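(* Let $\mathfrak g$ be of type $C_n$, let $\lambda=\sum_{i=1}^nm_i\omega_i\in P^+$ and $k=\sum_im_i$. For $1\le q\le k$ let $d(q)\in\{1,\dots,n\}$ be the index such that the $q$-th component of $r_\lambda$ is $\emptyset_{d(q)}$. Then the crystal $\mathcal R(\lambda)$ consists of all sequences $\mathbf x=(x_1,\dots,x_k,0,0,\dots)$ with $x_q\in\bigsqcup_s\mathcal R^{d(q)}_s$ for $1\le q\le k$ such that the following conditions hold for all pairs $(x_q,x_{q+1})$, $1\le q\le k-1$, where we write $x_q=(i_1,i_1')\cdots(i_s,i_s')\in\mathcal R^i_s$ and $x_{q+1}=(j_1,j_1')\cdots(j_t,j_t')\in\mathcal R^j_t$: 1. for all pairs $(x_q\ne\emptyset_i,\ x_{q+1}\ne\emptyset_j)$ we have - i) $\sharp\{i_r\mid 1\le i_r\le j_{t-p}\}\ge p+1$ for all $0\le p\le u:=\max\{0\le r\le t-1\mid j_{t-r}\le i\}$; - ii) $j_{t-p}\le i'_{j_{t-p}-p+s-i}$ for all $p\in\{u+1\le r\le t-1\mid j_{t-r}\le r+i\}$; - iii) $j_p'\le i'_{j-i+s-t+p}$ for all $1\le p\le i-j+t$; 2. there is no pair $(x_q,x_{q+1})$ of the form $(\emptyset_i,\ x_{q+1}\ne\emptyset_j)$ with $i\ge j_t$; 3. there is no pair $(x_q\ne\emptyset_i,\ x_{q+1})$ with the following property: there exist $i_p'\ge i_r'\ge n$ with - (a) $\overline{i_r'}-\delta_{\overline{i_r'},\{i+1,\dots,n\}}\notin(1-\delta_{\overline{i_r'},\{i+1,\dots,n\}})\{i_1,\dots,i_s\}\cup\delta_{\overline{i_r'},\{i+1,\dots,n\}}(\mathbf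 I-\{i_1',\dots,i_s'\})$, - (b) $\overline{i_p'}-\delta_{\overline{i_p'},\{j+1,\dots,n\}}\notin(1-\delta_{\overline{i_p'},\{j+1,\dots,n\}})\{j_1,\dots,j_t\}\cup\delta_{\overline{i_p'},\{j+1,\dots,n\}}(\mathbf I-\{j_1',\dots,j_t'\})$, - (c) $(p-r)+\sharp\{j_m\mid j_m<\overline{i_p'}\}-\sharp\{i_m\mid i_m<\overline{i_r'}\}+\sharp\{i_m'\mid i_m'<\overline{i_r'}\}-\sharp\{j_m'\mid j_m'<\overline{i_p'}\}\ge\max\{0,\overline{i_r'}-i\}-\max\{0,\overline{i_p'}-j\}$; 4. there is no pair $(x_q\ne\emptyset_i,\ x_{q+1}\ne\emptyset_j)$ with the following property: there exist $i_p'\ge j_r'\ge n$ with - (a) $\overline{i_p'}-\delta_{\overline{i_p'},\{j+1,\dots,n\}}\notin(1-\delta_{\overline{i_p'},\{j+1,\dots,n\}})\{j_1,\dots,j_t\}\cup\delta_{\overline{i_p'},\{j+1,\dots,n\}}(\mathbf I-\{j_1',\dots,j_t'\})$, - (b) $\overline{j_r'}-\delta_{\overline{j_r'},\{j+1,\dots,n\}}\notin(1-\delta_{\overline{j_r'},\{j+1,\dots,n\}})\{j_1,\dots,j_t\}\cup\delta_{\overline{j_r'},\{j+1,\dots,n\}}(\mathbf I-\{j_1',\dots,j_t'\})$, - (c) $(i-j)+(t-s)+(p-r)+\sharp\{j_m'\mid\overline{i_p'}\le j_m'<\overline{j_r'}\}-\sharp\{j_m\mid\overline{i_p'}\le j_m<\overline{j_r'}\}\ge\max\{0,\overline{j_r'}-j\}-\max\{0,\overline{i_p'}-j\}$.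 (If the set defining $u$ is empty, put $u=-1$. In condition 3, $x_{q+1}=\emptyset_j$, i.e. $t=0$, is allowed.)
   Context: **Notation in the claim.** For $A\subseteq\mathbf I$ and $y\in\mathbf I$, $\delta_{y,A}=1$ if $y\in A$ and $0$ otherwise; for $\nu\in\{0,1\}$, $\nu A=A$ if $\nu=1$ and $\nu A=\emptyset$ if $\nu=0$. If $y\in\mathbf I$, $y\ge n$, then $\overline y\in\{1,\dots,n\}$ is treated as an integer. **Lie algebra.** $\mathfrak g=\mathfrak{sp}_{2n}$ (type $C_n$), $I=\{1,\dots,n\}$, with simple roots $\alpha_l$, fundamental weights $\omega_l$ (standard numbering; $\alpha_n$ is long), $P^+=\bigoplus_i\mathbb Z_{\ge0}\omega_i$. Put, for $1\le i\le j\le n$, $\alpha_{i,j}=\alpha_i+\alpha_{i+1}+\dots+\alpha_j$ and $\alpha_{i,\overline j}=\alpha_i+\alpha_{i+1}+\dots+\alpha_n+\alpha_{n-1}+\dots+\alpha_j$. **Index set.** $\mathbf I=\{1<2<\dots<n<\overline{n-1}<\dots<\overline1\}$ (totally ordered as indicated). The bar is the involution of $\mathbf I$ with $\overline n=n$, $i\leftrightarrow\overline i$ for $1\le i\le n-1$. **Sequences.** For $1\le i\le n$, $s\ge0$, $\mathcal R^i_s$ is the set of sequences $(i_1,i_1')\cdots(i_s,i_s')$ with entries in $\mathbf I$ such that $1\le i_s<i_{s-1}<\dots<i_1\le i\le i_1'<i_2'<\dots<i_s'\le\overline1=\max\mathbf I$ and $i_j'\le\overline{i_j}$ for $j=1,\dots,s$.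 $\emptyset_i$ is the unique element of $\mathcal R^i_0$. Elements of $\mathcal R^i_s$ for different $i$ are regarded as distinct. $\mathcal R=\bigsqcup_{i,s}\mathcal R^i_s\sqcup\{0\}$, and $\mathcal R^\infty$ is the set of infinite sequences $\mathbf x=(x_1,x_2,\dots)$ with $x_j\in\mathcal R$ and only finitely many $x_j\ne0$ (each $\emptyset_i$ counts as non-zero; the component symbol $0$ is not the crystal symbol $0$). **Properties.** Let $x=(i_1,i_1')\cdots(i_s,i_s')\in\mathcal R^i_s$, $X=\{i_1,\dots,i_s\}$, $X'=\{i_1',\dots,i_s'\}$, $l\in I$. Convention: for $l=n$, the statements "$\overline l\in X'$" and "$\overline{l+1}\in X'$" below are regarded as false. (These properties are unrelated to the items (a),(b),(c) in the claim.) - (a): $l\notin X\cup X'$; and [$l+1\in X$ if $l<i$; $l-1\in X'$ if $l>i$; no condition if $l=i$]; and ($\overline{l+1}\in X'$ or $\overline l\notin X'$). - (a'): as (a), with the last clause replaced by ($\overline{l+1}\in X'$ and $\overline l\notin X'$). - (b): $\overline l\notin X'$, $\overline{l+1}\in X'$; and [$l+1\notin X$ or $l\in X$, if $l<i$; $l-1\notin X'$ or $l\in X'$, if $l>i$; $l=i_1$ or $l=i_1'$, if $l=i$]. - (c): $l\in X\cup X'$; and [$l+1\notin X$ if $l<i$; $l-1\notin X'$ if $l>i$; $(i_1,i_1')=(l,l)$ if $l=i$]; and ($\overline{l+1}\in X'$ or $\overline l\notin X'$). - (d): $\overline l\in X'$, $\overline{l+1}\notin X'$; and [$l+1\notin X$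 or $l\in X$, if $l<i$; $l-1\notin X'$ or $l\in X'$, if $l>i$; $l=i_1$ or $l=i_1'$, if $l=i$]. - (d'): as (d), with every "or" replaced by "and". **Maps $\theta_l,\rho_l$.** For $x\in\mathcal R^i_s$: if $x$ satisfies (a), $\theta_l(x)$ arises from $x$ by replacing $l+1$ by $l$ among the $i_k$ (if $l<i$), replacing $l-1$ by $l$ among the $i_k'$ (if $l>i$), adding the pair $(l,l)$ (if $l=i$); if $x$ satisfies (b), $\theta_l(x)$ arises by replacing $\overline{l+1}$ by $\overline l$; otherwise $\theta_l(x)=0$. If $x$ satisfies (c), $\rho_l(x)$ arises by replacing $l$ by $l+1$ among the $i_k$ (if $l<i$), $l$ by $l-1$ among the $i_k'$ (if $l>i$), erasing $(l,l)$ (if $l=i$); if $x$ satisfies (d), $\rho_l(x)$ arises by replacing $\overline l$ by $\overline{l+1}$; otherwise $\rho_l(x)=0$. The results have the same superscript $i$. **Crystal structure on $\mathcal R^\infty$.** Let $x_{q_1},\dots,x_{q_k}$ ($q_1<\dots<q_k$) be the non-zero components of $\mathbf x$. Put $\mathrm{wt}(\mathbf x)=\sum_{i=1}^nc_i\omega_i-\sum_j\mathrm{wt}(x_j)$, with $c_i$ the number of components in $\bigsqcup_s\mathcal R^i_s$, $\mathrm{wt}((i_1,i_1')\cdots(i_s,i_s'))=\sum_{r}\alpha_{i_r,i_r'}$, $\mathrm{wt}(0)=\mathrm{wt}(\emptyset_i)=0$. Put $\sigma_l^1=\tau_l^1=0$; for $2\le j\le k+1$, $\sigma_l^j(\mathbf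 x)=\sharp\{1\le p\le j-1: x_{q_p}\text{ satisfies (a) or (b)}\}+\sharp\{1\le p\le j-1:x_{q_p}\text{ satisfies (a')}\}$; for $2\le j\le k$, $\tau_l^j(\mathbf x)=\sharp\{2\le p\le j:x_{q_p}\text{ satisfies (c) or (d)}\}+\sharp\{2\le p\le j:x_{q_p}\text{ satisfies (d')}\}$. Let $\mu_l=\min_{1\le j\le k}(\sigma_l^j(\mathbf x)-\tau_l^j(\mathbf x))$, and let $f_l(\mathbf x)$ (resp. $e_l(\mathbf x)$) be the largest (resp. smallest) $p\in\{1,\dots,k\}$ with $\sigma_l^p(\mathbf x)-\tau_l^p(\mathbf x)=\mu_l$. Then $\tilde f_l\mathbf x$ is obtained by replacing the component $x_{q_p}$, $p=f_l(\mathbf x)$, by $\theta_l(x_{q_p})$ if this is $\ne0$, and $\tilde f_l\mathbf x=0$ otherwise; $\tilde e_l\mathbf x$ is obtained by replacing $x_{q_p}$, $p=e_l(\mathbf x)$, by $\rho_l(x_{q_p})$ if this is $\neq0$, and $\tilde e_l\mathbf x=0$ otherwise. Finally $\epsilon_l(\mathbf x)=\tau_l^2((\emptyset_1,x_{q_1},0,0,\dots))-\mu_l$ and $\varphi_l(\mathbf x)=\sigma_l^{k+1}(\mathbf x)-\tau_l^k(\mathbf x)-\mu_l$. For $\mathbf x=(0,0,\dots)$ put $\tilde e_l\mathbf x=\tilde f_l\mathbf x=0$, $\epsilon_l(\mathbf x)=\varphi_l(\mathbf x)=0$. **$\mathcal R(\lambda)$.** For $\lambda=\sum_im_i\omega_i\in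 P^+$, $r_\lambda=(\emptyset_1,\dots,\emptyset_1,\dots,\emptyset_n,\dots,\emptyset_n,0,0,\dots)$ with $\emptyset_i$ occurring $m_i$ times, and $\mathcal R(\lambda)$ is the connected component of $\mathcal R^\infty$ containing $r_\lambda$ (in the graph with arrows $\mathbf x\to\tilde f_l\mathbf x$). *)

theory Defs
  imports Main
begin

text \<open>
  The ordered set \<open>1 < 2 < \<dots> < n < bar (n - 1) < \<dots> < bar 1\<close> is represented by
  the naturals \<open>1, \<dots>, 2 * n - 1\<close> in their usual order: \<open>y \<le> n\<close> stands for itself and
  \<open>bar y\<close> (for \<open>1 \<le> y \<le> n\<close>) is \<open>2 * n - y\<close>. In particular \<open>bar n = n\<close>, and for
  \<open>y \<ge> n\<close> the value \<open>bar n y\<close> is the integer \<open>1 \<le> bar n y \<le> n\<close>.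
\<close>

definition letters :: "nat \<Rightarrow> nat set" where
  "letters n = {1..2 * n - 1}"

definition bar :: "nat \<Rightarrow> nat \<Rightarrow> nat" where
  "bar n y = 2 * n - y"

type_synonym pseq = "(nat \<times> nat) list"

definition Rseq :: "nat \<Rightarrow> nat \<Rightarrow> nat \<Rightarrow> pseq set" where
  "Rseq n i s = {ps. length ps = s \<and> set ps \<subseteq> letters n \<times> letters n
     \<and> sorted_wrt (>) (map fst ps) \<and> sorted_wrt (<) (map snd ps)
     \<and> (\<forall>(a, b) \<in> set ps. a \<le> i \<and> i \<le> b \<and> b \<le> bar n a)}"

text \<open>
  \<open>Elem i ps\<close> is the sequence \<open>ps\<close> with superscript \<open>i\<close>; the tag keeps equal sequences with
  different superscripts apart. \<open>Zero\<close> is the component symbol 0, whereas the crystal symbol 0 is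
  \<open>None\<close> below.
\<close>

datatype component = Zero | Elem nat pseq

definition R_comps :: "nat \<Rightarrow> component set" where
  "R_comps n = (\<Union>i\<in>{1..n}. \<Union>s. Elem i ` Rseq n i s) \<union> {Zero}"

text \<open>Infinite sequences are indexed from 0: \<open>x q\<close> is the (q + 1)-st component.\<close>

definition R_inf :: "nat \<Rightarrow> (nat \<Rightarrow> component) set" where
  "R_inf n = {x. (\<forall>q. x q \<in> R_comps n) \<and> finite {q. x q \<noteq> Zero}}"

abbreviation unprimed :: "pseq \<Rightarrow> nat set" where
  "unprimed ps \<equiv> set (map fst ps)"

abbreviation primed :: "pseq \<Rightarrow> nat set" where
  "primed ps \<equiv> set (map snd ps)"

text \<open>
  The statements that \<open>bar l\<close>, respectively \<open>bar (l + 1)\<close>, occurs among the primed entries; by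
  convention both are false for \<open>l = n\<close>.
\<close>

definition has_bar :: "nat \<Rightarrow> pseq \<Rightarrow> nat \<Rightarrow> bool" where
  "has_bar n ps l \<longleftrightarrow> l < n \<and> bar n l \<in> primed ps"

definition has_bar_Suc :: "nat \<Rightarrow> pseq \<Rightarrow> nat \<Rightarrow> bool" where
  "has_bar_Suc n ps l \<longleftrightarrow> l < n \<and> bar n (l + 1) \<in> primed ps"

text \<open>
  Whenever \<open>hd ps\<close> is relevant below, \<open>ps \<noteq> []\<close> follows from the other conjuncts.
\<close>

definition prop_a_base :: "nat \<Rightarrow> pseq \<Rightarrow> nat \<Rightarrow> bool" where
  "prop_a_base i ps l \<longleftrightarrow> l \<notin> unprimed ps \<union> primed ps
     \<and> (l < i \<longrightarrow> l + 1 \<in> unprimed ps)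
     \<and> (l > i \<longrightarrow> l - 1 \<in> primed ps)"

definition prop_a :: "nat \<Rightarrow> nat \<Rightarrow> nat \<Rightarrow> pseq \<Rightarrow> bool" where
  "prop_a n l i ps \<longleftrightarrow> prop_a_base i ps l \<and> (has_bar_Suc n ps l \<or> \<not> has_bar n ps l)"

definition prop_a' :: "nat \<Rightarrow> nat \<Rightarrow> nat \<Rightarrow> pseq \<Rightarrow> bool" where
  "prop_a' n l i ps \<longleftrightarrow> prop_a_base i ps l \<and> (has_bar_Suc n ps l \<and> \<not> has_bar n ps l)"

definition prop_b :: "nat \<Rightarrow> nat \<Rightarrow> nat \<Rightarrow> pseq \<Rightarrow> bool" where
  "prop_b n l i ps \<longleftrightarrow> \<not> has_bar n ps l \<and> has_bar_Suc n ps l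
     \<and> (l < i \<longrightarrow> l + 1 \<notin> unprimed ps \<or> l \<in> unprimed ps)
     \<and> (l > i \<longrightarrow> l - 1 \<notin> primed ps \<or> l \<in> primed ps)
     \<and> (l = i \<longrightarrow> l = fst (hd ps) \<or> l = snd (hd ps))"

definition prop_c :: "nat \<Rightarrow> nat \<Rightarrow> nat \<Rightarrow> pseq \<Rightarrow> bool" where
  "prop_c n l i ps \<longleftrightarrow> l \<in> unprimed ps \<union> primed ps
     \<and> (l < i \<longrightarrow> l + 1 \<notin> unprimed ps)
     \<and> (l > i \<longrightarrow> l - 1 \<notin> primed ps)
     \<and> (l = i \<longrightarrow> hd ps = (l, l))
     \<and> (has_bar_Suc n ps l \<or> \<not> has_bar n ps l)"

definition prop_d :: "nat \<Rightarrow> nat \<Rightarrow> nat \<Rightarrow> pseq \<Rightarrow> bool" where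
  "prop_d n l i ps \<longleftrightarrow> has_bar n ps l \<and> \<not> has_bar_Suc n ps l
     \<and> (l < i \<longrightarrow> l + 1 \<notin> unprimed ps \<or> l \<in> unprimed ps)
     \<and> (l > i \<longrightarrow> l - 1 \<notin> primed ps \<or> l \<in> primed ps)
     \<and> (l = i \<longrightarrow> l = fst (hd ps) \<or> l = snd (hd ps))"

definition prop_d' :: "nat \<Rightarrow> nat \<Rightarrow> nat \<Rightarrow> pseq \<Rightarrow> bool" where
  "prop_d' n l i ps \<longleftrightarrow> has_bar n ps l \<and> \<not> has_bar_Suc n ps l
     \<and> (l < i \<longrightarrow> l + 1 \<notin> unprimed ps \<and> l \<in> unprimed ps)
     \<and> (l > i \<longrightarrow> l - 1 \<notin> primed ps \<and> l \<in> primed ps)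
     \<and> (l = i \<longrightarrow> l = fst (hd ps) \<and> l = snd (hd ps))"

definition replace :: "nat \<Rightarrow> nat \<Rightarrow> nat \<Rightarrow> nat" where
  "replace a b y = (if y = a then b else y)"

text \<open>
  In the case \<open>l = i\<close> of property (a) all unprimed entries are below \<open>l\<close> and all primed ones
  above \<open>l\<close>, so that the new pair \<open>(l, l)\<close> comes first.
\<close>

definition theta :: "nat \<Rightarrow> nat \<Rightarrow> nat \<Rightarrow> pseq \<Rightarrow> component option" where
  "theta n l i ps =
    (if prop_a n l i ps then Some (Elem i
       (if l < i then map (\<lambda>(a, b). (replace (l + 1) l a, b)) ps
        else if l > i then map (\<lambda>(a, b). (a, replace (l - 1) l b)) ps
        else (l, l) # ps))
     else if prop_b n l i ps then Some (Elem i
       (map (\<lambda>(a, b). (a, replace (bar n (l + 1)) (bar n l) b)) ps))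
     else None)"

definition sat :: "(nat \<Rightarrow> pseq \<Rightarrow> bool) \<Rightarrow> component \<Rightarrow> bool" where
  "sat P c = (case c of Zero \<Rightarrow> False | Elem i ps \<Rightarrow> P i ps)"

definition nz_count :: "(nat \<Rightarrow> component) \<Rightarrow> nat" where
  "nz_count x = card {q. x q \<noteq> Zero}"

text \<open>\<open>nz_pos x p\<close> is the position of the \<open>p\<close>-th non-zero component, \<open>1 \<le> p \<le> nz_count x\<close>.\<close>

definition nz_pos :: "(nat \<Rightarrow> component) \<Rightarrow> nat \<Rightarrow> nat" where
  "nz_pos x p = sorted_list_of_set {q. x q \<noteq> Zero} ! (p - 1)"

definition sigma :: "nat \<Rightarrow> nat \<Rightarrow> (nat \<Rightarrow> component) \<Rightarrow> nat \<Rightarrow> nat" where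
  "sigma n l x j =
     card {p \<in> {1..<j}. sat (\<lambda>i ps. prop_a n l i ps \<or> prop_b n l i ps) (x (nz_pos x p))}
   + card {p \<in> {1..<j}. sat (prop_a' n l) (x (nz_pos x p))}"

definition tau :: "nat \<Rightarrow> nat \<Rightarrow> (nat \<Rightarrow> component) \<Rightarrow> nat \<Rightarrow> nat" where
  "tau n l x j =
     card {p \<in> {2..j}. sat (\<lambda>i ps. prop_c n l i ps \<or> prop_d n l i ps) (x (nz_pos x p))}
   + card {p \<in> {2..j}. sat (prop_d' n l) (x (nz_pos x p))}"

definition sig_diff :: "nat \<Rightarrow> nat \<Rightarrow> (nat \<Rightarrow> component) \<Rightarrow> nat \<Rightarrow> int" where
  "sig_diff n l x j = int (sigma n l x j) - int (tau n l x j)"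

definition mu :: "nat \<Rightarrow> nat \<Rightarrow> (nat \<Rightarrow> component) \<Rightarrow> int" where
  "mu n l x = Min (sig_diff n l x ` {1..nz_count x})"

definition f_index :: "nat \<Rightarrow> nat \<Rightarrow> (nat \<Rightarrow> component) \<Rightarrow> nat" where
  "f_index n l x = Max {p \<in> {1..nz_count x}. sig_diff n l x p = mu n l x}"

definition f_op :: "nat \<Rightarrow> nat \<Rightarrow> (nat \<Rightarrow> component) \<Rightarrow> (nat \<Rightarrow> component) option" where
  "f_op n l x =
    (if nz_count x = 0 then None
     else let q = nz_pos x (f_index n l x) in
       (case x q of
          Zero \<Rightarrow> None
        | Elem i ps \<Rightarrow> map_option (\<lambda>c. x(q := c)) (theta n l i ps)))"

definition f_arrow :: "nat \<Rightarrow> (nat \<Rightarrow> component) \<Rightarrow> (nat \<Rightarrow> component) \<Rightarrow> bool" where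
  "f_arrow n x y \<longleftrightarrow> x \<in> R_inf n \<and> y \<in> R_inf n \<and> (\<exists>l\<in>{1..n}. f_op n l x = Some y)"

text \<open>
  A dominant weight \<open>\<lambda> = (\<Sum>i=1..n. m i * \<omega>\<^sub>i)\<close> is given by its coefficients \<open>m\<close>.
\<close>

definition r_seq :: "nat \<Rightarrow> (nat \<Rightarrow> nat) \<Rightarrow> nat \<Rightarrow> component" where
  "r_seq n m q =
    (let cs = concat (map (\<lambda>i. replicate (m i) (Elem i [])) [1..<n + 1])
     in if q < length cs then cs ! q else Zero)"

definition R_lambda :: "nat \<Rightarrow> (nat \<Rightarrow> nat) \<Rightarrow> (nat \<Rightarrow> component) set" where
  "R_lambda n m = {x. equivclp (f_arrow n) (r_seq n m) x}"

text \<open>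
  Entries of a sequence with 1-based integer subscripts. Subscripts are integers because the
  subscript expressions in the conditions involve differences. If i) of condition 1 holds, all
  subscripts in ii) and iii) lie between 1 and the length (for \<open>i \<le> j\<close>), hence the values outside
  that range are immaterial.
\<close>

definition entry :: "pseq \<Rightarrow> int \<Rightarrow> nat" where
  "entry ps r = fst (ps ! nat (r - 1))"

definition entry' :: "pseq \<Rightarrow> int \<Rightarrow> nat" where
  "entry' ps r = snd (ps ! nat (r - 1))"

definition len :: "pseq \<Rightarrow> int" where
  "len ps = int (length ps)"

text \<open>
  In the conditions, the two neighbouring components are \<open>Elem i xs\<close> and \<open>Elem j ys\<close>.
\<close>

definition u_bound :: "nat \<Rightarrow> pseq \<Rightarrow> int" where
  "u_bound i ys =
    (let U = {r \<in> {0..len ys - 1}. entry ys (len ys - r) \<le> i}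
     in if U = {} then -1 else Max U)"

definition cond1 :: "nat \<Rightarrow> pseq \<Rightarrow> nat \<Rightarrow> pseq \<Rightarrow> bool" where
  "cond1 i xs j ys \<longleftrightarrow>
    (let s = len xs; t = len ys; u = u_bound i ys in
      xs \<noteq> [] \<and> ys \<noteq> [] \<longrightarrow>
        (\<forall>p\<in>{0..u}. int (card {a \<in> unprimed xs. 1 \<le> a \<and> a \<le> entry ys (t - p)}) \<ge> p + 1)
      \<and> (\<forall>p\<in>{r \<in> {u + 1..t - 1}. int (entry ys (t - r)) \<le> r + int i}.
            entry ys (t - p) \<le> entry' xs (int (entry ys (t - p)) - p + s - int i))
      \<and> (\<forall>p\<in>{1..int i - int j + t}.
            entry' ys p \<le> entry' xs (int j - int i + s - t + p)))"

definition cond2 :: "nat \<Rightarrow> pseq \<Rightarrow> nat \<Rightarrow> pseq \<Rightarrow> bool" where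
  "cond2 i xs j ys \<longleftrightarrow> \<not> (xs = [] \<and> ys \<noteq> [] \<and> i \<ge> entry ys (len ys))"

definition delta :: "nat \<Rightarrow> nat set \<Rightarrow> nat" where
  "delta y A = (if y \<in> A then 1 else 0)"

definition scale :: "nat \<Rightarrow> nat set \<Rightarrow> nat set" where
  "scale \<nu> A = (if \<nu> = 1 then A else {})"

definition avoids :: "nat \<Rightarrow> nat \<Rightarrow> nat \<Rightarrow> pseq \<Rightarrow> bool" where
  "avoids n y i ps \<longleftrightarrow>
    (let d = delta y {i + 1..n} in
      y - d \<notin> scale (1 - d) (unprimed ps) \<union> scale d (letters n - primed ps))"

definition excess :: "nat \<Rightarrow> nat \<Rightarrow> int" where
  "excess y i = max 0 (int y - int i)"

definition cond3 :: "nat \<Rightarrow> nat \<Rightarrow> pseq \<Rightarrow> nat \<Rightarrow> pseq \<Rightarrow> bool" where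
  "cond3 n i xs j ys \<longleftrightarrow>
    \<not> (xs \<noteq> [] \<and>
      (\<exists>p\<in>{1..len xs}. \<exists>r\<in>{1..len xs}.
        let a = bar n (entry' xs p); b = bar n (entry' xs r) in
          entry' xs p \<ge> entry' xs r \<and> entry' xs r \<ge> n
        \<and> avoids n b i xs
        \<and> avoids n a j ys
        \<and> (p - r) + int (card {y \<in> unprimed ys. y < a}) - int (card {y \<in> unprimed xs. y < b})
            + int (card {y \<in> primed xs. y < b}) - int (card {y \<in> primed ys. y < a})
          \<ge> excess b i - excess a j))"

definition cond4 :: "nat \<Rightarrow> nat \<Rightarrow> pseq \<Rightarrow> nat \<Rightarrow> pseq \<Rightarrow> bool" where
  "cond4 n i xs j ys \<longleftrightarrow>
    \<not> (xs \<noteq> [] \<and> ys \<noteq> [] \<and>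
      (\<exists>p\<in>{1..len xs}. \<exists>r\<in>{1..len ys}.
        let a = bar n (entry' xs p); b = bar n (entry' ys r) in
          entry' xs p \<ge> entry' ys r \<and> entry' ys r \<ge> n
        \<and> avoids n a j ys
        \<and> avoids n b j ys
        \<and> (int i - int j) + (len ys - len xs) + (p - r)
            + int (card {y \<in> primed ys. a \<le> y \<and> y < b})
            - int (card {y \<in> unprimed ys. a \<le> y \<and> y < b})
          \<ge> excess b j - excess a j))"

end

theory Submission
  imports Defs
begin

text \<open>
  Replace a sequence with superscript \<open>i\<close> by its column: the \<open>i\<close>-element set of letters
  \<open>1, \<dots>, 2 * n\<close> obtained from \<open>{1..i}\<close> by removing the unprimed entries and inserting \<open>b + 1\<close> for
  every primed entry \<open>b\<close>; the letter \<open>2 * n + 1 - a\<close> is the barred letter of \<open>a \<le> n\<close>. Write \<open>A\<close> and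
  \<open>B\<close> for the counting functions of the unbarred, respectively barred, letters up to \<open>a\<close>. The columns
  that occur are those with \<open>A a + B a \<le> a\<close> for all \<open>a \<le> n\<close> (Kashiwara--Nakashima columns), and
  \<open>\<theta>\<^sub>l\<close> is the usual crystal operator on them. For the columns \<open>R\<close>, \<open>L\<close> of \<open>x\<^sub>q\<close>, \<open>x\<^sub>q\<^sub>+\<^sub>1\<close>, of heights
  \<open>i \<le> j\<close>, conditions 1--4 amount to the inequalities
  \<open>A\<^sub>L a + B\<^sub>R a - a \<ge> max (A\<^sub>R b + B\<^sub>R b - b) (A\<^sub>L b + B\<^sub>L b - b + i - j)\<close> for all \<open>a \<le> b \<le> n\<close>: the case
  \<open>a = b\<close> is condition 1 (and 2), and a violated inequality with \<open>b - a\<close> minimal gives a forbidden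
  configuration of condition 3 or 4. Since an operator with index \<open>l\<close> changes \<open>A\<close> and \<open>B\<close> only at
  \<open>l\<close>, the inequalities are stable in both directions under the tensor product rule, which only
  involves neighbours of the component acted upon. Finally, every sequence that satisfies the
  inequalities and is not \<open>r\<^sub>\<lambda>\<close> has an incoming arrow, and arrows increase the sum of all letters.
\<close>

section \<open>Columns\<close>

definition cnt :: "nat set \<Rightarrow> nat \<Rightarrow> int" where
  "cnt C y = int (card (C \<inter> {1..y}))"

definition cnt_bar :: "nat \<Rightarrow> nat set \<Rightarrow> nat \<Rightarrow> int" where
  "cnt_bar n C a = int (card (C \<inter> {2 * n + 1 - a..2 * n}))"

definition slack :: "nat \<Rightarrow> nat set \<Rightarrow> nat \<Rightarrow> int" where
  "slack n C a = cnt C a + cnt_bar n C a - int a"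

definition admissible :: "nat \<Rightarrow> nat \<Rightarrow> nat set \<Rightarrow> bool" where
  "admissible n i C \<longleftrightarrow> C \<subseteq> {1..2 * n} \<and> card C = i \<and> (\<forall>a\<le>n. slack n C a \<le> 0)"

text \<open>A pair \<open>(a, b)\<close> moves the letter \<open>a\<close> to \<open>b + 1\<close>:
  the simple step \<open>b\<close> leads from letter \<open>b\<close> to letter
  \<open>b + 1\<close>, so that the weight drops exactly by the root attached to the pair. The shift
  also reconciles \<open>2 * n\<close> letters with \<open>2 * n - 1\<close> indices.\<close>

definition column :: "nat \<Rightarrow> pseq \<Rightarrow> nat set" where
  "column i ps = ({1..i} - unprimed ps) \<union> Suc ` primed ps"

text \<open>The part of \<open>Rseq\<close> that fixes a sequence by its column. The bound
  \<open>b \<le> bar n a\<close> is kept apart, since on columns it turns into the inequality of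
  \<open>admissible\<close>; the operators are first computed at this coarser level.\<close>

definition bisorted :: "nat \<Rightarrow> pseq \<Rightarrow> bool" where
  "bisorted i ps \<longleftrightarrow> sorted_wrt (>) (map fst ps) \<and> sorted_wrt (<) (map snd ps)
     \<and> (\<forall>(a, b) \<in> set ps. 1 \<le> a \<and> a \<le> i \<and> i \<le> b)"

section \<open>Counting letters\<close>

lemma cnt_0 [simp]: "cnt C 0 = 0"
  by (simp add: cnt_def)

lemma cnt_Suc: "cnt C (Suc a) = cnt C a + of_bool (Suc a \<in> C)"
proof -
  have "C \<inter> {1..Suc a} = (if Suc a \<in> C then insert (Suc a) (C \<inter> {1..a}) else C \<inter> {1..a})"
    by (auto simp: le_Suc_eq)
  then show ?thesis by (auto simp: cnt_def)
qed

lemma cnt_bar_0 [simp]: "cnt_bar n C 0 = 0"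
  by (simp add: cnt_bar_def)

lemma cnt_bar_Suc:
  assumes "a < n"
  shows "cnt_bar n C (Suc a) = cnt_bar n C a + of_bool (2 * n - a \<in> C)"
proof -
  have "2 * n + 1 - Suc a = 2 * n - a" "2 * n + 1 - a = Suc (2 * n - a)" using assms by auto
  moreover have "{2 * n - a..2 * n} = insert (2 * n - a) {Suc (2 * n - a)..2 * n}" by auto
  ultimately have "C \<inter> {2 * n + 1 - Suc a..2 * n} = (if 2 * n - a \<in> C
      then insert (2 * n - a) (C \<inter> {2 * n + 1 - a..2 * n}) else C \<inter> {2 * n + 1 - a..2 * n})"
    by auto
  then show ?thesis using assms by (auto simp: cnt_bar_def)
qed

text \<open>The barred letters of \<open>1, \<dots>, a\<close> are the letters above
  \<open>2 * n - a\<close>. This complement turns statements about rows beyond \<open>n\<close> into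
  statements about \<open>cnt_bar\<close>.\<close>

lemma cnt_cnt_bar:
  assumes "C \<subseteq> {1..2 * n}" "a \<le> 2 * n"
  shows "cnt C (2 * n - a) + cnt_bar n C a = int (card C)"
proof -
  have "C = (C \<inter> {1..2 * n - a}) \<union> (C \<inter> {2 * n + 1 - a..2 * n})" using assms by auto
  moreover have "card ((C \<inter> {1..2 * n - a}) \<union> (C \<inter> {2 * n + 1 - a..2 * n}))
      = card (C \<inter> {1..2 * n - a}) + card (C \<inter> {2 * n + 1 - a..2 * n})"
    by (rule card_Un_disjoint) auto
  ultimately show ?thesis by (simp add: cnt_def cnt_bar_def)
qed

lemma cnt_plus_bar_le:
  assumes "C \<subseteq> {1..2 * n}" "a \<le> n"
  shows "cnt C a + cnt_bar n C a \<le> int (card C)"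
proof -
  have "card ((C \<inter> {1..a}) \<union> (C \<inter> {2 * n + 1 - a..2 * n}))
      = card (C \<inter> {1..a}) + card (C \<inter> {2 * n + 1 - a..2 * n})"
    by (rule card_Un_disjoint) (use assms in auto)
  moreover have "card ((C \<inter> {1..a}) \<union> (C \<inter> {2 * n + 1 - a..2 * n})) \<le> card C"
    using assms by (intro card_mono finite_subset[OF assms(1)]) auto
  ultimately show ?thesis by (simp add: cnt_def cnt_bar_def)
qed

section \<open>Sequences versus admissible columns\<close>

lemma bisortedD:
  assumes "bisorted i ps"
  shows "unprimed ps \<subseteq> {1..i}" "primed ps \<subseteq> {i..}" "distinct (map fst ps)" "distinct (map snd ps)"
    "sorted_wrt (<) (rev (map fst ps))" "sorted_wrt (<) (map snd ps)"
    "card (unprimed ps) = length ps" "card (primed ps) = length ps"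
proof -
  show "unprimed ps \<subseteq> {1..i}" "primed ps \<subseteq> {i..}" using assms by (auto simp: bisorted_def)
  show s: "sorted_wrt (<) (rev (map fst ps))" "sorted_wrt (<) (map snd ps)"
    using assms by (auto simp: bisorted_def sorted_wrt_rev)
  have "distinct (rev (map fst ps))" using s(1) strict_sorted_iff by blast
  then show d: "distinct (map fst ps)" by simp
  show d': "distinct (map snd ps)" using s(2) strict_sorted_iff by blast
  show "card (unprimed ps) = length ps" "card (primed ps) = length ps"
    using d d' distinct_card by fastforce+
qed

lemma Rseq_bisorted:
  assumes "ps \<in> Rseq n i s" shows "bisorted i ps"
  using assms by (auto simp: Rseq_def bisorted_def letters_def)

lemma mem_column:
  assumes "bisorted i ps"
  shows "y \<in> column i ps \<longleftrightarrow>
    (if y \<le> i then y \<ge> 1 \<and> y \<notin> unprimed ps else y - 1 \<in> primed ps)"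
  using bisortedD(1,2)[OF assms] by (force simp: column_def image_iff)

lemma unprimed_column:
  assumes "bisorted i ps" shows "unprimed ps = {1..i} - column i ps"
  using bisortedD(1)[OF assms] mem_column[OF assms] by (auto simp del: set_map)

lemma primed_column:
  assumes "bisorted i ps" shows "primed ps = {b. i \<le> b \<and> Suc b \<in> column i ps}"
  using bisortedD(2)[OF assms] mem_column[OF assms] by auto

text \<open>The column determines the sets of unprimed and of primed entries, and the strict orders
  recover the two lists from these sets.\<close>

lemma column_inj:
  assumes "bisorted i ps" "bisorted i qs" "column i ps = column i qs"
  shows "ps = qs"
proof -
  have "rev (map fst ps) = rev (map fst qs)"
    using assms bisortedD[OF assms(1)] bisortedD[OF assms(2)]
    by (intro strict_sorted_equal) (auto simp only: set_rev unprimed_column)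
  moreover have "map snd ps = map snd qs"
    using assms bisortedD[OF assms(1)] bisortedD[OF assms(2)]
    by (intro strict_sorted_equal) (auto simp only: primed_column)
  ultimately show ?thesis by (metis rev_rev_ident zip_map_fst_snd)
qed

text \<open>Primed entries are counted with \<open>b < y\<close> because \<open>b\<close>
  contributes the letter \<open>b + 1\<close>.\<close>

lemma cnt_column:
  assumes "bisorted i ps"
  shows "cnt (column i ps) y = int (min y i) - int (card {a \<in> unprimed ps. a \<le> y})
    + int (card {b \<in> primed ps. b < y})"
proof -
  note b = bisortedD(1,2)[OF assms]
  have "column i ps \<inter> {1..y} = ({1..min y i} - {a \<in> unprimed ps. a \<le> y})
      \<union> Suc ` {b \<in> primed ps. b < y}"
    using b by (auto simp: column_def)
  moreover have "card \<dots> = card ({1..min y i} - {a \<in> unprimed ps. a \<le> y})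
      + card (Suc ` {b \<in> primed ps. b < y})"
    using b by (intro card_Un_disjoint) (fastforce)+
  moreover have "card ({1..min y i} - {a \<in> unprimed ps. a \<le> y})
      = min y i - card {a \<in> unprimed ps. a \<le> y}"
    using b by (subst card_Diff_subset) auto
  moreover have "card {a \<in> unprimed ps. a \<le> y} \<le> min y i"
  proof -
    have "{a \<in> unprimed ps. a \<le> y} \<subseteq> {1..min y i}" using b by auto
    from card_mono[OF _ this] show ?thesis by simp
  qed
  moreover have "card (Suc ` {b \<in> primed ps. b < y}) = card {b \<in> primed ps. b < y}"
    by (intro card_image) auto
  ultimately have "card (column i ps \<inter> {1..y})
      = min y i - card {a \<in> unprimed ps. a \<le> y} + card {b \<in> primed ps. b < y}"
    and "card {a \<in> unprimed ps. a \<le> y} \<le> min y i"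
    by (simp_all only:)
  then show ?thesis unfolding cnt_def by linarith
qed

text \<open>As \<open>i \<le> n\<close>, the letters above \<open>2 * n - a\<close> exceed
  \<open>i\<close> and hence all come from primed entries.\<close>

lemma cnt_bar_column:
  assumes "bisorted i ps" "primed ps \<subseteq> {..<2 * n}" "i \<le> n" "a \<le> n"
  shows "cnt_bar n (column i ps) a = int (card {b \<in> primed ps. 2 * n - a \<le> b})"
proof -
  have "column i ps \<inter> {2 * n + 1 - a..2 * n} = Suc ` {b \<in> primed ps. 2 * n - a \<le> b}"
  proof (intro set_eqI iffI)
    fix y assume "y \<in> column i ps \<inter> {2 * n + 1 - a..2 * n}"
    then have "\<not> y \<le> i" "y - 1 \<in> primed ps" "2 * n - a \<le> y - 1" "y = Suc (y - 1)"
      using assms mem_column[OF assms(1), of y] by (auto simp del: set_map split: if_splits)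
    then show "y \<in> Suc ` {b \<in> primed ps. 2 * n - a \<le> b}" by blast
  next
    fix y assume "y \<in> Suc ` {b \<in> primed ps. 2 * n - a \<le> b}"
    then show "y \<in> column i ps \<inter> {2 * n + 1 - a..2 * n}"
      using assms by (force simp: column_def)
  qed
  then show ?thesis by (simp add: cnt_bar_def card_image)
qed

lemma card_column:
  assumes "bisorted i ps" shows "card (column i ps) = i"
proof -
  note b = bisortedD[OF assms]
  have "card (column i ps) = card ({1..i} - unprimed ps) + card (Suc ` primed ps)"
    unfolding column_def using b by (intro card_Un_disjoint) fastforce+
  also have "\<dots> = i"
    using b card_mono[OF _ b(1)] by (simp add: card_Diff_subset card_image)
  finally show ?thesis .
qed

text \<open>For \<open>a \<le> i\<close>, a pair whose second entry is at least
  \<open>2 * n - a\<close> has first entry at most \<open>a\<close>, because the second entry is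
  bounded by the bar of the first; so there are at most as many barred letters as removed ones. For
  \<open>a > i\<close> the column has fewer than \<open>a\<close> letters.\<close>

lemma Rseq_admissible:
  assumes "ps \<in> Rseq n i s" "1 \<le> i" "i \<le> n"
  shows "admissible n i (column i ps)"
proof -
  note bs = Rseq_bisorted[OF assms(1)]
  note b = bisortedD[OF bs]
  have le: "\<And>a b. (a, b) \<in> set ps \<Longrightarrow> b \<le> 2 * n - a \<and> 1 \<le> b \<and> b < 2 * n"
    using assms by (force simp: Rseq_def letters_def bar_def)
  have pl: "primed ps \<subseteq> {..<2 * n}" using le by auto
  have sub: "column i ps \<subseteq> {1..2 * n}"
    using assms pl by (auto simp: column_def)
  have "slack n (column i ps) a \<le> 0" if "a \<le> n" for a
  proof (cases "a \<le> i")
    case True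
    have "{b \<in> primed ps. 2 * n - a \<le> b} = snd ` {z \<in> set ps. 2 * n - a \<le> snd z}" by auto
    then have "card {b \<in> primed ps. 2 * n - a \<le> b} \<le> card {z \<in> set ps. 2 * n - a \<le> snd z}"
      by (simp add: card_image_le)
    also have "\<dots> \<le> card {z \<in> set ps. fst z \<le> a}"
      using le that assms(3) by (intro card_mono subsetI) (force, fastforce)
    also have "\<dots> = card (fst ` {z \<in> set ps. fst z \<le> a})"
      using b(3) by (intro card_image[symmetric]) (auto simp: distinct_map intro: inj_on_subset)
    also have "fst ` {z \<in> set ps. fst z \<le> a} = {x \<in> unprimed ps. x \<le> a}" by auto
    finally have *: "card {b \<in> primed ps. 2 * n - a \<le> b} \<le> card {x \<in> unprimed ps. x \<le> a}" .
    have "{b \<in> primed ps. b < a} = {}" using b(2) True by auto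
    then show ?thesis
      using * True cnt_column[OF bs, of a] cnt_bar_column[OF bs pl assms(3) that]
      unfolding slack_def by (simp only: card.empty)
  next
    case False
    then show ?thesis
      using cnt_plus_bar_le[OF sub that] card_column[OF bs] by (simp add: slack_def)
  qed
  then show ?thesis using sub card_column[OF bs] by (simp add: admissible_def)
qed

lemma card_less_nth:
  fixes zs :: "nat list"
  assumes "sorted_wrt (<) zs" "p < length zs"
  shows "card {b \<in> set zs. b < zs ! p} = p"
proof -
  have "{b \<in> set zs. b < zs ! p} = set (take p zs)"
  proof (intro set_eqI iffI)
    fix b assume "b \<in> {b \<in> set zs. b < zs ! p}"
    then obtain m where m: "m < length zs" "b = zs ! m" "zs ! m < zs ! p"
      by (auto simp: in_set_conv_nth)
    then have "m < p"
      using assms by (metis linorder_neqE_nat order_less_asym' sorted_wrt_iff_nth_less)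
    then show "b \<in> set (take p zs)"
      using m assms(2) by (auto simp: in_set_conv_nth intro!: exI[of _ m])
  next
    fix b assume "b \<in> set (take p zs)"
    then obtain m where "m < p" "b = zs ! m" using assms(2) by (auto simp: in_set_conv_nth)
    then show "b \<in> {b \<in> set zs. b < zs ! p}"
      using assms by (auto simp: sorted_wrt_iff_nth_less)
  qed
  then show ?thesis
    using assms distinct_card[of "take p zs"] by (simp add: strict_sorted_iff)
qed

text \<open>Reads a bound for a single entry of an increasing list as a bound for a counting
  function; in this way the subscripted comparisons of condition 1 become inequalities between
  columns.\<close>

lemma le_nth_iff_card:
  fixes zs :: "nat list"
  assumes "sorted_wrt (<) zs" "p < length zs"
  shows "y \<le> zs ! p \<longleftrightarrow> card {b \<in> set zs. b < y} \<le> p"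
proof
  assume "y \<le> zs ! p"
  then have "card {b \<in> set zs. b < y} \<le> card {b \<in> set zs. b < zs ! p}"
    by (intro card_mono) auto
  then show "card {b \<in> set zs. b < y} \<le> p" using card_less_nth[OF assms] by simp
next
  assume le: "card {b \<in> set zs. b < y} \<le> p"
  show "y \<le> zs ! p"
  proof (rule ccontr)
    assume "\<not> y \<le> zs ! p"
    then have "insert (zs ! p) {b \<in> set zs. b < zs ! p} \<subseteq> {b \<in> set zs. b < y}"
      using assms(2) by auto
    then have "card (insert (zs ! p) {b \<in> set zs. b < zs ! p}) \<le> card {b \<in> set zs. b < y}"
      by (intro card_mono) auto
    then show False using le card_less_nth[OF assms] by simp
  qed
qed

text \<open>Pair the missing letters, in decreasing order, with the added ones, in increasing order.
  A pair violating the bound \<open>b \<le> bar n a\<close> would make the slack positive just below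
  its unprimed entry.\<close>

lemma admissible_Rseq:
  assumes "admissible n i C" "1 \<le> i" "i \<le> n"
  obtains ps s where "ps \<in> Rseq n i s" "column i ps = C"
proof -
  define X where "X = {1..i} - C"
  define Y where "Y = {b. i \<le> b \<and> Suc b \<in> C}"
  have C: "C \<subseteq> {1..2 * n}" "card C = i" and sl: "\<And>a. a \<le> n \<Longrightarrow> slack n C a \<le> 0"
    using assms(1) by (auto simp: admissible_def)
  have fin: "finite C" "finite X" using C(1) finite_subset by (auto simp: X_def)
  have "Suc ` Y \<subseteq> C" by (auto simp: Y_def)
  then have finY: "finite Y" using fin finite_subset finite_imageD by fastforce
  have Ceq: "C = ({1..i} - X) \<union> Suc ` Y"
  proof (intro set_eqI iffI)
    fix x assume x: "x \<in> C"
    then have "x = Suc (x - 1)" using C(1) by force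
    then show "x \<in> ({1..i} - X) \<union> Suc ` Y"
      using x by (cases "x \<le> i") (auto simp: X_def Y_def image_iff intro!: exI[of _ "x - 1"])
  qed (auto simp: X_def Y_def)
  have "card C = card ({1..i} - X) + card (Suc ` Y)"
    by (subst Ceq, intro card_Un_disjoint) (use finY in \<open>auto simp: Y_def\<close>)
  also have "card ({1..i} - X) = i - card X"
    using fin by (subst card_Diff_subset) (auto simp: X_def)
  finally have cXY: "card X = card Y"
    using C(2) card_mono[of "{1..i}" X] by (auto simp: X_def card_image)
  define xs where "xs = rev (sorted_list_of_set X)"
  define ys where "ys = sorted_list_of_set Y"
  define ps where "ps = zip xs ys"
  have len: "length xs = card X" "length ys = card X" by (simp_all add: xs_def ys_def cXY)
  have ps: "map fst ps = xs" "map snd ps = ys" by (simp_all add: ps_def len)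
  have set: "set xs = X" "set ys = Y" using fin finY by (simp_all add: xs_def ys_def)
  have bs: "bisorted i ps"
    unfolding bisorted_def ps
  proof (intro conjI ballI, goal_cases)
    case (3 z)
    then have "fst z \<in> set xs" "snd z \<in> set ys"
      unfolding ps_def by (metis prod.collapse set_zip_leftD set_zip_rightD)+
    then show ?case unfolding set by (auto simp: X_def Y_def)
  qed (simp_all add: xs_def ys_def sorted_wrt_rev)
  have col: "column i ps = C" using Ceq by (simp add: column_def ps set del: set_map)
  have pl: "primed ps \<subseteq> {..<2 * n}" unfolding ps set using C(1) by (auto simp: Y_def)
  have le: "ys ! m + xs ! m \<le> 2 * n" if m: "m < card X" for m
  proof (rule ccontr)
    assume "\<not> ys ! m + xs ! m \<le> 2 * n"
    then have gt: "2 * n + 1 \<le> ys ! m + xs ! m" by simp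
    \<comment> \<open>The index just below the offending entry: only \<open>card X - 1 - m\<close>
      letters up to \<open>a\<close> are missing, while at least \<open>card X - m\<close> barred
      letters are present.\<close>
    define a where "a = xs ! m - 1"
    have "xs ! m \<in> X" using m len(1) set by (metis nth_mem)
    then have x: "1 \<le> xs ! m" "xs ! m \<le> i" by (auto simp: X_def)
    have srt: "sorted_wrt (<) (rev xs)" "sorted_wrt (<) ys" by (auto simp: xs_def ys_def)
    have "rev xs ! (card X - 1 - m) = xs ! m" using m len(1) by (simp add: rev_nth)
    then have "card {b \<in> X. b < xs ! m} = card X - 1 - m"
      using card_less_nth[OF srt(1), of "card X - 1 - m"] m len set by simp
    moreover have "{b \<in> X. b < xs ! m} = {b \<in> unprimed ps. b \<le> a}"
      unfolding ps set a_def using x by auto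
    ultimately have 1: "card {b \<in> unprimed ps. b \<le> a} = card X - 1 - m" by simp
    have "card {b \<in> Y. b < ys ! m} = m"
      using card_less_nth[OF srt(2), of m] m len set by simp
    moreover have "card Y = card {b \<in> Y. b < ys ! m} + card {b \<in> Y. ys ! m \<le> b}"
      by (subst card_Un_disjoint[symmetric]) (auto simp: finY intro: arg_cong[where f = card])
    ultimately have "card {b \<in> Y. ys ! m \<le> b} = card X - m" using cXY by simp
    moreover have "card {b \<in> Y. ys ! m \<le> b} \<le> card {b \<in> Y. 2 * n - a \<le> b}"
      using gt x assms(3) by (intro card_mono) (auto simp: finY a_def)
    ultimately have 2: "card X - m \<le> card {b \<in> primed ps. 2 * n - a \<le> b}"
      unfolding ps set by simp
    have an: "a \<le> n" using x assms(3) by (simp add: a_def)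
    have "{b \<in> primed ps. b < a} = {}" unfolding ps set using x by (auto simp: Y_def a_def)
    then have "cnt C a = int a - int (card X - 1 - m)"
      using cnt_column[OF bs, of a] 1 x unfolding col by (simp add: a_def)
    moreover have "cnt_bar n C a \<ge> int (card X - m)"
      using cnt_bar_column[OF bs pl assms(3) an] 2 unfolding col by simp
    ultimately show False using sl[OF an] m by (simp add: slack_def)
  qed
  have "ps \<in> Rseq n i (card X)"
  proof -
    have "b \<le> bar n a \<and> a \<in> letters n \<and> b \<in> letters n" if ab: "(a, b) \<in> set ps" for a b
    proof -
      obtain m where "m < card X" "a = xs ! m" "b = ys ! m"
        using ab len by (auto simp: ps_def in_set_zip)
      moreover have "1 \<le> a" "a \<le> i" "i \<le> b" using ab bs by (auto simp: bisorted_def)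
      ultimately show ?thesis using le[of m] assms(2,3) by (auto simp: bar_def letters_def)
    qed
    then show ?thesis using bs
      by (auto simp: Rseq_def bisorted_def ps_def len)
  qed
  with col that show ?thesis by blast
qed

section \<open>Signatures and the operators on columns\<close>

definition plus_at :: "nat \<Rightarrow> nat set \<Rightarrow> bool" where
  "plus_at y C \<longleftrightarrow> y \<in> C \<and> Suc y \<notin> C"

definition minus_at :: "nat \<Rightarrow> nat set \<Rightarrow> bool" where
  "minus_at y C \<longleftrightarrow> y \<notin> C \<and> Suc y \<in> C"

text \<open>For \<open>l < n\<close> the operator with index \<open>l\<close> has a second edge,
  from the barred letter of \<open>l + 1\<close>, which is \<open>2 * n - l\<close>, to that of
  \<open>l\<close>. For \<open>l = n\<close> it would coincide with the first edge, hence the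
  restriction.\<close>

definition plus_bar :: "nat \<Rightarrow> nat \<Rightarrow> nat set \<Rightarrow> bool" where
  "plus_bar n l C \<longleftrightarrow> l < n \<and> plus_at (2 * n - l) C"

definition minus_bar :: "nat \<Rightarrow> nat \<Rightarrow> nat set \<Rightarrow> bool" where
  "minus_bar n l C \<longleftrightarrow> l < n \<and> minus_at (2 * n - l) C"

text \<open>The plus signs that survive the signature rule, in which a plus on the edge
  \<open>l\<close> cancels a minus on the barred edge. The shape follows the count in
  \<open>sigma\<close>: once for (a) or (b), once more for (a'). In the same way \<open>eps\<close>
  follows \<open>tau\<close> with (c), (d) and (d').\<close>

definition phi :: "nat \<Rightarrow> nat \<Rightarrow> nat set \<Rightarrow> nat" where
  "phi n l C = of_bool (plus_at l C \<and> \<not> minus_bar n l C \<or> plus_bar n l C \<and> \<not> plus_at l C)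
     + of_bool (plus_at l C \<and> plus_bar n l C)"

definition eps :: "nat \<Rightarrow> nat \<Rightarrow> nat set \<Rightarrow> nat" where
  "eps n l C = of_bool (minus_at l C \<and> \<not> minus_bar n l C \<or> minus_bar n l C \<and> \<not> plus_at l C)
     + of_bool (minus_bar n l C \<and> minus_at l C)"

definition raise_letter :: "nat \<Rightarrow> nat set \<Rightarrow> nat set" where
  "raise_letter y C = insert (Suc y) (C - {y})"

definition lower_letter :: "nat \<Rightarrow> nat set \<Rightarrow> nat set" where
  "lower_letter y C = insert y (C - {Suc y})"

text \<open>With two plus signs the edge \<open>l\<close> is used first, whereas
  \<open>e_col\<close> with two minus signs uses the barred edge first; this order makes them
  inverse to each other. The last branch is meaningful only if \<open>phi n l C\<close> is
  positive.\<close>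

definition f_col :: "nat \<Rightarrow> nat \<Rightarrow> nat set \<Rightarrow> nat set" where
  "f_col n l C = (if plus_at l C \<and> \<not> minus_bar n l C then raise_letter l C
     else raise_letter (2 * n - l) C)"

definition e_col :: "nat \<Rightarrow> nat \<Rightarrow> nat set \<Rightarrow> nat set" where
  "e_col n l C = (if minus_at l C \<and> \<not> minus_bar n l C then lower_letter l C
     else lower_letter (2 * n - l) C)"

text \<open>Unprimed entries decrease from at most \<open>i\<close> and primed ones increase from at
  least \<open>i\<close>, so \<open>i\<close> can occur only in the first pair. This is what the
  clauses for \<open>l = i\<close> exploit.\<close>

lemma hd_bisorted:
  assumes "bisorted i ps" "ps \<noteq> []"
  shows "fst (hd ps) = i \<longleftrightarrow> i \<in> unprimed ps" "snd (hd ps) = i \<longleftrightarrow> i \<in> primed ps"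
  using assms by (cases ps; force simp: bisorted_def)+

section \<open>Properties (a) to (d') read off from the column\<close>

context
  fixes n i l :: nat and ps :: pseq
  assumes bs: "bisorted i ps" and i: "1 \<le> i" "i \<le> n" and l: "1 \<le> l" "l \<le> n"
begin

lemma notin_primed: "y < i \<Longrightarrow> y \<notin> primed ps"
  using bisortedD(2)[OF bs] by auto

lemma notin_unprimed: "i < y \<Longrightarrow> y \<notin> unprimed ps"
  using bisortedD(1)[OF bs] by auto

lemma has_bar_column: "has_bar n ps l \<longleftrightarrow> l < n \<and> Suc (2 * n - l) \<in> column i ps"
  using i l by (auto simp: has_bar_def bar_def mem_column[OF bs] simp del: set_map)

lemma has_bar_Suc_column: "has_bar_Suc n ps l \<longleftrightarrow> l < n \<and> 2 * n - l \<in> column i ps"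
  using i l by (auto simp: has_bar_Suc_def bar_def mem_column[OF bs] simp del: set_map)

text \<open>The three cases of (a) differ only in how letters are recorded: up to \<open>i\<close>
  through unprimed entries, which are the missing letters, and above \<open>i\<close> through primed
  entries, which are one smaller than the letter. On the column all three say the same.\<close>

lemma prop_a_base_column: "prop_a_base i ps l \<longleftrightarrow> plus_at l (column i ps)"
  using i l notin_primed notin_unprimed
  by (cases l i rule: linorder_cases)
    (auto simp: prop_a_base_def plus_at_def mem_column[OF bs] simp del: set_map)

lemma prop_a_column:
  "prop_a n l i ps \<longleftrightarrow> plus_at l (column i ps) \<and> \<not> minus_bar n l (column i ps)"
  by (auto simp: prop_a_def prop_a_base_column has_bar_column has_bar_Suc_column minus_bar_def
      minus_at_def)

lemma prop_a'_column:
  "prop_a' n l i ps \<longleftrightarrow> plus_at l (column i ps) \<and> plus_bar n l (column i ps)"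
  by (auto simp: prop_a'_def prop_a_base_column has_bar_column has_bar_Suc_column plus_bar_def
      plus_at_def)

text \<open>For the empty sequence \<open>hd\<close> is unspecified, so the clause for
  \<open>l = i\<close> is translated for non-empty sequences; the lemmas that build on this one
  treat the empty sequence separately.\<close>

lemma not_plus_column:
  assumes "ps \<noteq> []"
  shows "(l < i \<longrightarrow> l + 1 \<notin> unprimed ps \<or> l \<in> unprimed ps)
     \<and> (l > i \<longrightarrow> l - 1 \<notin> primed ps \<or> l \<in> primed ps)
     \<and> (l = i \<longrightarrow> l = fst (hd ps) \<or> l = snd (hd ps)) \<longleftrightarrow> \<not> plus_at l (column i ps)"
  using i l notin_primed notin_unprimed hd_bisorted[OF bs assms]
  by (cases l i rule: linorder_cases)
    (auto simp: plus_at_def mem_column[OF bs] simp del: set_map)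

lemma minus_column:
  assumes "ps \<noteq> []"
  shows "(l < i \<longrightarrow> l + 1 \<notin> unprimed ps \<and> l \<in> unprimed ps)
     \<and> (l > i \<longrightarrow> l - 1 \<notin> primed ps \<and> l \<in> primed ps)
     \<and> (l = i \<longrightarrow> l = fst (hd ps) \<and> l = snd (hd ps)) \<longleftrightarrow> minus_at l (column i ps)"
  using i l notin_primed notin_unprimed hd_bisorted[OF bs assms]
  by (cases l i rule: linorder_cases)
    (auto simp: minus_at_def mem_column[OF bs] simp del: set_map)

lemma prop_b_column:
  "prop_b n l i ps \<longleftrightarrow> plus_bar n l (column i ps) \<and> \<not> plus_at l (column i ps)"
proof (cases "ps = []")
  case True
  then show ?thesis
    using i l by (auto simp: prop_b_def has_bar_Suc_def plus_bar_def plus_at_def column_def)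
next
  case False
  show ?thesis
    unfolding prop_b_def not_plus_column[OF False] has_bar_column has_bar_Suc_column plus_bar_def
    by (auto simp: plus_at_def)
qed

lemma prop_d_column:
  "prop_d n l i ps \<longleftrightarrow> minus_bar n l (column i ps) \<and> \<not> plus_at l (column i ps)"
proof (cases "ps = []")
  case True
  then show ?thesis
    using i l by (auto simp: prop_d_def has_bar_def minus_bar_def minus_at_def column_def)
next
  case False
  show ?thesis
    unfolding prop_d_def not_plus_column[OF False] has_bar_column has_bar_Suc_column minus_bar_def
    by (auto simp: minus_at_def)
qed

lemma prop_d'_column:
  "prop_d' n l i ps \<longleftrightarrow> minus_bar n l (column i ps) \<and> minus_at l (column i ps)"
proof (cases "ps = []")
  case True
  then show ?thesis
    using i l by (auto simp: prop_d'_def has_bar_def minus_bar_def minus_at_def column_def)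
next
  case False
  show ?thesis
    unfolding prop_d'_def minus_column[OF False] has_bar_column has_bar_Suc_column minus_bar_def
    by (auto simp: minus_at_def)
qed

lemma prop_c_column:
  "prop_c n l i ps \<longleftrightarrow> minus_at l (column i ps) \<and> \<not> minus_bar n l (column i ps)"
proof (cases "ps = []")
  case True
  then show ?thesis
    using i l by (auto simp: prop_c_def minus_at_def column_def)
next
  case False
  have "l \<in> unprimed ps \<union> primed ps \<and> (l < i \<longrightarrow> l + 1 \<notin> unprimed ps)
     \<and> (l > i \<longrightarrow> l - 1 \<notin> primed ps) \<and> (l = i \<longrightarrow> hd ps = (l, l)) \<longleftrightarrow> minus_at l (column i ps)"
    unfolding minus_column[OF False, symmetric]
    using i l notin_primed notin_unprimed hd_bisorted[OF bs False]
    by (cases l i rule: linorder_cases) (auto simp: prod_eq_iff simp del: set_map)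
  moreover have "has_bar_Suc n ps l \<or> \<not> has_bar n ps l \<longleftrightarrow> \<not> minus_bar n l (column i ps)"
    by (auto simp: has_bar_column has_bar_Suc_column minus_bar_def minus_at_def)
  ultimately show ?thesis unfolding prop_c_def by blast
qed

end

section \<open>The map \<theta> and its inverse on columns\<close>

lemma sorted_wrt_map_replace:
  assumes "sorted_wrt (<) zs"
  shows "y \<notin> set zs \<Longrightarrow> sorted_wrt (<) (map (replace (Suc y) y) zs)"
    "Suc y \<notin> set zs \<Longrightarrow> sorted_wrt (<) (map (replace y (Suc y)) zs)"
  using assms unfolding sorted_wrt_map
  by (auto elim!: sorted_wrt_mono_rel[rotated] simp: replace_def Suc_lessI)
    (metis less_antisym, metis Suc_lessI)

lemma sorted_wrt_map_replace_rev:
  assumes "sorted_wrt (>) zs" "y \<notin> set zs"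
  shows "sorted_wrt (>) (map (replace (Suc y) y) zs)"
  using sorted_wrt_map_replace(1)[of "rev zs" y] assms
  by (simp add: sorted_wrt_rev flip: rev_map)

lemma image_replace: "replace a b ` S = (if a \<in> S then insert b (S - {a}) else S)"
  by (auto simp: replace_def)

lemma bisortedI:
  assumes "sorted_wrt (>) (map fst ps)" "sorted_wrt (<) (map snd ps)"
    "\<And>a b. (a, b) \<in> set ps \<Longrightarrow> 1 \<le> a \<and> a \<le> i \<and> i \<le> b"
  shows "bisorted i ps"
  using assms by (auto simp: bisorted_def)

text \<open>Every replacement made by \<theta> moves one letter of the column up by one: (a) moves
  \<open>l\<close>, in three disguises, and (b) moves \<open>2 * n - l\<close>. Only
  \<open>bisorted\<close> is asserted of the result; membership in \<open>Rseq\<close> comes later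
  from \<open>R_inf\<close>, which arrows require at both ends.\<close>

lemma theta_column:
  assumes bs: "bisorted i ps" and i: "1 \<le> i" "i \<le> n" and l: "1 \<le> l" "l \<le> n"
  shows "phi n l (column i ps) = 0 \<Longrightarrow> theta n l i ps = None"
    "0 < phi n l (column i ps) \<Longrightarrow> \<exists>qs. theta n l i ps = Some (Elem i qs) \<and> bisorted i qs
       \<and> column i qs = f_col n l (column i ps)"
proof -
  note pa = prop_a_column[OF assms] and pb = prop_b_column[OF assms]
  show "phi n l (column i ps) = 0 \<Longrightarrow> theta n l i ps = None"
    by (auto simp: theta_def pa pb phi_def split: if_splits)
  assume pos: "0 < phi n l (column i ps)"
  let ?C = "column i ps"
  have mem: "\<And>x y. (x, y) \<in> set ps \<Longrightarrow> 1 \<le> x \<and> x \<le> i \<and> i \<le> y \<and> x \<in> unprimed ps \<and> y \<in> primed ps"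
    using bs by (force simp: bisorted_def)
  have srt: "sorted_wrt (>) (map fst ps)" "sorted_wrt (<) (map snd ps)"
    using bs by (auto simp: bisorted_def)
  show "\<exists>qs. theta n l i ps = Some (Elem i qs) \<and> bisorted i qs \<and> column i qs = f_col n l ?C"
  proof (cases "prop_a n l i ps")
    case a: True
    then have base: "prop_a_base i ps l" by (simp add: prop_a_def)
    have fc: "f_col n l ?C = raise_letter l ?C" using a by (simp add: pa f_col_def)
    consider "l < i" | "l > i" | "l = i" by linarith
    then show ?thesis
    proof cases
      case 1
      let ?qs = "map (\<lambda>(a, b). (replace (l + 1) l a, b)) ps"
      have f: "map fst ?qs = map (replace (Suc l) l) (map fst ps)" "map snd ?qs = map snd ps"
        by auto
      have nl: "l \<notin> unprimed ps" "Suc l \<in> unprimed ps"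
        using base 1 by (auto simp: prop_a_base_def)
      have "sorted_wrt (>) (map fst ?qs)"
        unfolding f by (intro sorted_wrt_map_replace_rev srt nl)
      moreover have "sorted_wrt (<) (map snd ?qs)" unfolding f by (rule srt)
      ultimately have "bisorted i ?qs"
        by (rule bisortedI) (use 1 l in \<open>auto simp: replace_def dest: mem\<close>)
      moreover have "unprimed ?qs = insert l (unprimed ps - {Suc l})" "primed ?qs = primed ps"
        unfolding f using nl by (simp_all only: set_map[of "replace _ _"] image_replace if_True)
      then have "column i ?qs = raise_letter l ?C"
      proof -
        have "l \<notin> Suc ` primed ps" using 1 bisortedD(2)[OF bs] by force
        moreover assume "unprimed ?qs = insert l (unprimed ps - {Suc l})" "primed ?qs = primed ps"
        ultimately show ?thesis
          unfolding column_def raise_letter_def using 1 l nl by (auto simp del: set_map)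
      qed
      ultimately show ?thesis using a 1 fc by (auto simp: theta_def)
    next
      case 2
      let ?qs = "map (\<lambda>(a, b). (a, replace (l - 1) l b)) ps"
      have f: "map snd ?qs = map (replace (l - 1) (Suc (l - 1))) (map snd ps)"
        "map fst ?qs = map fst ps"
        using l by auto
      have nl: "l \<notin> primed ps" "l - 1 \<in> primed ps"
        using base 2 by (auto simp: prop_a_base_def)
      have "sorted_wrt (<) (map snd ?qs)"
        unfolding f by (intro sorted_wrt_map_replace srt) (use nl l in auto)
      moreover have "sorted_wrt (>) (map fst ?qs)" unfolding f by (rule srt)
      ultimately have "bisorted i ?qs"
        by (intro bisortedI) (use 2 l in \<open>auto simp: replace_def dest: mem\<close>)
      moreover have "primed ?qs = insert l (primed ps - {l - 1})" "unprimed ?qs = unprimed ps"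
        unfolding f using nl l
          by (simp_all only: set_map[of "replace _ _"] image_replace if_True) simp
      then have "column i ?qs = raise_letter l ?C"
        unfolding column_def raise_letter_def using 2 l notin_unprimed[OF assms] by auto
      ultimately show ?thesis using a 2 fc by (auto simp: theta_def)
    next
      case 3
      \<comment> \<open>The pair \<open>(l, l)\<close> removes the letter \<open>l\<close> and adds
        \<open>l + 1\<close>.\<close>
      let ?qs = "(l, l) # ps"
      have nl: "l \<notin> unprimed ps" "l \<notin> primed ps"
        using base by (auto simp: prop_a_base_def)
      have "\<And>x y. (x, y) \<in> set ps \<Longrightarrow> x < l \<and> l < y"
        using mem nl 3 by (metis le_neq_implies_less)
      then have "bisorted i ?qs"
        by (intro bisortedI) (use 3 l srt in \<open>auto dest: mem\<close>)
      moreover have "column i ?qs = raise_letter l ?C"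
        unfolding column_def raise_letter_def using 3 l nl bisortedD(2)[OF bs] by force
      ultimately show ?thesis using a 3 fc by (auto simp: theta_def)
    qed
  next
    case na: False
    \<comment> \<open>A plus and a minus on the barred edge exclude each other, so a positive
      \<open>phi\<close> without (a) can only come from (b).\<close>
    have "\<not> (plus_bar n l ?C \<and> minus_bar n l ?C)"
      by (auto simp: plus_bar_def minus_bar_def plus_at_def minus_at_def)
    with na pos have b: "prop_b n l i ps" by (auto simp: pa pb phi_def split: if_splits)
    have ln: "l < n" using b by (simp add: pb plus_bar_def)
    have fc: "f_col n l ?C = raise_letter (2 * n - l) ?C" using na by (auto simp: pa f_col_def)
    let ?m = "2 * n - (l + 1)"
    let ?qs = "map (\<lambda>(a, b). (a, replace (bar n (l + 1)) (bar n l) b)) ps"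
    have m: "2 * n - l = Suc ?m" "i \<le> ?m" using ln i by auto
    have f: "map snd ?qs = map (replace ?m (Suc ?m)) (map snd ps)" "map fst ?qs = map fst ps"
      using m by (auto simp: bar_def)
    have nl: "Suc ?m \<notin> primed ps" "?m \<in> primed ps"
      using b ln m by (auto simp: prop_b_def has_bar_def has_bar_Suc_def bar_def simp del: set_map)
    have "sorted_wrt (<) (map snd ?qs)"
      unfolding f by (intro sorted_wrt_map_replace srt) (use nl in auto)
    moreover have "sorted_wrt (>) (map fst ?qs)" unfolding f by (rule srt)
    ultimately have "bisorted i ?qs"
      by (intro bisortedI) (use m in \<open>auto simp: replace_def bar_def dest: mem\<close>)
    moreover have "primed ?qs = insert (Suc ?m) (primed ps - {?m})" "unprimed ?qs = unprimed ps"
      unfolding f using nl by (simp_all only: set_map[of "replace _ _"] image_replace if_True)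
    then have "column i ?qs = raise_letter (2 * n - l) ?C"
      unfolding column_def raise_letter_def m(1) using m(2) by auto
    ultimately show ?thesis using b na fc by (auto simp: theta_def)
  qed
qed

lemma bar_letters:
  assumes "1 \<le> l" "l < (n::nat)"
  shows "Suc l \<noteq> 2 * n - l" "l \<noteq> 2 * n - l" "l \<noteq> Suc (2 * n - l)" "Suc l \<noteq> Suc (2 * n - l)"
    "2 * n - l \<noteq> Suc l" "2 * n - l \<noteq> l" "Suc (2 * n - l) \<noteq> l" "l \<noteq> Suc l" "Suc l \<noteq> l"
  using assms by auto

text \<open>All quantities depend only on the membership of the letters on the edges, four distinct
  ones for \<open>l < n\<close> and two for \<open>l = n\<close>, so a finite case check
  suffices.\<close>

lemma
  assumes "0 < eps n l C" "1 \<le> l" "l \<le> n"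
  shows f_col_e_col: "f_col n l (e_col n l C) = C"
    and phi_e_col: "phi n l (e_col n l C) = Suc (phi n l C)"
    and eps_e_col: "eps n l C = Suc (eps n l (e_col n l C))"
proof -
  have "f_col n l (e_col n l C) = C \<and> phi n l (e_col n l C) = Suc (phi n l C)
      \<and> eps n l C = Suc (eps n l (e_col n l C))"
  proof (cases "l < n")
    case True
    then show ?thesis
      using assms bar_letters[OF assms(2) True]
      unfolding f_col_def e_col_def phi_def eps_def plus_bar_def minus_bar_def raise_letter_def
        lower_letter_def plus_at_def minus_at_def
      by (cases "l \<in> C"; cases "Suc l \<in> C"; cases "2 * n - l \<in> C"; cases "Suc (2 * n - l) \<in> C")
        (simp_all add: insert_absorb insert_commute Diff_insert_absorb insert_Diff_if)
  next
    case False
    then show ?thesis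
      using assms 
      unfolding f_col_def e_col_def phi_def eps_def plus_bar_def minus_bar_def raise_letter_def
        lower_letter_def plus_at_def minus_at_def
      by (cases "l \<in> C"; cases "Suc l \<in> C") (auto simp: insert_absorb)
  qed
  then show "f_col n l (e_col n l C) = C" "phi n l (e_col n l C) = Suc (phi n l C)"
    "eps n l C = Suc (eps n l (e_col n l C))" by auto
qed

section \<open>Stability of the inequalities for neighbouring columns\<close>

text \<open>\<open>R\<close> belongs to the first component of a pair and \<open>L\<close> to the
  second; as the shorter column stands to the right in a tableau, they are its right and left
  columns. For \<open>a = b\<close> the two inequalities compare the rows up to \<open>n\<close>
  and, by complement, those from \<open>n\<close> on.\<close>

definition compat :: "nat \<Rightarrow> nat set \<Rightarrow> nat set \<Rightarrow> bool" where
  "compat n R L \<longleftrightarrow> (\<forall>a b. a \<le> b \<and> b \<le> n \<longrightarrow>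
     slack n R b \<le> cnt L a + cnt_bar n R a - int a
   \<and> slack n L b + int (card R) - int (card L) \<le> cnt L a + cnt_bar n R a - int a)"

lemma compatD:
  assumes "compat n R L" "a \<le> b" "b \<le> n"
  shows "cnt R b + cnt_bar n R b - int b \<le> cnt L a + cnt_bar n R a - int a"
    "cnt L b + cnt_bar n L b - int b + int (card R) - int (card L)
      \<le> cnt L a + cnt_bar n R a - int a"
  using assms by (auto simp: compat_def slack_def)

lemma compatI:
  assumes "\<And>a b. a \<le> b \<Longrightarrow> b \<le> n \<Longrightarrow>
      cnt R b + cnt_bar n R b - int b \<le> cnt L a + cnt_bar n R a - int a
    \<and> cnt L b + cnt_bar n L b - int b + int (card R) - int (card L)
      \<le> cnt L a + cnt_bar n R a - int a"
  shows "compat n R L"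
  using assms by (auto simp: compat_def slack_def)

lemma admissibleD:
  assumes "admissible n i C"
  shows "C \<subseteq> {1..2 * n}" "card C = i" "finite C" "a \<le> n \<Longrightarrow> slack n C a \<le> 0"
  using assms finite_subset by (auto simp: admissible_def)

lemma cnt_raise_letter:
  assumes "plus_at y C" "1 \<le> y"
  shows "cnt (raise_letter y C) a = cnt C a - of_bool (a = y)"
  using assms by (induction a) (auto simp: cnt_Suc raise_letter_def plus_at_def)

lemma raise_letter_subset:
  assumes "C \<subseteq> {1..2 * n}" "plus_at y C" "y < 2 * n"
  shows "raise_letter y C \<subseteq> {1..2 * n}"
  using assms by (auto simp: raise_letter_def)

lemma card_raise_letter:
  assumes "plus_at y C" "finite C"
  shows "card (raise_letter y C) = card C"
  using assms card_Suc_Diff1[of C y] by (auto simp: raise_letter_def plus_at_def)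

lemma cnt_bar_raise_letter:
  assumes "plus_at y C" "1 \<le> y" "y < 2 * n" "C \<subseteq> {1..2 * n}" "a \<le> 2 * n"
  shows "cnt_bar n (raise_letter y C) a = cnt_bar n C a + of_bool (a = 2 * n - y)"
proof -
  have "(2 * n - a = y) = (a = 2 * n - y)" using assms by auto
  moreover have "finite C" using assms finite_subset by auto
  ultimately show ?thesis
    using cnt_cnt_bar[OF assms(4,5)] cnt_raise_letter[OF assms(1,2), of "2 * n - a"]
      cnt_cnt_bar[OF raise_letter_subset[OF assms(4,1,3)] assms(5)] card_raise_letter[OF assms(1)]
    by auto
qed

text \<open>The increments of both counting functions around \<open>l\<close>, written with
  \<open>if\<close> so that the stability proofs can be closed by case splitting and linear
  arithmetic.\<close>

lemma local_counts:
  assumes "1 \<le> l"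
  shows "cnt C l = cnt C (l - 1) + (if l \<in> C then 1 else 0)"
    "cnt C (Suc l) = cnt C l + (if Suc l \<in> C then 1 else 0)"
    "l \<le> n \<Longrightarrow> cnt_bar n C l = cnt_bar n C (l - 1) + (if Suc (2 * n - l) \<in> C then 1 else 0)"
    "l < n \<Longrightarrow> cnt_bar n C (Suc l) = cnt_bar n C l + (if 2 * n - l \<in> C then 1 else 0)"
proof -
  show "cnt C l = cnt C (l - 1) + (if l \<in> C then 1 else 0)"
    using cnt_Suc[of C "l - 1"] assms by auto
  assume "l \<le> n"
  then have "2 * n - (l - 1) = Suc (2 * n - l)" using assms by auto
  then show "cnt_bar n C l = cnt_bar n C (l - 1) + (if Suc (2 * n - l) \<in> C then 1 else 0)"
    using cnt_bar_Suc[of "l - 1" n C] assms \<open>l \<le> n\<close> by auto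
qed (auto simp: cnt_Suc cnt_bar_Suc)

lemma eps_eq_0: "eps n l C = 0 \<longleftrightarrow> \<not> minus_at l C \<and> (minus_bar n l C \<longrightarrow> plus_at l C)"
  by (auto simp: eps_def)

lemma phi_eq_0: "phi n l C = 0 \<longleftrightarrow> \<not> plus_bar n l C \<and> (plus_at l C \<longrightarrow> minus_bar n l C)"
  by (auto simp: phi_def)

lemma phi_le_1: "\<not> (plus_at l C \<and> plus_bar n l C) \<Longrightarrow> phi n l C \<le> 1"
  by (auto simp: phi_def)

lemma not_plus_minus_bar: "plus_bar n l C \<Longrightarrow> \<not> minus_bar n l C"
  by (simp add: plus_bar_def minus_bar_def plus_at_def minus_at_def)

text \<open>
  Below, \<open>f_col\<close> changes both counting functions only at the index \<open>l\<close>, so that only the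
  inequalities with \<open>a = l\<close> or \<open>b = l\<close> matter; those are compared with the inequalities at the
  neighbouring indices \<open>l - 1\<close> and \<open>l + 1\<close>.
\<close>

lemma compat_f_col_first:
  assumes R: "admissible n i R" and L: "admissible n j L" and l: "1 \<le> l" "l \<le> n"
    and gt: "eps n l L < phi n l R"
  shows "compat n (f_col n l R) L \<longleftrightarrow> compat n R L"
proof (cases "l < n")
  case True
  then have sn: "Suc l \<le> n" "l \<le> Suc l" by auto
  have k: "l - 1 \<le> l" "l - 1 \<le> n" "l - 1 \<noteq> l" using l by auto
  note RD = admissibleD[OF R] and LD = admissibleD[OF L]
  note cR = local_counts(1,2)[OF l(1), where C = R] local_counts(3)[OF l, where C = R]
    local_counts(4)[OF l(1) True, where C = R]
  note cL = local_counts(1,2)[OF l(1), where C = L] local_counts(3)[OF l, where C = L]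
    local_counts(4)[OF l(1) True, where C = L]
  show ?thesis
  proof (cases "plus_at l R \<and> \<not> minus_bar n l R")
    case a: True
    then have R': "f_col n l R = raise_letter l R" by (simp add: f_col_def)
    have cnt': "cnt (f_col n l R) a = cnt R a - (if a = l then 1 else 0)" for a
      unfolding R' using a l by (simp add: cnt_raise_letter)
    have bar': "cnt_bar n (f_col n l R) a = cnt_bar n R a" if "a \<le> n" for a
      unfolding R' using a l True RD that by (simp add: cnt_bar_raise_letter)
    have card': "card (f_col n l R) = card R" unfolding R'
      using a RD by (simp add: card_raise_letter)
    show ?thesis
    proof
      assume "compat n R L"
      from compatD[OF this] show "compat n (f_col n l R) L"
        by (intro compatI) (fastforce simp: cnt' bar' card')
    next
      \<comment> \<open>Only \<open>b = l\<close> is at stake. As \<open>R\<close> has no minus on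
        the barred edge, its slack at \<open>l\<close> equals that at \<open>l - 1\<close> or at
        \<open>l + 1\<close>, which settles \<open>a < l\<close>.\<close>
      assume c: "compat n (f_col n l R) L"
      note D = compatD[OF c, unfolded card']
      \<comment> \<open>If \<open>R\<close> has no plus on the barred edge, its \<open>phi\<close>
        is at most 1, so \<open>gt\<close> forces \<open>eps n l L = 0\<close>. This serves the case
        \<open>a = b = l\<close>.\<close>
      have e0: "\<not> (2 * n - l \<in> R \<and> Suc (2 * n - l) \<notin> R) \<Longrightarrow> \<not> minus_at l L"
        using phi_le_1[of l R n] gt eps_eq_0[of n l L] True
        by (auto simp: plus_bar_def plus_at_def)
      have R1: "2 * n - l \<in> R \<or> Suc (2 * n - l) \<notin> R" "l \<in> R" "Suc l \<notin> R"
        using a True by (auto simp: minus_bar_def minus_at_def plus_at_def)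
      show "compat n R L"
      proof (intro compatI, goal_cases)
        case (1 a b)
        note D1 = D[OF 1]
        consider "b \<noteq> l" | "b = l" "a \<le> l - 1" "a \<noteq> l" | "b = l" "a = l" using 1 by linarith
        then show ?case
        proof cases
          case 1
          then show ?thesis using D1 \<open>a \<le> b\<close> \<open>b \<le> n\<close> by (auto simp: cnt' bar')
        next
          case 2
          then have as: "a \<le> Suc l" by simp
          show ?thesis
            using 2 D1 k D(1)[OF \<open>a \<le> l - 1\<close> k(2)] D(1)[OF as sn(1)] R1 cR l True
            by (auto simp: cnt' bar' split: if_splits)
        next
          case 3
          then show ?thesis
            using D1 k D(1)[OF order_refl k(2)] D(1)[OF order_refl sn(1)] D(1)[OF sn(2,1)] R1 cR cL
              l True e0
            by (auto simp: cnt' bar' minus_at_def split: if_splits)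
        qed
      qed
    qed
  next
    case na: False
    then have b: "plus_bar n l R" "\<not> plus_at l R"
      using gt phi_eq_0[of n l R] not_plus_minus_bar[of n l R] by auto
    then have p: "plus_at (2 * n - l) R" by (simp add: plus_bar_def)
    have R': "f_col n l R = raise_letter (2 * n - l) R" using na by (auto simp: f_col_def)
    have cnt': "cnt (f_col n l R) a = cnt R a" if "a \<le> n" for a
      unfolding R' using p l True that by (simp add: cnt_raise_letter)
    have bar': "cnt_bar n (f_col n l R) a = cnt_bar n R a + (if a = l then 1 else 0)"
      if "a \<le> n" for a
      unfolding R' using p l True RD that by (simp add: cnt_bar_raise_letter)
    have card': "card (f_col n l R) = card R" unfolding R'
      using p RD by (simp add: card_raise_letter)
    have R1: "2 * n - l \<in> R" "Suc (2 * n - l) \<notin> R" "l \<notin> R \<or> Suc l \<in> R"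
      using p b by (auto simp: plus_at_def)
    have L1: "\<not> minus_at l L" "minus_bar n l L \<Longrightarrow> plus_at l L"
      using phi_le_1[of l R n] b gt eps_eq_0[of n l L] by auto
    show ?thesis
    proof
      \<comment> \<open>For \<open>a < b = l\<close> the raised slack of \<open>R\<close> equals the
        old slack at \<open>l - 1\<close> or at \<open>l + 1\<close>, because \<open>R\<close> has
        no plus on the edge \<open>l\<close>.\<close>
      assume c: "compat n R L"
      note D = compatD[OF c]
      show "compat n (f_col n l R) L"
      proof (intro compatI, goal_cases)
        case (1 a b)
        note D1 = D[OF 1]
        consider "b \<noteq> l \<or> a = l" | "b = l" "a \<le> l - 1" "a \<noteq> l" using 1 by linarith
        then show ?case
        proof cases
          case 1
          then show ?thesis using D1 \<open>a \<le> b\<close> \<open>b \<le> n\<close> by (auto simp: cnt' bar' card')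
        next
          case 2
          then have as: "a \<le> Suc l" by simp
          show ?thesis
            using 2 D1 k D(1)[OF \<open>a \<le> l - 1\<close> k(2)] D(1)[OF as sn(1)] R1 cR l True
            by (auto simp: cnt' bar' card' split: if_splits)
        qed
      qed
    next
      \<comment> \<open>At \<open>a = l\<close> the old right-hand side equals that at
        \<open>l - 1\<close> or at \<open>l + 1\<close>, because \<open>L\<close> has no minus on
        the edge \<open>l\<close>.\<close>
      assume c: "compat n (f_col n l R) L"
      note D = compatD[OF c, unfolded card']
      show "compat n R L"
      proof (intro compatI, goal_cases)
        case (1 a b)
        note D1 = D[OF 1]
        consider "a \<noteq> l" | "a = l" "b = l" | "a = l" "Suc l \<le> b" "b \<noteq> l" using 1 by linarith
        then show ?case
        proof cases
          case 1
          then show ?thesis using D1 \<open>a \<le> b\<close> \<open>b \<le> n\<close> by (auto simp: cnt' bar' split: if_splits)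
        next
          case 2
          then show ?thesis
            using D1 k D[OF order_refl k(2)] D[OF order_refl sn(1)] D[OF k(1) l(2)] R1 cR cL l True
              L1
            by (auto simp: cnt' bar' plus_at_def minus_at_def minus_bar_def split: if_splits)
        next
          case 3
          then have lb: "l - 1 \<le> b" by simp
          show ?thesis
            using 3 D1 k D[OF lb \<open>b \<le> n\<close>] D[OF \<open>Suc l \<le> b\<close> \<open>b \<le> n\<close>] R1 cR cL l True L1 \<open>b \<le> n\<close>
            by (auto simp: cnt' bar' plus_at_def minus_at_def minus_bar_def split: if_splits)
        qed
      qed
    qed
  qed
next
  case False
  then have ln: "l = n" using l by simp
  have k: "l - 1 \<le> l" "l - 1 \<le> n" "l - 1 \<noteq> l" using l by auto
  note RD = admissibleD[OF R] and LD = admissibleD[OF L]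
  note cR = local_counts(1,2)[OF l(1), where C = R] local_counts(3)[OF l, where C = R]
  note cL = local_counts(1,2)[OF l(1), where C = L] local_counts(3)[OF l, where C = L]
  have nb: "\<not> plus_bar n l C" "\<not> minus_bar n l C" for C
    using ln by (auto simp: plus_bar_def minus_bar_def)
  have a: "plus_at l R" "\<not> minus_at l L"
    using gt phi_eq_0[of n l R] eps_eq_0[of n l L] phi_le_1[of l R n] nb by auto
  then have R': "f_col n l R = raise_letter l R" using nb by (simp add: f_col_def)
  have cnt': "cnt (f_col n l R) a = cnt R a - (if a = l then 1 else 0)" for a
    unfolding R' using a l by (simp add: cnt_raise_letter)
  have bar': "cnt_bar n (f_col n l R) a = cnt_bar n R a + (if a = l then 1 else 0)" if "a \<le> n" for a
    unfolding R' using a l ln RD that by (simp add: cnt_bar_raise_letter)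
  have card': "card (f_col n l R) = card R" unfolding R' using a RD by (simp add: card_raise_letter)
  \<comment> \<open>At the index \<open>n\<close> the two counts exhaust the column, so both
    inequalities at \<open>a = b = n\<close> say \<open>cnt R n \<le> cnt L n\<close>. With no
    neighbour \<open>n + 1\<close>, this is derived from the two inequalities at
    \<open>n - 1\<close>.\<close>
  have tot: "cnt R n + cnt_bar n R n = int (card R)" "cnt L n + cnt_bar n L n = int (card L)"
    using cnt_cnt_bar[of _ n n] RD LD by auto
  have m: "2 * n - l = l" using ln by simp
  show ?thesis
  proof
    assume c: "compat n R L"
    note D = compatD[OF c]
    show "compat n (f_col n l R) L"
    proof (intro compatI, goal_cases)
      case (1 a b)
      then show ?case using D[OF 1] by (auto simp: cnt' bar' card')
    qed
  next
    assume c: "compat n (f_col n l R) L"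
    note D = compatD[OF c, unfolded card']
    show "compat n R L"
    proof (intro compatI, goal_cases)
      case (1 a b)
      note D1 = D[OF 1]
      consider "a \<noteq> l" | "a = l" "b = l" using 1 ln by linarith
      then show ?case
      proof cases
        case 1
        then show ?thesis using D1 \<open>a \<le> b\<close> \<open>b \<le> n\<close> by (auto simp: cnt' bar' split: if_splits)
      next
        case 2
        then show ?thesis
          using D1 k D[OF order_refl k(2)] a cR cL l tot m ln
          by (auto simp: cnt'[unfolded ln] bar'[unfolded ln] minus_at_def plus_at_def split:
            if_splits)
      qed
    qed
  qed
qed

text \<open>The mirror image: now the slack of \<open>L\<close> changes and, for a step on the edge
  \<open>l\<close>, also the right-hand side. The hypothesis \<open>le\<close> says that the minus
  signs of \<open>L\<close> absorb all plus signs of \<open>R\<close>, so that the operator passes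
  on to \<open>L\<close>.\<close>

lemma compat_f_col_second:
  assumes R: "admissible n i R" and L: "admissible n j L" and l: "1 \<le> l" "l \<le> n"
    and le: "phi n l R \<le> eps n l L" and pos: "0 < phi n l L"
  shows "compat n R (f_col n l L) \<longleftrightarrow> compat n R L"
proof (cases "l < n")
  case True
  then have sn: "Suc l \<le> n" "l \<le> Suc l" by auto
  have k: "l - 1 \<le> l" "l - 1 \<le> n" "l - 1 \<noteq> l" using l by auto
  note RD = admissibleD[OF R] and LD = admissibleD[OF L]
  note cR = local_counts(1,2)[OF l(1), where C = R] local_counts(3)[OF l, where C = R]
    local_counts(4)[OF l(1) True, where C = R]
  note cL = local_counts(1,2)[OF l(1), where C = L] local_counts(3)[OF l, where C = L]
    local_counts(4)[OF l(1) True, where C = L]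
  show ?thesis
  proof (cases "plus_at l L \<and> \<not> minus_bar n l L")
    case a: True
    then have L': "f_col n l L = raise_letter l L" by (simp add: f_col_def)
    have cnt': "cnt (f_col n l L) a = cnt L a - (if a = l then 1 else 0)" for a
      unfolding L' using a l by (simp add: cnt_raise_letter)
    have bar': "cnt_bar n (f_col n l L) a = cnt_bar n L a" if "a \<le> n" for a
      unfolding L' using a l True LD that by (simp add: cnt_bar_raise_letter)
    have card': "card (f_col n l L) = card L" unfolding L'
      using a LD by (simp add: card_raise_letter)
    have L1: "2 * n - l \<in> L \<or> Suc (2 * n - l) \<notin> L" "l \<in> L" "Suc l \<notin> L"
      using a True by (auto simp: minus_bar_def minus_at_def plus_at_def)
    \<comment> \<open>A plus on the edge \<open>l\<close> that survives in \<open>L\<close> leaves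
      \<open>eps n l L = 0\<close>, whence \<open>phi n l R = 0\<close>. Without a plus on the
      barred edge of \<open>R\<close>, the lowered right-hand side at \<open>l\<close> equals that
      at \<open>l - 1\<close> or at \<open>l + 1\<close>.\<close>
    have R1: "\<not> plus_bar n l R" "plus_at l R \<Longrightarrow> minus_bar n l R"
      using a le eps_eq_0[of n l L] phi_eq_0[of n l R] by (auto simp: plus_at_def minus_at_def)
    show ?thesis
    proof
      assume c: "compat n R L"
      note D = compatD[OF c]
      show "compat n R (f_col n l L)"
      proof (intro compatI, goal_cases)
        case (1 a b)
        note D1 = D[OF 1]
        consider "a \<noteq> l" | "a = l" "b = l" | "a = l" "Suc l \<le> b" "b \<noteq> l" using 1 by linarith
        then show ?case
        proof cases
          case 1
          then show ?thesis using D1 \<open>a \<le> b\<close> \<open>b \<le> n\<close>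
            by (auto simp: cnt' bar' card' split: if_splits)
        next
          case 2
          then show ?thesis
            using D1 k D[OF order_refl k(2)] D[OF order_refl sn(1)] D[OF k(1) l(2)] R1 cR cL l True
              L1
            by (auto simp: cnt' bar' card' plus_at_def plus_bar_def minus_bar_def minus_at_def
              split: if_splits)
        next
          case 3
          then have lb: "l - 1 \<le> b" by simp
          show ?thesis
            using 3 D1 k D[OF lb \<open>b \<le> n\<close>] D[OF \<open>Suc l \<le> b\<close> \<open>b \<le> n\<close>] R1 cR cL l True L1 \<open>b \<le> n\<close>
            by (auto simp: cnt' bar' card' plus_at_def plus_bar_def minus_bar_def minus_at_def
              split: if_splits)
        qed
      qed
    next
      assume c: "compat n R (f_col n l L)"
      note D = compatD[OF c, unfolded card']
      show "compat n R L"
      proof (intro compatI, goal_cases)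
        case (1 a b)
        note D1 = D[OF 1]
        consider "b \<noteq> l \<or> a = l" | "b = l" "a \<le> l - 1" "a \<noteq> l" using 1 by linarith
        then show ?case
        proof cases
          case 1
          then show ?thesis using D1 \<open>a \<le> b\<close> \<open>b \<le> n\<close> by (auto simp: cnt' bar' split: if_splits)
        next
          case 2
          then have as: "a \<le> Suc l" by simp
          show ?thesis
            using 2 D1 k D(2)[OF \<open>a \<le> l - 1\<close> k(2)] D(2)[OF as sn(1)] L1 cL l True
            by (auto simp: cnt' bar' split: if_splits)
        qed
      qed
    qed
  next
    case na: False
    then have b: "plus_bar n l L" "\<not> plus_at l L"
      using pos phi_eq_0[of n l L] not_plus_minus_bar[of n l L] by auto
    then have p: "plus_at (2 * n - l) L" by (simp add: plus_bar_def)
    have L': "f_col n l L = raise_letter (2 * n - l) L" using na by (auto simp: f_col_def)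
    have cnt': "cnt (f_col n l L) a = cnt L a" if "a \<le> n" for a
      unfolding L' using p l True that by (simp add: cnt_raise_letter)
    have bar': "cnt_bar n (f_col n l L) a = cnt_bar n L a + (if a = l then 1 else 0)"
      if "a \<le> n" for a
      unfolding L' using p l True LD that by (simp add: cnt_bar_raise_letter)
    have card': "card (f_col n l L) = card L" unfolding L'
      using p LD by (simp add: card_raise_letter)
    have L1: "2 * n - l \<in> L" "Suc (2 * n - l) \<notin> L" "l \<notin> L \<or> Suc l \<in> L"
      using p b by (auto simp: plus_at_def)
    \<comment> \<open>Without a minus on the edge \<open>l\<close> the column \<open>L\<close> has
      \<open>eps\<close> zero, because its barred edge carries a plus; then \<open>le\<close> makes
      \<open>phi n l R\<close> zero.\<close>
    have R1: "\<not> minus_at l L \<Longrightarrow> \<not> plus_bar n l R"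
      using le eps_eq_0[of n l L] phi_eq_0[of n l R] not_plus_minus_bar[OF b(1)] by auto
    show ?thesis
    proof
      assume c: "compat n R L"
      note D = compatD[OF c]
      show "compat n R (f_col n l L)"
      proof (intro compatI, goal_cases)
        case (1 a b)
        note D1 = D[OF 1]
        consider "b \<noteq> l" | "b = l" "a \<le> l - 1" "a \<noteq> l" | "b = l" "a = l" using 1 by linarith
        then show ?case
        proof cases
          case 1
          then show ?thesis using D1 \<open>a \<le> b\<close> \<open>b \<le> n\<close> by (auto simp: cnt' bar' card')
        next
          case 2
          then have as: "a \<le> Suc l" by simp
          show ?thesis
            using 2 D1 k D(2)[OF \<open>a \<le> l - 1\<close> k(2)] D(2)[OF as sn(1)] L1 cL l True
            by (auto simp: cnt' bar' card' split: if_splits)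
        next
          case 3
          then show ?thesis
            using D1 k D(2)[OF order_refl k(2)] D(2)[OF order_refl sn(1)] D(2)[OF sn(2,1)] L1 cR cL
              l True R1
            by (auto simp: cnt' bar' card' minus_at_def plus_bar_def plus_at_def split: if_splits)
        qed
      qed
    next
      assume c: "compat n R (f_col n l L)"
      from compatD[OF this, unfolded card'] show "compat n R L"
        by (intro compatI) (fastforce simp: cnt' bar' split: if_splits)
    qed
  qed
next
  case False
  then have ln: "l = n" using l by simp
  have k: "l - 1 \<le> l" "l - 1 \<le> n" "l - 1 \<noteq> l" using l by auto
  note RD = admissibleD[OF R] and LD = admissibleD[OF L]
  note cR = local_counts(1,2)[OF l(1), where C = R] local_counts(3)[OF l, where C = R]
  note cL = local_counts(1,2)[OF l(1), where C = L] local_counts(3)[OF l, where C = L]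
  have nb: "\<not> plus_bar n l C" "\<not> minus_bar n l C" for C
    using ln by (auto simp: plus_bar_def minus_bar_def)
  have a: "plus_at l L" "\<not> plus_at l R"
    using le pos phi_eq_0[of n l L] phi_eq_0[of n l R] eps_eq_0[of n l L] nb
    by (auto simp: plus_at_def minus_at_def)
  then have L': "f_col n l L = raise_letter l L" using nb by (simp add: f_col_def)
  have cnt': "cnt (f_col n l L) a = cnt L a - (if a = l then 1 else 0)" for a
    unfolding L' using a l by (simp add: cnt_raise_letter)
  have bar': "cnt_bar n (f_col n l L) a = cnt_bar n L a + (if a = l then 1 else 0)" if "a \<le> n" for a
    unfolding L' using a l ln LD that by (simp add: cnt_bar_raise_letter)
  have card': "card (f_col n l L) = card L" unfolding L' using a LD by (simp add: card_raise_letter)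
  have tot: "cnt R n + cnt_bar n R n = int (card R)" "cnt L n + cnt_bar n L n = int (card L)"
    using cnt_cnt_bar[of _ n n] RD LD by auto
  have m: "2 * n - l = l" using ln by simp
  show ?thesis
  proof
    assume c: "compat n R L"
    note D = compatD[OF c]
    show "compat n R (f_col n l L)"
    proof (intro compatI, goal_cases)
      case (1 a b)
      note D1 = D[OF 1]
      consider "a \<noteq> l" | "a = l" "b = l" using 1 ln by linarith
      then show ?case
      proof cases
        case 1
        then show ?thesis using D1 \<open>a \<le> b\<close> \<open>b \<le> n\<close> by (auto simp: cnt' bar' card' split: if_splits)
      next
        case 2
        then show ?thesis
          using D1 k D[OF order_refl k(2)] a cR cL l tot m ln
          by (auto simp: cnt'[unfolded ln] bar'[unfolded ln] card'[unfolded ln] minus_at_def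
            plus_at_def split: if_splits)
      qed
    qed
  next
    assume c: "compat n R (f_col n l L)"
    note D = compatD[OF c, unfolded card']
    show "compat n R L"
    proof (intro compatI, goal_cases)
      case (1 a b)
      then show ?case using D[OF 1] by (auto simp: cnt' bar' split: if_splits)
    qed
  qed
qed

section \<open>The conditions of the theorem as inequalities\<close>

lemma cnt_mono: "a \<le> b \<Longrightarrow> cnt C a \<le> cnt C b"
  unfolding cnt_def by (intro of_nat_mono card_mono) auto

lemma cnt_le_card: "finite C \<Longrightarrow> cnt C a \<le> int (card C)"
  unfolding cnt_def by (intro of_nat_mono card_mono) auto

text \<open>Take a violation with \<open>b - a\<close> minimal. The inequalities for
  \<open>(a + 1, b)\<close> and \<open>(a, b - 1)\<close> force \<open>g b = H a + 1\<close>, with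
  \<open>H\<close> ascending from \<open>a\<close> and \<open>g\<close> ascending to
  \<open>b\<close>; the hypothesis on pairs of ascents excludes exactly this.\<close>

lemma le_from_ascents:
  fixes H g :: "nat \<Rightarrow> int"
  assumes "\<And>a. a < n \<Longrightarrow> H (Suc a) \<le> H a + 1" "\<And>a. a < n \<Longrightarrow> g (Suc a) \<le> g a + 1"
    and "\<And>a. a \<le> n \<Longrightarrow> g a \<le> H a"
    and "\<And>a b. a \<le> b \<Longrightarrow> b < n \<Longrightarrow> H (Suc a) = H a + 1 \<Longrightarrow> g (Suc b) = g b + 1 \<Longrightarrow> g (Suc b) < H (Suc a)"
    and "a \<le> b" "b \<le> n"
  shows "g b \<le> H a"
  using assms(5,6)
proof (induction "b - a" arbitrary: a b rule: less_induct)
  case less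
  show ?case
  proof (cases "a = b")
    case True
    then show ?thesis using assms(3) less.prems by simp
  next
    case False
    then obtain b' where b': "b = Suc b'" "a \<le> b'" using less.prems by (cases b) auto
    have "g b \<le> H (Suc a)" using less.hyps[of b "Suc a"] False less.prems by auto
    moreover have "g b' \<le> H a" using less.hyps[of b' a] b' less.prems by auto
    moreover have "H (Suc a) \<le> H a + 1" "g (Suc b') \<le> g b' + 1"
      using assms(1)[of a] assms(2)[of b'] b' less.prems by auto
    moreover have "H (Suc a) = H a + 1 \<Longrightarrow> g b = g b' + 1 \<Longrightarrow> g b < H (Suc a)"
      using assms(4)[of a b'] b' less.prems by auto
    ultimately show ?thesis unfolding b'(1) by linarith
  qed
qed

text \<open>The memberships mark ascents: the right-hand side of \<open>compat\<close> rises at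
  \<open>a\<close> and the slack of \<open>C\<close> at \<open>b\<close>. With \<open>C = R\<close>
  this is the absence of a configuration of condition 3, with \<open>C = L\<close> of condition
  4.\<close>

definition corner_free :: "nat \<Rightarrow> nat set \<Rightarrow> nat set \<Rightarrow> nat set \<Rightarrow> bool" where
  "corner_free n R L C \<longleftrightarrow> (\<forall>a b. 1 \<le> a \<and> a \<le> b \<and> b \<le> n \<and> Suc (2 * n - a) \<in> R \<and> a \<in> L
      \<and> Suc (2 * n - b) \<in> C \<and> b \<in> C \<longrightarrow>
     slack n C b + int (card R) - int (card C) < cnt L a + cnt_bar n R a - int a)"

lemma compat_iff_corner_free:
  assumes "R \<subseteq> {1..2 * n}" "L \<subseteq> {1..2 * n}"
  shows "compat n R L \<longleftrightarrow> (\<forall>y\<le>2 * n. cnt R y \<le> cnt L y) \<and> corner_free n R L R \<and> corner_free n R L L"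
proof
  assume c: "compat n R L"
  have "cnt R y \<le> cnt L y" if "y \<le> 2 * n" for y
  proof (cases "y \<le> n")
    case True
    then show ?thesis using compatD(1)[OF c order_refl True] by simp
  next
    case False
    then have "2 * n - y \<le> n" "2 * n - y \<le> 2 * n" "2 * n - (2 * n - y) = y" using that by auto
    then show ?thesis
      using compatD(2)[OF c order_refl, of "2 * n - y"] cnt_cnt_bar[OF assms(1), of "2 * n - y"]
        cnt_cnt_bar[OF assms(2), of "2 * n - y"] by simp
  qed
  moreover have "corner_free n R L R \<and> corner_free n R L L"
    unfolding corner_free_def
  proof (intro conjI allI impI; elim conjE)
    fix a b assume ab: "1 \<le> a" "a \<le> b" "b \<le> n" "Suc (2 * n - a) \<in> R" "a \<in> L"
    \<comment> \<open>The strict inequality at \<open>a\<close> is the weak one at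
      \<open>a - 1\<close>, as the right-hand side rises by one from \<open>a - 1\<close> to
      \<open>a\<close>.\<close>
    then have "a - 1 \<le> b" by simp
    note D = compatD[OF c this ab(3)]
    have H: "cnt L a + cnt_bar n R a - int a
        = cnt L (a - 1) + cnt_bar n R (a - 1) - int (a - 1) + 1"
      using local_counts(1)[OF ab(1), of L] local_counts(3)[OF ab(1), of n R] ab by simp
    show "slack n R b + int (card R) - int (card R) < cnt L a + cnt_bar n R a - int a"
      "slack n L b + int (card R) - int (card L) < cnt L a + cnt_bar n R a - int a"
      using D H by (simp_all add: slack_def)
  qed
  ultimately show "(\<forall>y\<le>2 * n. cnt R y \<le> cnt L y) \<and> corner_free n R L R \<and> corner_free n R L L"
    by blast
next
  assume asm: "(\<forall>y\<le>2 * n. cnt R y \<le> cnt L y) \<and> corner_free n R L R \<and> corner_free n R L L"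
  define H where "H a = cnt L a + cnt_bar n R a - int a" for a
  have H_Suc: "H (Suc a) = H a + of_bool (Suc a \<in> L) + of_bool (2 * n - a \<in> R) - 1" if "a < n" for a
    using that by (simp add: H_def cnt_Suc cnt_bar_Suc)
  have s_Suc: "slack n C (Suc a) = slack n C a + of_bool (Suc a \<in> C) + of_bool (2 * n - a \<in> C) - 1"
    if "a < n" for a C
    using that by (simp add: slack_def cnt_Suc cnt_bar_Suc)
  have bar: "cnt_bar n L a + int (card R) - int (card L) \<le> cnt_bar n R a" if "a \<le> n" for a
  proof -
    have "cnt R (2 * n - a) \<le> cnt L (2 * n - a)" using asm by simp
    then show ?thesis using cnt_cnt_bar[OF assms(1), of a] cnt_cnt_bar[OF assms(2), of a] that
      by simp
  qed
  have cnt: "cnt R a \<le> cnt L a" if "a \<le> n" for a using asm that by simp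
  have corner: "slack n C (Suc b) + int (card R) - int (card C) < H (Suc a)"
    if "a \<le> b" "b < n" "H (Suc a) = H a + 1" "slack n C (Suc b) = slack n C b + 1"
      "corner_free n R L C" for a b C
  proof -
    have "Suc a \<in> L" "2 * n - a \<in> R" "Suc b \<in> C" "2 * n - b \<in> C"
      using that H_Suc[of a] s_Suc[of b C] by (auto simp: of_bool_def split: if_splits)
    moreover have "Suc (2 * n - Suc a) = 2 * n - a" "Suc (2 * n - Suc b) = 2 * n - b"
      using that by auto
    ultimately show ?thesis
      using that(1,2) that(5)[unfolded corner_free_def, rule_format, of "Suc a" "Suc b"]
      unfolding H_def by simp
  qed
  have "slack n C b + int (card R) - int (card C) \<le> H a"
    if "C = R \<or> C = L" "a \<le> b" "b \<le> n" for a b C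
  proof (rule le_from_ascents[where H = H and n = n and a = a and b = b
        and g = "\<lambda>b. slack n C b + int (card R) - int (card C)"])
    fix a assume "a \<le> n"
    then show "slack n C a + int (card R) - int (card C) \<le> H a"
      using that(1) cnt bar unfolding slack_def H_def by fastforce
  next
    fix a b assume "a \<le> b" "b < n" "H (Suc a) = H a + 1"
      "slack n C (Suc b) + int (card R) - int (card C)
          = slack n C b + int (card R) - int (card C) + 1"
    then show "slack n C (Suc b) + int (card R) - int (card C) < H (Suc a)"
      using corner[of a b C] that(1) asm by auto
  qed (use that in \<open>auto simp: H_Suc s_Suc\<close>)
  from this[of R] this[of L] show "compat n R L" by (auto simp: compat_def H_def)
qed

text \<open>The clauses with \<delta> in conditions 3 and 4 are membership in the column in
  disguise: up to \<open>i\<close> a letter is present if it is not an unprimed entry, beyond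
  \<open>i\<close> if its predecessor is a primed one.\<close>

lemma avoids_column:
  assumes "bisorted i ps" "1 \<le> i" "1 \<le> y" "y \<le> n"
  shows "avoids n y i ps \<longleftrightarrow> y \<in> column i ps"
  using assms
  by (auto simp: avoids_def delta_def scale_def Let_def mem_column[OF assms(1)] letters_def simp
    del: set_map)

text \<open>A letter of the column is no unprimed entry, so \<open><\<close> and
  \<open>\<le>\<close> count the same unprimed entries; \<open>excess\<close> is the difference
  between \<open>y\<close> and \<open>min y i\<close>. Thus the counts in clause (c) combine to row
  counts.\<close>

lemma cnt_column_mem:
  assumes "bisorted i ps" "y \<in> column i ps"
  shows "int (card {z \<in> unprimed ps. z < y}) - int (card {z \<in> primed ps. z < y}) + excess y i
    = int y - cnt (column i ps) y"
proof -
  have "y \<notin> unprimed ps"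
    using assms(2) mem_column[OF assms(1), of y] bisortedD(1)[OF assms(1)]
    by (auto split: if_splits simp del: set_map)
  then have *: "{z \<in> unprimed ps. z \<le> y} = {z \<in> unprimed ps. z < y}"
    using order_le_less by blast
  show ?thesis using cnt_column[OF assms(1), of y] unfolding excess_def * by linarith
qed

lemma card_split_less:
  fixes y :: nat
  assumes "finite S"
  shows "card S = card {b \<in> S. b < y} + card {b \<in> S. y \<le> b}"
proof -
  have "card ({b \<in> S. b < y} \<union> {b \<in> S. y \<le> b}) = card {b \<in> S. b < y} + card {b \<in> S. y \<le> b}"
    using assms by (intro card_Un_disjoint) auto
  moreover have "{b \<in> S. b < y} \<union> {b \<in> S. y \<le> b} = S" by auto
  ultimately show ?thesis by simp
qed

lemma primed_eq_nths:
  "b \<in> primed xs \<longleftrightarrow> (\<exists>p\<in>{1..len xs}. entry' xs p = b)"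
proof
  assume "b \<in> primed xs"
  then obtain m where "m < length xs" "map snd xs ! m = b" by (auto simp: in_set_conv_nth)
  then show "\<exists>p\<in>{1..len xs}. entry' xs p = b"
    by (intro bexI[of _ "int m + 1"]) (auto simp: entry'_def len_def)
next
  assume "\<exists>p\<in>{1..len xs}. entry' xs p = b"
  then show "b \<in> primed xs" by (auto simp: entry'_def len_def intro!: image_eqI nth_mem)
qed

lemma card_less_entry':
  assumes "bisorted i xs" "p \<in> {1..len xs}"
  shows "int (card {b \<in> primed xs. b < entry' xs p}) = p - 1"
proof -
  have m: "nat (p - 1) < length xs" "int (nat (p - 1)) = p - 1"
    using assms(2) by (auto simp: len_def)
  then show ?thesis
    using card_less_nth[OF bisortedD(6)[OF assms(1)], of "nat (p - 1)"]
    by (simp add: entry'_def del: set_map)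
qed

text \<open>The primed entries from the \<open>p\<close>-th on are those that contribute the barred
  letters of \<open>1, \<dots>, a\<close>, so a barred count determines \<open>p\<close> from the
  end of the list. This turns \<open>p - r\<close> in clause (c) into a difference of barred
  counts.\<close>

lemma entry'_ge_n:
  assumes ps: "ps \<in> Rseq n i s" and i: "1 \<le> i" "i \<le> n" and p: "p \<in> {1..len ps}" "n \<le> entry' ps p"
  obtains a where "1 \<le> a" "a \<le> n" "entry' ps p = 2 * n - a" "bar n (entry' ps p) = a"
    "Suc (2 * n - a) \<in> column i ps" "p = len ps + 1 - cnt_bar n (column i ps) a"
proof -
  note bs = Rseq_bisorted[OF ps]
  define a where "a = bar n (entry' ps p)"
  have mem: "entry' ps p \<in> primed ps" using p(1) primed_eq_nths by blast
  have pl: "primed ps \<subseteq> {..<2 * n}" using ps i by (fastforce simp: Rseq_def letters_def)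
  then have a: "1 \<le> a" "a \<le> n" "entry' ps p = 2 * n - a"
    using mem p(2) by (auto simp: a_def bar_def simp del: set_map)
  have Suc: "Suc (2 * n - a) \<in> column i ps"
    using mem unfolding a(3) column_def by blast
  have "card (primed ps) = card {b \<in> primed ps. b < entry' ps p} + card {b \<in> primed ps. entry' ps p
      \<le> b}"
    by (rule card_split_less) simp
  then have "len ps = p - 1 + cnt_bar n (column i ps) a"
    using cnt_bar_column[OF bs pl i(2) a(2)] card_less_entry'[OF bs p(1)] bisortedD(8)[OF bs]
    unfolding a(3) len_def by linarith
  then have "p = len ps + 1 - cnt_bar n (column i ps) a" by simp
  with Suc show ?thesis by (intro that[OF a a_def[symmetric]])
qed

lemma entry'_bar_index:
  assumes "ps \<in> Rseq n i s" "1 \<le> i" "i \<le> n" "p \<in> {1..len ps}" "entry' ps p = 2 * n - a"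
    "1 \<le> a" "a \<le> n"
  shows "bar n (entry' ps p) = a" "p = len ps + 1 - cnt_bar n (column i ps) a"
proof -
  show b: "bar n (entry' ps p) = a" using assms by (simp add: bar_def)
  have "n \<le> entry' ps p" using assms by simp
  from entry'_ge_n[OF assms(1-4) this] b show "p = len ps + 1 - cnt_bar n (column i ps) a" by metis
qed

lemma entry'_bar_exists:
  assumes "bisorted i ps" "i \<le> n" "1 \<le> a" "a \<le> n" "Suc (2 * n - a) \<in> column i ps"
  obtains p where "p \<in> {1..len ps}" "entry' ps p = 2 * n - a"
proof -
  have "2 * n - a \<in> primed ps"
    using assms mem_column[OF assms(1)] by (auto split: if_splits simp del: set_map)
  then show ?thesis using primed_eq_nths that by blast
qed

lemma cond3D:
  assumes "cond3 n i xs j ys" "xs \<noteq> []" "p \<in> {1..len xs}" "r \<in> {1..len xs}"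
    "a = bar n (entry' xs p)" "b = bar n (entry' xs r)"
    "entry' xs r \<le> entry' xs p" "n \<le> entry' xs r" "avoids n b i xs" "avoids n a j ys"
  shows "\<not> (p - r) + int (card {y \<in> unprimed ys. y < a}) - int (card {y \<in> unprimed xs. y < b})
            + int (card {y \<in> primed xs. y < b}) - int (card {y \<in> primed ys. y < a})
          \<ge> excess b i - excess a j"
  using assms(1-4,7-10) unfolding cond3_def Let_def assms(5,6) by blast

lemma cond4D:
  assumes "cond4 n i xs j ys" "xs \<noteq> []" "ys \<noteq> []" "p \<in> {1..len xs}" "r \<in> {1..len ys}"
    "a = bar n (entry' xs p)" "b = bar n (entry' ys r)"
    "entry' ys r \<le> entry' xs p" "n \<le> entry' ys r" "avoids n a j ys" "avoids n b j ys"
  shows "\<not> (int i - int j) + (len ys - len xs) + (p - r)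
            + int (card {y \<in> primed ys. a \<le> y \<and> y < b})
            - int (card {y \<in> unprimed ys. a \<le> y \<and> y < b})
          \<ge> excess b j - excess a j"
  using assms(1-5,8-11) unfolding cond4_def Let_def assms(6,7) by blast

section \<open>Conditions 3 and 4 as absence of corners\<close>

context
  fixes n i j s t :: nat and xs ys :: pseq
  assumes xs: "xs \<in> Rseq n i s" and ys: "ys \<in> Rseq n j t" and ij: "1 \<le> i" "i \<le> j" "j \<le> n"
begin

lemma bR: "bisorted i xs" and bL: "bisorted j ys" and iN: "i \<le> n" and jN: "1 \<le> j"
  using Rseq_bisorted xs ys ij by auto

text \<open>Let \<open>a\<close> and \<open>b\<close> be the bars of the primed entries with
  subscripts \<open>p\<close> and \<open>r\<close>. The order of the entries becomes
  \<open>a \<le> b\<close>, clauses (a) and (b) become memberships, and (c) becomes the negated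
  corner inequality.\<close>

lemma cond3_iff: "cond3 n i xs j ys \<longleftrightarrow> corner_free n (column i xs) (column j ys) (column i xs)"
proof -
  have *: "(p - r) + int (card {y \<in> unprimed ys. y < a}) - int (card {y \<in> unprimed xs. y < b})
            + int (card {y \<in> primed xs. y < b}) - int (card {y \<in> primed ys. y < a})
          \<ge> excess b i - excess a j
              \<longleftrightarrow> slack n (column i xs) b \<ge> cnt (column j ys) a + cnt_bar n (column i xs) a - int a"
    if "a \<in> column j ys" "b \<in> column i xs" "p = len xs + 1 - cnt_bar n (column i xs) a"
      "r = len xs + 1 - cnt_bar n (column i xs) b" for p r a b
    using cnt_column_mem[OF bL that(1)] cnt_column_mem[OF bR that(2)] that(3,4)
    by (auto simp: slack_def simp del: set_map)
  show ?thesis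
  proof
    assume c: "cond3 n i xs j ys"
    show "corner_free n (column i xs) (column j ys) (column i xs)"
      unfolding corner_free_def
    proof (intro allI impI; elim conjE)
      fix a b assume ab: "1 \<le> a" "a \<le> b" "b \<le> n" "Suc (2 * n - a) \<in> column i xs" "a \<in> column j ys"
        "Suc (2 * n - b) \<in> column i xs" "b \<in> column i xs"
      obtain p where p: "p \<in> {1..len xs}" "entry' xs p = 2 * n - a"
        using entry'_bar_exists[OF bR iN ab(1) _ ab(4)] ab by auto
      obtain r where r: "r \<in> {1..len xs}" "entry' xs r = 2 * n - b"
        using entry'_bar_exists[OF bR iN _ ab(3,6)] ab by auto
      have a1: "a \<le> n" "1 \<le> b" using ab by auto
      have ge: "n \<le> entry' xs p" "n \<le> entry' xs r" using p r ab by auto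
      note a' = entry'_bar_index[OF xs ij(1) iN p ab(1) a1(1)]
      note b' = entry'_bar_index[OF xs ij(1) iN r a1(2) ab(3)]
      have "xs \<noteq> []" using p by (auto simp: len_def)
      moreover have "entry' xs r \<le> entry' xs p" using p r ab by auto
      moreover have "avoids n b i xs" "avoids n a j ys"
        using avoids_column[OF bR ij(1), of b n] avoids_column[OF bL jN, of a n] ab by auto
      ultimately have "\<not> (slack n (column i xs) b
          \<ge> cnt (column j ys) a + cnt_bar n (column i xs) a - int a)"
        unfolding *[OF ab(5,7) a'(2) b'(2), symmetric]
        using ge(2) by (intro cond3D[OF c _ p(1) r(1) a'(1)[symmetric] b'(1)[symmetric]])
      then show "slack n (column i xs) b + int (card (column i xs)) - int (card (column i xs))
          < cnt (column j ys) a + cnt_bar n (column i xs) a - int a" by simp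
    qed
  next
    assume cf: "corner_free n (column i xs) (column j ys) (column i xs)"
    show "cond3 n i xs j ys"
      unfolding cond3_def Let_def
    proof (intro notI, elim conjE bexE)
      fix p r
      assume p: "p \<in> {1..len xs}" and r: "r \<in> {1..len xs}"
        and le: "entry' xs r \<le> entry' xs p" and ge: "n \<le> entry' xs r"
        and av: "avoids n (bar n (entry' xs r)) i xs" "avoids n (bar n (entry' xs p)) j ys"
        and big: "excess (bar n (entry' xs r)) i - excess (bar n (entry' xs p)) j
          \<le> p - r + int (card {y \<in> unprimed ys. y < bar n (entry' xs p)})
            - int (card {y \<in> unprimed xs. y < bar n (entry' xs r)})
            + int (card {y \<in> primed xs. y < bar n (entry' xs r)})
            - int (card {y \<in> primed ys. y < bar n (entry' xs p)})"
      obtain a where a: "1 \<le> a" "a \<le> n" "entry' xs p = 2 * n - a" "bar n (entry' xs p) = a"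
        "Suc (2 * n - a) \<in> column i xs" "p = len xs + 1 - cnt_bar n (column i xs) a"
        using entry'_ge_n[OF xs ij(1) iN p order_trans[OF ge le]] by metis
      obtain b where b: "1 \<le> b" "b \<le> n" "entry' xs r = 2 * n - b" "bar n (entry' xs r) = b"
        "Suc (2 * n - b) \<in> column i xs" "r = len xs + 1 - cnt_bar n (column i xs) b"
        using entry'_ge_n[OF xs ij(1) iN r ge] by metis
      have mem: "b \<in> column i xs" "a \<in> column j ys"
        using av a b avoids_column[OF bR ij(1) b(1,2)] avoids_column[OF bL jN a(1,2)] by auto
      have "a \<le> b" using le a b by auto
      then have "slack n (column i xs) b < cnt (column j ys) a + cnt_bar n (column i xs) a - int a"
        using cf a b mem unfolding corner_free_def by auto
      then show False using big *[OF mem(2,1) a(6) b(6)] unfolding a(4) b(4) by linarith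
    qed
  qed
qed

text \<open>As for condition 3, but \<open>b\<close> now comes from the second sequence:
  \<open>t - s\<close> cancels the lengths hidden in \<open>p\<close> and \<open>r\<close>, and
  \<open>i - j\<close> is the difference of the heights.\<close>

lemma cond4_iff: "cond4 n i xs j ys \<longleftrightarrow> corner_free n (column i xs) (column j ys) (column j ys)"
proof -
  have *: "(int i - int j) + (len ys - len xs) + (p - r)
            + int (card {y \<in> primed ys. a \<le> y \<and> y < b})
            - int (card {y \<in> unprimed ys. a \<le> y \<and> y < b})
          \<ge> excess b j - excess a j \<longleftrightarrow>
      slack n (column j ys) b + int (card (column i xs)) - int (card (column j ys))
          \<ge> cnt (column j ys) a + cnt_bar n (column i xs) a - int a"
    if "a \<in> column j ys" "b \<in> column j ys" "a \<le> b" "p = len xs + 1 - cnt_bar n (column i xs) a"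
      "r = len ys + 1 - cnt_bar n (column j ys) b" for p r a b
  proof -
    have split: "card {y \<in> S. y < b} = card {y \<in> S. y < a} + card {y \<in> S. a \<le> y \<and> y < b}"
      if "finite S" for S
    proof -
      have "{z \<in> {y \<in> S. y < b}. z < a} = {y \<in> S. y < a}"
        "{z \<in> {y \<in> S. y < b}. a \<le> z} = {y \<in> S. a \<le> y \<and> y < b}"
        using \<open>a \<le> b\<close> by auto
      then show ?thesis using card_split_less[of "{y \<in> S. y < b}" a] that by simp
    qed
    show ?thesis
      using cnt_column_mem[OF bL that(1)] cnt_column_mem[OF bL that(2)] that(4,5)
        card_column[OF bR] card_column[OF bL] split[of "primed ys"] split[of "unprimed ys"]
      by (auto simp: slack_def simp del: set_map)
  qed
  show ?thesis
  proof
    assume c: "cond4 n i xs j ys"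
    show "corner_free n (column i xs) (column j ys) (column j ys)"
      unfolding corner_free_def
    proof (intro allI impI; elim conjE)
      fix a b assume ab: "1 \<le> a" "a \<le> b" "b \<le> n" "Suc (2 * n - a) \<in> column i xs" "a \<in> column j ys"
        "Suc (2 * n - b) \<in> column j ys" "b \<in> column j ys"
      obtain p where p: "p \<in> {1..len xs}" "entry' xs p = 2 * n - a"
        using entry'_bar_exists[OF bR iN ab(1) _ ab(4)] ab by auto
      obtain r where r: "r \<in> {1..len ys}" "entry' ys r = 2 * n - b"
        using entry'_bar_exists[OF bL ij(3) _ ab(3,6)] ab by auto
      have a1: "a \<le> n" "1 \<le> b" using ab by auto
      have ge: "n \<le> entry' xs p" "n \<le> entry' ys r" using p r ab by auto
      note a' = entry'_bar_index[OF xs ij(1) iN p ab(1) a1(1)]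
      note b' = entry'_bar_index[OF ys jN ij(3) r a1(2) ab(3)]
      have "xs \<noteq> []" "ys \<noteq> []" using p r by (auto simp: len_def)
      moreover have "entry' ys r \<le> entry' xs p" using p r ab by auto
      moreover have "avoids n b j ys" "avoids n a j ys"
        using avoids_column[OF bL jN, of b n] avoids_column[OF bL jN, of a n] ab by auto
      ultimately have "\<not> (slack n (column j ys) b
          + int (card (column i xs)) - int (card (column j ys))
          \<ge> cnt (column j ys) a + cnt_bar n (column i xs) a - int a)"
        unfolding *[OF ab(5,7,2) a'(2) b'(2), symmetric]
        using ge(2) by (intro cond4D[OF c _ _ p(1) r(1) a'(1)[symmetric] b'(1)[symmetric]])
      then show "slack n (column j ys) b + int (card (column i xs)) - int (card (column j ys))
          < cnt (column j ys) a + cnt_bar n (column i xs) a - int a" by simp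
    qed
  next
    assume cf: "corner_free n (column i xs) (column j ys) (column j ys)"
    show "cond4 n i xs j ys"
      unfolding cond4_def Let_def
    proof (intro notI, elim conjE bexE)
      fix p r
      assume p: "p \<in> {1..len xs}" and r: "r \<in> {1..len ys}"
        and le: "entry' ys r \<le> entry' xs p" and ge: "n \<le> entry' ys r"
        and av: "avoids n (bar n (entry' xs p)) j ys" "avoids n (bar n (entry' ys r)) j ys"
        and big: "excess (bar n (entry' ys r)) j - excess (bar n (entry' xs p)) j
          \<le> int i - int j + (len ys - len xs) + (p - r)
            + int (card {y \<in> primed ys. bar n (entry' xs p) \<le> y \<and> y < bar n (entry' ys r)})
            - int (card {y \<in> unprimed ys. bar n (entry' xs p) \<le> y \<and> y < bar n (entry' ys r)})"
      obtain a where a: "1 \<le> a" "a \<le> n" "entry' xs p = 2 * n - a" "bar n (entry' xs p) = a"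
        "Suc (2 * n - a) \<in> column i xs" "p = len xs + 1 - cnt_bar n (column i xs) a"
        using entry'_ge_n[OF xs ij(1) iN p order_trans[OF ge le]] by metis
      obtain b where b: "1 \<le> b" "b \<le> n" "entry' ys r = 2 * n - b" "bar n (entry' ys r) = b"
        "Suc (2 * n - b) \<in> column j ys" "r = len ys + 1 - cnt_bar n (column j ys) b"
        using entry'_ge_n[OF ys jN ij(3) r ge] by metis
      have mem: "b \<in> column j ys" "a \<in> column j ys"
        using av a b avoids_column[OF bL jN b(1,2)] avoids_column[OF bL jN a(1,2)] by auto
      have ab: "a \<le> b" using le a b by auto
      then have "slack n (column j ys) b + int (card (column i xs)) - int (card (column j ys))
          < cnt (column j ys) a + cnt_bar n (column i xs) a - int a"
        using cf a b mem unfolding corner_free_def by auto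
      then show False using big *[OF mem(2,1) ab a(6) b(6)] unfolding a(4) b(4) by linarith
    qed
  qed
qed

end

text \<open>The unprimed entries decrease, so the one with subscript \<open>t - p\<close> is entry
  \<open>p\<close>, counted from 0, of the reversed list. The indices whose entry is at most
  \<open>i\<close> form an initial segment ending at \<open>u\<close>; the default \<open>-1\<close>
  fits the empty segment.\<close>

lemma u_bound:
  assumes "bisorted j ys"
  shows "- 1 \<le> u_bound i ys" "u_bound i ys < len ys"
    "p < length ys \<Longrightarrow> int p \<le> u_bound i ys \<longleftrightarrow> rev (map fst ys) ! p \<le> i"
proof -
  define U where "U = {r \<in> {0..len ys - 1}. entry ys (len ys - r) \<le> i}"
  have fin: "finite U" unfolding U_def by (rule finite_subset[of _ "{0..len ys - 1}"]) auto
  have u: "u_bound i ys = (if U = {} then -1 else Max U)"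
    unfolding u_bound_def Let_def U_def[symmetric] ..
  have MaxU: "U \<noteq> {} \<Longrightarrow> Max U \<in> U" using fin by simp
  have range: "r \<in> U \<Longrightarrow> 0 \<le> r \<and> r < len ys" for r by (simp add: U_def)
  show "- 1 \<le> u_bound i ys" "u_bound i ys < len ys"
    using MaxU range by (auto simp: u) (auto simp: len_def; fastforce)+
  have ent: "entry ys (len ys - int p) = rev (map fst ys) ! p" if "p < length ys" for p
    using that by (simp add: entry_def len_def rev_nth nat_diff_distrib' flip: of_nat_diff)
  have memU: "int p \<in> U \<longleftrightarrow> rev (map fst ys) ! p \<le> i" if "p < length ys" for p
    using that ent[OF that] by (auto simp: U_def len_def)
  have mono: "rev (map fst ys) ! p \<le> rev (map fst ys) ! q" if "p \<le> q" "q < length ys" for p q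
    using bisortedD(5)[OF assms] that
    by (cases "p = q") (auto simp: sorted_wrt_iff_nth_less intro: less_imp_le)
  assume p: "p < length ys"
  show "int p \<le> u_bound i ys \<longleftrightarrow> rev (map fst ys) ! p \<le> i"
  proof
    assume le: "int p \<le> u_bound i ys"
    then have ne: "U \<noteq> {}" by (auto simp: u)
    obtain q where q: "Max U = int q" "q < length ys"
      using range[OF MaxU[OF ne]] zero_le_imp_eq_int by (fastforce simp: len_def)
    then have "rev (map fst ys) ! q \<le> i" using MaxU[OF ne] memU[of q] by simp
    moreover have "p \<le> q" using le q ne by (simp add: u)
    ultimately show "rev (map fst ys) ! p \<le> i" using mono[of p q] q by linarith
  next
    assume "rev (map fst ys) ! p \<le> i"
    then have "int p \<in> U" using memU p by simp
    then show "int p \<le> u_bound i ys" using fin by (auto simp: u)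
  qed
qed

lemma entry_rev_nth:
  assumes "p < length ys" shows "entry ys (len ys - int p) = rev (map fst ys) ! p"
  using assms by (simp add: entry_def len_def rev_nth nat_diff_distrib' flip: of_nat_diff)

lemma card_unprimed_le:
  assumes "bisorted j ys" "p < length ys"
  shows "card {a \<in> unprimed ys. a \<le> rev (map fst ys) ! p} = Suc p"
proof -
  let ?e = "rev (map fst ys) ! p"
  have "?e \<in> unprimed ys" using nth_mem[of p "rev (map fst ys)"] assms(2) by (simp del: set_map)
  then have "{a \<in> unprimed ys. a \<le> ?e} = insert ?e {a \<in> unprimed ys. a < ?e}"
    by (auto simp: order_le_less simp del: set_map)
  moreover have "card {a \<in> unprimed ys. a < ?e} = p"
    using card_less_nth[OF bisortedD(5)[OF assms(1)], of p] assms(2) by (simp del: set_map)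
  ultimately show ?thesis by simp
qed

lemma unprimed_nthE:
  assumes "e \<in> unprimed ys"
  obtains p where "p < length ys" "e = rev (map fst ys) ! p"
proof -
  have "e \<in> set (rev (map fst ys))" using assms by simp
  then show ?thesis using that unfolding in_set_conv_nth by auto
qed

lemma unprimed_nth: "p < length ys \<Longrightarrow> rev (map fst ys) ! p \<in> unprimed ys"
  using nth_mem[of p "rev (map fst ys)"] by (simp del: set_map)

lemma ball_unprimed:
  "(\<forall>e\<in>unprimed ys. P e) \<longleftrightarrow> (\<forall>p<length ys. P (rev (map fst ys) ! p))"
proof
  assume r: "\<forall>p<length ys. P (rev (map fst ys) ! p)"
  show "\<forall>e\<in>unprimed ys. P e"
  proof
    fix e assume "e \<in> unprimed ys"
    then obtain p where "p < length ys" "e = rev (map fst ys) ! p" by (rule unprimed_nthE)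
    with r show "P e" by blast
  qed
qed (use unprimed_nth in blast)

lemma le_entry'_iff:
  assumes "bisorted i xs" "1 \<le> m" "m \<le> len xs"
  shows "y \<le> entry' xs m \<longleftrightarrow> int (card {b \<in> primed xs. b < y}) \<le> m - 1"
proof -
  have m: "nat (m - 1) < length xs" using assms by (auto simp: len_def)
  have "y \<le> map snd xs ! nat (m - 1) \<longleftrightarrow> card {b \<in> primed xs. b < y} \<le> nat (m - 1)"
    by (rule le_nth_iff_card[OF bisortedD(6)[OF assms(1)]]) (use m in simp)
  then show ?thesis using m assms by (simp add: entry'_def le_nat_iff del: set_map)
qed

section \<open>Conditions 1 and 2 as row inequalities\<close>

context
  fixes n i j s t :: nat and xs ys :: pseq
  assumes xs: "xs \<in> Rseq n i s" and ys: "ys \<in> Rseq n j t" and ij: "1 \<le> i" "i \<le> j" "j \<le> n"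
begin

text \<open>Up to \<open>j\<close> the count of the column of \<open>ys\<close> stays constant only
  at unprimed entries; elsewhere it rises by one, and \<open>cnt R\<close> can rise no faster. So a
  row inequality can first fail only at an unprimed entry.\<close>

lemma rows_from_unprimed:
  assumes "\<And>e. e \<in> unprimed ys \<Longrightarrow> e \<le> k \<Longrightarrow> cnt R e \<le> cnt (column j ys) e" "y \<le> k" "k \<le> j"
  shows "cnt R y \<le> cnt (column j ys) y"
  using assms(2)
proof (induction y)
  case (Suc y)
  show ?case
  proof (cases "Suc y \<in> unprimed ys")
    case False
    then have "Suc y \<in> column j ys" using Suc.prems assms(3) mem_column[OF bL[OF xs ys ij]] by auto
    then show ?thesis using Suc by (simp add: cnt_Suc)
  qed (use Suc assms in auto)
qed simp

text \<open>Beyond \<open>j\<close> the count of the column of \<open>ys\<close> rises only directly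
  after a primed entry. Hence the induction runs downwards from \<open>2 * n\<close>, where this
  count is \<open>j\<close>: across a step at which it is constant the inequality is
  inherited.\<close>

lemma rows_from_primed:
  assumes "\<And>e. e \<in> primed ys \<Longrightarrow> cnt R e \<le> cnt (column j ys) e" "j \<le> y" "y \<le> 2 * n"
    "finite R" "card R \<le> j"
  shows "cnt R y \<le> cnt (column j ys) y"
  using assms(3,2)
proof (induction rule: inc_induct)
  case base
  have L: "column j ys \<subseteq> {1..2 * n}" "card (column j ys) = j"
    using Rseq_admissible[OF ys] ij admissibleD by auto
  have "cnt (column j ys) (2 * n) = int j" using cnt_cnt_bar[OF L(1), of 0] L by simp
  then show ?case using cnt_le_card[OF assms(4), of "2 * n"] assms(5) by linarith
next
  case (step y)
  show ?case
  proof (cases "y \<in> primed ys")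
    case False
    then have "Suc y \<notin> column j ys" using step mem_column[OF bL[OF xs ys ij]] by auto
    then show ?thesis using step cnt_Suc[of "column j ys" y] cnt_mono[of y "Suc y" R] by auto
  qed (use assms in auto)
qed

text \<open>By the two preceding lemmas the rows need testing only at the unprimed entries up to
  \<open>i\<close> (\<open>Q1\<close>), the unprimed entries beyond \<open>i\<close>
  (\<open>Q2\<close>) and the primed entries (\<open>Q3\<close>) of \<open>ys\<close>; these match
  i), ii) and iii). The ranges in ii) and iii) omit the indices at which the row inequality is
  automatic, since the first column has only \<open>i\<close> letters.\<close>

lemma cond1_iff:
  assumes ne: "xs \<noteq> []" "ys \<noteq> []"
  shows "cond1 i xs j ys \<longleftrightarrow> (\<forall>y\<le>2 * n. cnt (column i xs) y \<le> cnt (column j ys) y)"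
proof -
  let ?R = "column i xs" and ?L = "column j ys"
  define u where "u = u_bound i ys"
  let ?X = "\<lambda>y. int (card {a \<in> unprimed xs. a \<le> y})" and ?Y =
    "\<lambda>y. int (card {b \<in> primed xs. b < y})"
  let ?X' = "\<lambda>y. int (card {a \<in> unprimed ys. a \<le> y})" and ?Y' =
    "\<lambda>y. int (card {b \<in> primed ys. b < y})"
  note bR = Rseq_bisorted[OF xs] and bL = Rseq_bisorted[OF ys]
  note cR = cnt_column[OF bR] and cL = cnt_column[OF bL]
  note u = u_bound[OF bL, where i = i, folded u_def]
  have finR: "finite ?R" "card ?R = i" using Rseq_admissible[OF xs] ij admissibleD by auto
  have R_le: "cnt ?R y \<le> int i" for y using cnt_le_card[OF finR(1)] finR by metis
  have Y0: "?Y y = 0" if "y \<le> i" for y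
  proof -
    have "{b \<in> primed xs. b < y} = {}" using bisortedD(2)[OF bR] that by fastforce
    then show ?thesis by (simp only: card.empty)
  qed
  have Y'0: "?Y' y = 0" if "y \<le> j" for y
  proof -
    have "{b \<in> primed ys. b < y} = {}" using bisortedD(2)[OF bL] that by fastforce
    then show ?thesis by (simp only: card.empty)
  qed
  have Xs: "i \<le> y \<Longrightarrow> ?X y = len xs" for y
  proof -
    assume "i \<le> y"
    then have "{a \<in> unprimed xs. a \<le> y} = unprimed xs" using bisortedD(1)[OF bR] by fastforce
    then show ?thesis using bisortedD(7)[OF bR] by (simp add: len_def del: set_map)
  qed
  have Xt: "j \<le> y \<Longrightarrow> ?X' y = len ys" for y
  proof -
    assume "j \<le> y"
    then have "{a \<in> unprimed ys. a \<le> y} = unprimed ys" using bisortedD(1)[OF bL] by fastforce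
    then show ?thesis using bisortedD(7)[OF bL] by (simp add: len_def del: set_map)
  qed
  define Q1 where "Q1 \<longleftrightarrow> (\<forall>e\<in>unprimed ys. e \<le> i \<longrightarrow> cnt ?R e \<le> cnt ?L e)"
  define Q2 where "Q2 \<longleftrightarrow> (\<forall>e\<in>unprimed ys. i < e \<longrightarrow> cnt ?R e \<le> cnt ?L e)"
  define Q3 where "Q3 \<longleftrightarrow> (\<forall>e\<in>primed ys. cnt ?R e \<le> cnt ?L e)"
  define P1 where "P1 \<longleftrightarrow> (\<forall>p\<in>{0..u}. int (card {a \<in> unprimed xs. 1 \<le> a
      \<and> a \<le> entry ys (len ys - p)}) \<ge> p + 1)"
  define P2 where "P2 \<longleftrightarrow> (\<forall>p\<in>{r \<in> {u + 1..len ys - 1}. int (entry ys (len ys - r)) \<le> r + int i}.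
            entry ys (len ys - p) \<le> entry' xs (int (entry ys (len ys - p)) - p + len xs - int i))"
  define P3 where "P3 \<longleftrightarrow> (\<forall>p\<in>{1..int i - int j + len ys}.
            entry' ys p \<le> entry' xs (int j - int i + len xs - len ys + p))"
  have cond: "cond1 i xs j ys \<longleftrightarrow> P1 \<and> P2 \<and> P3"
    using ne by (simp only: cond1_def P1_def P2_def P3_def u_def Let_def simp_thms)
  have ej: "e \<le> j" "1 \<le> e" if "e \<in> unprimed ys" for e using that bisortedD(1)[OF bL] by auto
  have one: "{a \<in> unprimed xs. 1 \<le> a \<and> a \<le> e} = {a \<in> unprimed xs. a \<le> e}" for e
    using bisortedD(1)[OF bR] by fastforce
  have "P1 \<longleftrightarrow> (\<forall>p<length ys. rev (map fst ys) ! p \<le> i \<longrightarrow> int p + 1 \<le> ?X (rev (map fst ys) ! p))"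
    (is "_ \<longleftrightarrow> ?P1")
  proof
    assume P1: P1
    show ?P1
    proof (intro allI impI)
      fix p assume p: "p < length ys" "rev (map fst ys) ! p \<le> i"
      then have "int p \<in> {0..u}" using u(3)[OF p(1)] by simp
      with P1 have "int p + 1 \<le> int (card {a \<in> unprimed xs. 1 \<le> a \<and> a \<le> entry ys (len ys - int p)})"
        unfolding P1_def by blast
      then show "int p + 1 \<le> ?X (rev (map fst ys) ! p)" unfolding one entry_rev_nth[OF p(1)] .
    qed
  next
    assume P1: ?P1
    show P1
      unfolding P1_def
    proof
      fix p' assume p': "p' \<in> {0..u}"
      then obtain p where p: "p' = int p" "p < length ys"
        using u(2) zero_le_imp_eq_int by (fastforce simp: len_def)
      then show "p' + 1 \<le> int (card {a \<in> unprimed xs. 1 \<le> a \<and> a \<le> entry ys (len ys - p')})"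
        using P1 u(3)[OF p(2)] p' unfolding one p(1) entry_rev_nth[OF p(2)] by simp
    qed
  qed
  also have "\<dots> \<longleftrightarrow> Q1"
  proof -
    have "int p + 1 \<le> ?X e \<longleftrightarrow> cnt ?R e \<le> cnt ?L e"
      if p: "p < length ys" "e = rev (map fst ys) ! p" "e \<le> i" for p e
    proof -
      have "?X' e = int p + 1" using card_unprimed_le[OF bL p(1)] unfolding p(2) by simp
      moreover have "min e i = e" "min e j = e" using ij p(3) by auto
      ultimately show ?thesis
        using cR[of e] cL[of e] Y0[OF p(3)] Y'0[of e] ij(2) p(3) by linarith
    qed
    then show ?thesis unfolding Q1_def ball_unprimed by blast
  qed
  finally have PQ1: "P1 \<longleftrightarrow> Q1" .
  \<comment> \<open>Under \<open>Q1\<close> the row inequality at \<open>i\<close> keeps the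
    subscripts in ii) at least 1; outside the range of the list \<open>entry'\<close> has no
    meaning.\<close>
  have PQ2: "P2 \<longleftrightarrow> Q2" if Q1
  proof -
    have row: "cnt ?R i \<le> cnt ?L i"
      by (rule rows_from_unprimed[of i]) (use that ij in \<open>auto simp: Q1_def simp del: set_map\<close>)
    have rep: "P2 \<longleftrightarrow> (\<forall>p<length ys. i < rev (map fst ys) ! p
        \<longrightarrow> int (rev (map fst ys) ! p) \<le> int p + int i \<longrightarrow>
      rev (map fst ys) ! p \<le> entry' xs (int (rev (map fst ys) ! p) - int p + len xs - int i))"
      (is "_ \<longleftrightarrow> ?P2")
    proof
      assume P2: P2
      show ?P2
      proof (intro allI impI)
        fix p assume p: "p < length ys" "i < rev (map fst ys) ! p"
          "int (rev (map fst ys) ! p) \<le> int p + int i"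
        then have "int p \<in> {r \<in> {u + 1..len ys - 1}. int (entry ys (len ys - r)) \<le> r + int i}"
          using u(3)[OF p(1)] entry_rev_nth[OF p(1)] by (auto simp: len_def)
        with P2 have "entry ys (len ys - int p)
            \<le> entry' xs (int (entry ys (len ys - int p)) - int p + len xs - int i)"
          unfolding P2_def by blast
        then show "rev (map fst ys) ! p
            \<le> entry' xs (int (rev (map fst ys) ! p) - int p + len xs - int i)"
          unfolding entry_rev_nth[OF p(1)] .
      qed
    next
      assume P2: ?P2
      show P2
        unfolding P2_def
      proof
        fix p' assume p': "p' \<in> {r \<in> {u + 1..len ys - 1}. int (entry ys (len ys - r)) \<le> r + int i}"
        then have "0 \<le> p'" "p' < len ys" using u(1) by auto
        then obtain p where p: "p' = int p" "p < length ys"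
          using zero_le_imp_eq_int by (fastforce simp: len_def)
        then show "entry ys (len ys - p')
            \<le> entry' xs (int (entry ys (len ys - p')) - p' + len xs - int i)"
          using P2 u(3)[OF p(2)] p'
            unfolding p(1) entry_rev_nth[OF p(2)] by (simp add: entry_rev_nth[OF p(2)])
      qed
    qed
    have "(int e \<le> int p + int i \<longrightarrow> e \<le> entry' xs (int e - int p + len xs - int i))
        \<longleftrightarrow> cnt ?R e \<le> cnt ?L e"
      if p: "p < length ys" "e = rev (map fst ys) ! p" "i < e" for p e
    proof -
      have e: "e \<in> unprimed ys" unfolding p(2) by (rule unprimed_nth[OF p(1)])
      have "?X' e = int p + 1" using card_unprimed_le[OF bL p(1)] unfolding p(2) by simp
      moreover have "min e j = e" using ej[OF e] by simp
      ultimately have Le: "cnt ?L e = int e - int p - 1"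
        using cL[of e] Y'0[OF ej(1)[OF e]] by linarith
      \<comment> \<open>As \<open>e\<close> is a gap of \<open>?L\<close>, the count just before
        \<open>e\<close> is already \<open>e - p - 1\<close>. It is at least the count at
        \<open>i\<close>, which \<open>row\<close> bounds below by \<open>i - s\<close>; so the
        subscript is at least 1.\<close>
      have "e \<notin> ?L" using e ej[OF e] mem_column[OF bL, of e] by (simp del: set_map)
      then have "cnt ?L (e - 1) = cnt ?L e" using local_counts(1)[OF ej(2)[OF e], of ?L] by simp
      moreover have "cnt ?L i \<le> cnt ?L (e - 1)" using p by (intro cnt_mono) simp
      moreover have "int i - len xs \<le> cnt ?R i" using cR[of i] Xs[of i] by simp
      ultimately have m: "1 \<le> int e - int p + len xs - int i" using row Le by linarith
      have "min e i = i" using p(3) by simp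
      then have Re: "cnt ?R e = int i - len xs + ?Y e" using cR[of e] Xs[of e] p(3) by linarith
      show ?thesis
      proof (cases "int e \<le> int p + int i")
        case True
        then have "int e - int p + len xs - int i \<le> len xs" by simp
        from le_entry'_iff[OF bR m this, of e] show ?thesis using True Le Re by linarith
      next
        \<comment> \<open>Here \<open>cnt ?L e\<close> is at least \<open>i\<close>, so the row
          inequality is automatic while ii) is silent.\<close>
        case False
        then show ?thesis using R_le[of e] Le by linarith
      qed
    qed
    then show ?thesis unfolding rep Q2_def ball_unprimed by blast
  qed
  \<comment> \<open>\<open>Q1\<close> and \<open>Q2\<close> give the row inequality at
    \<open>j\<close>, which makes the subscripts in iii) at least 1.\<close>
  have PQ3: "P3 \<longleftrightarrow> Q3" if Q1 Q2
  proof -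
    have "cnt ?R e \<le> cnt ?L e" if "e \<in> unprimed ys" for e
      using \<open>Q1\<close> \<open>Q2\<close> that unfolding Q1_def Q2_def by (cases "e \<le> i") (simp_all del: set_map)
    then have row: "cnt ?R j \<le> cnt ?L j" by (rule rows_from_unprimed[of j]) auto
    have jt: "cnt ?L j = int j - len ys" using cL[of j] Xt[of j] Y'0[of j] by (simp del: set_map)
    have iR: "int i - len xs \<le> cnt ?R j" using cR[of j] Xs[of j] ij by simp
    have eq: "(p \<le> int i - int j + len ys
        \<longrightarrow> entry' ys p \<le> entry' xs (int j - int i + len xs - len ys + p))
        \<longleftrightarrow> cnt ?R (entry' ys p) \<le> cnt ?L (entry' ys p)" if p: "p \<in> {1..len ys}" for p
    proof -
      let ?e = "entry' ys p"
      have "?e \<in> primed ys" using p primed_eq_nths by blast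
      then have e: "j \<le> ?e" using bisortedD(2)[OF bL] by auto
      have Le: "cnt ?L ?e = int j - len ys + p - 1"
        using cL[of ?e] Xt[OF e] card_less_entry'[OF bL p] e by simp
      have Re: "cnt ?R ?e = int i - len xs + ?Y ?e" using cR[of ?e] Xs[of ?e] e ij by simp
      have m: "1 \<le> int j - int i + len xs - len ys + p" using row jt iR p by auto
      show ?thesis
      proof (cases "p \<le> int i - int j + len ys")
        case True
        then have "int j - int i + len xs - len ys + p \<le> len xs" by simp
        from le_entry'_iff[OF bR m this, of ?e] show ?thesis using True Le Re by linarith
      next
        case False
        then show ?thesis using R_le[of ?e] Le by linarith
      qed
    qed
    have sub: "{1..int i - int j + len ys} \<subseteq> {1..len ys}" using ij by auto
    show ?thesis
    proof
      assume P3
      then have "cnt ?R (entry' ys p) \<le> cnt ?L (entry' ys p)" if "p \<in> {1..len ys}" for p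
        using eq[OF that] that unfolding P3_def by auto
      then show Q3 unfolding Q3_def using primed_eq_nths by metis
    next
      assume Q3
      then have "cnt ?R (entry' ys p) \<le> cnt ?L (entry' ys p)" if "p \<in> {1..len ys}" for p
        using that primed_eq_nths unfolding Q3_def by blast
      then show P3 using eq sub unfolding P3_def by auto
    qed
  qed
  have "Q1 \<and> Q2 \<and> Q3 \<longleftrightarrow> (\<forall>y\<le>2 * n. cnt ?R y \<le> cnt ?L y)"
  proof
    assume Q: "Q1 \<and> Q2 \<and> Q3"
    show "\<forall>y\<le>2 * n. cnt ?R y \<le> cnt ?L y"
    proof (intro allI impI)
      fix y assume y: "y \<le> 2 * n"
      show "cnt ?R y \<le> cnt ?L y"
      proof (cases "y \<le> j")
        case True
        have "cnt ?R e \<le> cnt ?L e" if "e \<in> unprimed ys" for e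
          using Q that unfolding Q1_def Q2_def by (cases "e \<le> i") (simp_all del: set_map)
        then show ?thesis by (rule rows_from_unprimed[of j]) (use True in auto)
      next
        case False
        show ?thesis
          by (rule rows_from_primed) (use Q False y finR ij in \<open>auto simp: Q3_def simp del:
            set_map\<close>)
      qed
    qed
  next
    assume row: "\<forall>y\<le>2 * n. cnt ?R y \<le> cnt ?L y"
    have "primed ys \<subseteq> {..2 * n}" using ys by (fastforce simp: Rseq_def letters_def)
    then show "Q1 \<and> Q2 \<and> Q3"
      using row ej ij unfolding Q1_def Q2_def Q3_def by (force simp del: set_map)
  qed
  then show ?thesis using cond PQ1 PQ2 PQ3 by blast
qed

text \<open>Condition 1 is vacuous if a sequence is empty. With \<open>ys = []\<close> the second
  column is initial and all rows hold; with \<open>xs = []\<close> the rows say that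
  \<open>{1..i}\<close> lies in the second column, so that the least unprimed entry of
  \<open>ys\<close> exceeds \<open>i\<close>, which is condition 2.\<close>

lemma cond12_iff:
  "cond1 i xs j ys \<and> cond2 i xs j ys \<longleftrightarrow> (\<forall>y\<le>2 * n. cnt (column i xs) y \<le> cnt (column j ys) y)"
proof -
  note bR = Rseq_bisorted[OF xs] and bL = Rseq_bisorted[OF ys]
  have full: "cnt (column k []) y = int (min y k)" for k y
    using cnt_column[of k "[]" y] by (simp add: bisorted_def)
  have fin: "finite (column i xs)" "card (column i xs) = i" "finite (column j ys)"
    using Rseq_admissible[OF xs] Rseq_admissible[OF ys] ij admissibleD by auto
  have le: "cnt C y \<le> int y" for C y
    unfolding cnt_def using card_mono[of "{1..y}" "C \<inter> {1..y}"] by simp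
  consider "xs \<noteq> []" "ys \<noteq> []" | "ys = []" | "xs = []" "ys \<noteq> []" by blast
  then show ?thesis
  proof cases
    case 1
    then show ?thesis using cond1_iff by (simp add: cond2_def)
  next
    case 2
    have "cnt (column i xs) y \<le> int (min y j)" for y
      using le[of _ y] cnt_le_card[OF fin(1), of y] fin(2) ij by (simp add: min_def)
    then show ?thesis unfolding 2 full by (simp add: cond1_def cond2_def)
  next
    case 3
    have e0: "entry ys (len ys) = rev (map fst ys) ! 0" "0 < length ys"
      using entry_rev_nth[of 0 ys] 3 by simp_all
    have mem0: "entry ys (len ys) \<in> unprimed ys" using unprimed_nth[of 0 ys] e0 by simp
    have min0: "entry ys (len ys) \<le> x" if x: "x \<in> unprimed ys" for x
    proof -
      obtain p where p: "p < length ys" "x = rev (map fst ys) ! p"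
        using unprimed_nthE[OF x] by blast
      show ?thesis
        using bisortedD(5)[OF bL] p e0
        by (cases "p = 0") (auto simp: sorted_wrt_iff_nth_less intro: less_imp_le)
    qed
    have "cond1 i xs j ys \<and> cond2 i xs j ys \<longleftrightarrow> i < entry ys (len ys)"
      using 3 by (auto simp: cond1_def cond2_def)
    also have "\<dots> \<longleftrightarrow> (\<forall>y\<le>2 * n. int (min y i) \<le> cnt (column j ys) y)"
    proof
      assume i: "i < entry ys (len ys)"
      have low: "cnt (column j ys) y = int y" if "y \<le> i" for y
        using that
      proof (induction y)
        case (Suc y)
        then have "Suc y \<in> column j ys" using i min0[of "Suc y"] ij mem_column[OF bL] by fastforce
        then show ?case using Suc by (simp add: cnt_Suc)
      qed simp
      show "\<forall>y\<le>2 * n. int (min y i) \<le> cnt (column j ys) y"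
      proof (intro allI impI)
        fix y
        show "int (min y i) \<le> cnt (column j ys) y"
          using low[of "min y i"] cnt_mono[of "min y i" y "column j ys"] by simp
      qed
    next
      assume row: "\<forall>y\<le>2 * n. int (min y i) \<le> cnt (column j ys) y"
      show "i < entry ys (len ys)"
      proof (rule ccontr)
        let ?e = "entry ys (len ys)"
        assume "\<not> i < ?e"
        then have e: "?e \<le> i" by simp
        have e1: "1 \<le> ?e" using mem0 bisortedD(1)[OF bL] by auto
        have "?e \<notin> column j ys" using mem0 e ij mem_column[OF bL] by simp
        then have "cnt (column j ys) ?e = cnt (column j ys) (?e - 1)"
          using local_counts(1)[OF e1, of "column j ys"] by simp
        also have "\<dots> \<le> int (?e - 1)" by (rule le)
        finally show False using row e e1 ij by (auto dest: spec[of _ ?e])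
      qed
    qed
    finally show ?thesis unfolding \<open>xs = []\<close> full .
  qed
qed

lemma conds_iff_compat:
  "cond1 i xs j ys \<and> cond2 i xs j ys \<and> cond3 n i xs j ys \<and> cond4 n i xs j ys
    \<longleftrightarrow> compat n (column i xs) (column j ys)"
proof -
  have "column i xs \<subseteq> {1..2 * n}" "column j ys \<subseteq> {1..2 * n}"
    using Rseq_admissible[OF xs] Rseq_admissible[OF ys] ij admissibleD by auto
  from compat_iff_corner_free[OF this] show ?thesis
    using cond12_iff cond3_iff[OF xs ys ij] cond4_iff[OF xs ys ij] by blast
qed

end

section \<open>Sequences of columns\<close>

lemma cnt_initial: "cnt {1..i} y = int (min y i)"
proof -
  have "{1..i} \<inter> {1..y} = {1..min y i}" by auto
  then show ?thesis by (simp add: cnt_def)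
qed

lemma phi_initial:
  assumes "i \<le> n" "l \<le> n" "1 \<le> i" shows "phi n l {1..i} = of_bool (l = i)"
  using assms by (auto simp: phi_def plus_at_def plus_bar_def minus_bar_def minus_at_def)

lemma eps_initial:
  assumes "i \<le> n" "l \<le> n" "1 \<le> l" shows "eps n l {1..i} = 0"
  using assms by (auto simp: eps_def plus_at_def minus_bar_def minus_at_def)

text \<open>Lowering a letter can raise the slack only at \<open>l\<close>, and only for a step on
  the edge \<open>l\<close> with \<open>l < n\<close>. There the surviving minus makes the slack at
  \<open>l\<close> one less than at \<open>l - 1\<close> or at \<open>l + 1\<close>, hence negative
  beforehand.\<close>

lemma admissible_e_col:
  assumes C: "admissible n i C" and l: "1 \<le> l" "l \<le> n" and pos: "0 < eps n l C"
  shows "admissible n i (e_col n l C)"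
proof -
  note CD = admissibleD[OF C]
  define C' where "C' = e_col n l C"
  define y where "y = (if minus_at l C \<and> \<not> minus_bar n l C then l else 2 * n - l)"
  have m: "minus_at y C" using pos by (auto simp: y_def eps_def minus_bar_def split: if_splits)
  have C': "C' = lower_letter y C" by (simp add: C'_def e_col_def y_def)
  have yn: "1 \<le> y" "y < 2 * n" using l by (auto simp: y_def)
  have p: "plus_at y C'" and CC': "C = raise_letter y C'"
    using m by (auto simp: C' plus_at_def minus_at_def lower_letter_def raise_letter_def)
  have sub: "C' \<subseteq> {1..2 * n}" using CD(1) yn by (auto simp: C' lower_letter_def)
  have fin: "finite C'" using sub finite_subset by blast
  have card: "card C' = i" using card_raise_letter[OF p fin] CD(2) CC' by simp
  have cnt: "cnt C' a = cnt C a + of_bool (a = y)" for a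
    using cnt_raise_letter[OF p yn(1), of a] CC' by simp
  have bar: "cnt_bar n C' a = cnt_bar n C a - of_bool (a = 2 * n - y)" if "a \<le> n" for a
    using cnt_bar_raise_letter[OF p yn sub, of a] CC' that by simp
  have "slack n C' a \<le> 0" if a: "a \<le> n" for a
  proof (cases "a = y \<and> a \<noteq> 2 * n - y")
    case False
    then show ?thesis using CD(4)[OF a] cnt[of a] bar[OF a] by (auto simp: slack_def)
  next
    case True
    then have y: "y = l" "l < n" "\<not> minus_bar n l C"
      using a l by (auto simp: y_def split: if_splits)
    have mem: "l \<notin> C" "Suc l \<in> C" "2 * n - l \<in> C \<or> Suc (2 * n - l) \<notin> C"
      using m y by (auto simp: minus_at_def minus_bar_def)
    have "slack n C (l - 1) \<le> 0" "slack n C (Suc l) \<le> 0" using CD(4) y l by auto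
    then have "slack n C l < 0"
      using local_counts(1,2)[OF l(1), of C] local_counts(3)[OF l, of C]
        local_counts(4)[OF l(1) y(2), of C] mem l
      by (auto simp: slack_def split: if_splits)
    then show ?thesis using cnt[of a] bar[OF a] True y(1) by (simp add: slack_def)
  qed
  then show ?thesis using sub card by (simp add: admissible_def C'_def)
qed

text \<open>Let \<open>g\<close> be the first gap and \<open>c\<close> the next letter of the
  column. If \<open>c \<le> n + 1\<close>, the minus on the edge \<open>c - 1\<close> is never
  cancelled. If \<open>c\<close> is the barred letter of some \<open>l < n\<close>, then for
  \<open>g \<le> l\<close> the minus on the barred edge meets no plus on the edge \<open>l\<close>,
  and for \<open>l < g\<close> the slack at \<open>l\<close> would be positive.\<close>

lemma admissible_eq_initial:
  assumes C: "admissible n i C" and i: "i \<le> n" and sub: "{1..e} \<subseteq> C"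
    and hw: "\<And>l. e < l \<Longrightarrow> l \<le> n \<Longrightarrow> eps n l C = 0"
  shows "C = {1..i}"
proof (rule ccontr)
  note CD = admissibleD[OF C]
  assume ne: "C \<noteq> {1..i}"
  have "\<not> {1..i} \<subseteq> C"
    using card_subset_eq[OF CD(3), of "{1..i}"] CD(2) ne by auto
  then have ex: "\<exists>g. g \<in> {1..i} \<and> g \<notin> C" by blast
  define g where "g = (LEAST g. g \<in> {1..i} \<and> g \<notin> C)"
  have g: "1 \<le> g" "g \<le> i" "g \<notin> C" using LeastI_ex[OF ex] by (auto simp: g_def)
  have below: "z \<in> C" if "1 \<le> z" "z < g" for z
    using not_less_Least[of z "\<lambda>g. g \<in> {1..i} \<and> g \<notin> C"] that g(2) by (auto simp: g_def)
  have eg: "e < g" using sub g by (meson atLeastAtMost_iff not_less subsetD)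
  have "\<not> C \<subseteq> {1..i}"
    using card_subset_eq[of "{1..i}" C] CD(2) ne by auto
  then have ex': "\<exists>c. c \<in> C \<and> g < c" using CD(1) g(2) by fastforce
  define c where "c = (LEAST c. c \<in> C \<and> g < c)"
  have c: "c \<in> C" "g < c" using LeastI_ex[OF ex'] by (auto simp: c_def)
  have gap: "z \<notin> C" if "g \<le> z" "z < c" for z
    using not_less_Least[of z "\<lambda>c. c \<in> C \<and> g < c"] that g(3) by (cases "z = g") (auto simp: c_def)
  have c2: "c \<le> 2 * n" using c(1) CD(1) by auto
  show False
  proof (cases "c \<le> Suc n")
    case True
    have "minus_at (c - 1) C" using gap[of "c - 1"] c by (auto simp: minus_at_def)
    then show False using hw[of "c - 1"] eps_eq_0[of n "c - 1" C] True c eg by auto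
  next
    case False
    define l where "l = 2 * n + 1 - c"
    have l: "1 \<le> l" "l < n" "c = Suc (2 * n - l)" using False c2 by (auto simp: l_def)
    have "minus_bar n l C"
      using gap[of "2 * n - l"] c l i g(2) by (auto simp: minus_bar_def minus_at_def)
    show False
    proof (cases "g \<le> l")
      case True
      then have "plus_at l C" using hw[of l] eps_eq_0[of n l C] \<open>minus_bar n l C\<close> eg l by auto
      then show False using gap[of l] True l by (auto simp: plus_at_def)
    next
      case False
      have "{1..l} \<subseteq> C" using below False by auto
      then have "C \<inter> {1..l} = {1..l}" by blast
      then have "cnt C l = int l" by (simp add: cnt_def)
      moreover have "c \<in> C \<inter> {2 * n + 1 - l..2 * n}" using c l by auto
      then have "1 \<le> cnt_bar n C l"
        unfolding cnt_bar_def
          using card_gt_0_iff[of "C \<inter> {2 * n + 1 - l..2 * n}"] CD(3) by fastforce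
      ultimately show False using CD(4)[of l] l by (simp add: slack_def)
    qed
  qed
qed

lemma compat_initial_subset:
  assumes "compat n {1..e} C" "e \<le> n" shows "{1..e} \<subseteq> C"
proof -
  have "int e \<le> cnt C e"
    using compatD(1)[OF assms(1) order_refl assms(2)] unfolding cnt_initial by simp
  then have "card {1..e} \<le> card (C \<inter> {1..e})" by (simp add: cnt_def)
  then have "C \<inter> {1..e} = {1..e}" by (intro card_seteq) auto
  then show ?thesis by blast
qed

lemma column_Nil [simp]: "column i [] = {1..i}"
  by (simp add: column_def)

lemma sum_raise_letter:
  assumes "plus_at y C" "finite C" shows "\<Sum>(raise_letter y C) = Suc (\<Sum>C)"
  using assms by (auto simp: plus_at_def raise_letter_def sum.remove[of C y "\<lambda>z. z"])

lemma sum_f_col: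
  assumes "0 < phi n l C" "finite C" shows "\<Sum>(f_col n l C) = Suc (\<Sum>C)"
proof -
  have "plus_at l C \<and> \<not> minus_bar n l C \<or> plus_at (2 * n - l) C \<and> \<not> (plus_at l C
      \<and> \<not> minus_bar n l C)"
    using assms(1) by (auto simp: phi_def plus_bar_def split: if_splits)
  then show ?thesis using sum_raise_letter[OF _ assms(2)] by (auto simp: f_col_def)
qed

definition comp_col :: "component \<Rightarrow> nat set" where
  "comp_col c = (case c of Zero \<Rightarrow> {} | Elem i ps \<Rightarrow> column i ps)"

lemma comp_col_Elem [simp]: "comp_col (Elem i ps) = column i ps"
  by (simp add: comp_col_def)

lemma card_Collect_atLeastLessThan_Suc:
  "a \<le> j \<Longrightarrow> card {p \<in> {a..<Suc j}. P p} = card {p \<in> {a..<j}. P p} + of_bool (P j)"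
proof -
  assume "a \<le> j"
  then have "{p \<in> {a..<Suc j}. P p}
      = (if P j then insert j {p \<in> {a..<j}. P p} else {p \<in> {a..<j}. P p})"
    by (auto simp: less_Suc_eq)
  then show ?thesis by simp
qed

lemma theta_Elem: "theta n l i ps = Some c \<Longrightarrow> \<exists>qs. c = Elem i qs"
  by (auto simp: theta_def split: if_splits)

section \<open>Sequences with fixed superscripts and the tensor product rule\<close>

locale tensor =
  fixes n k :: nat and d :: "nat \<Rightarrow> nat"
  assumes n: "1 \<le> n" and d: "\<And>q. q < k \<Longrightarrow> 1 \<le> d q \<and> d q \<le> n"
begin

definition seqs :: "(nat \<Rightarrow> component) set" where
  "seqs = {x. (\<forall>q<k. x q \<in> (\<Union>s. Elem (d q) ` Rseq n (d q) s)) \<and> (\<forall>q\<ge>k. x q = Zero)}"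

definition pairs_compat :: "(nat \<Rightarrow> component) \<Rightarrow> bool" where
  "pairs_compat x \<longleftrightarrow> (\<forall>q. q + 1 < k \<longrightarrow> compat n (comp_col (x q)) (comp_col (x (q + 1))))"

lemma seqsE:
  assumes "x \<in> seqs" "q < k"
  obtains ps s where "x q = Elem (d q) ps" "ps \<in> Rseq n (d q) s"
  using assms by (auto simp: seqs_def)

lemma seqs_update:
  assumes "x \<in> seqs" "q < k" "ps \<in> Rseq n (d q) s"
  shows "x(q := Elem (d q) ps) \<in> seqs"
  using assms by (auto simp: seqs_def)

lemma seqs_admissible:
  assumes "x \<in> seqs" "q < k" shows "admissible n (d q) (comp_col (x q))"
proof -
  obtain ps s where "x q = Elem (d q) ps" "ps \<in> Rseq n (d q) s" using seqsE[OF assms] .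
  then show ?thesis using Rseq_admissible d[OF assms(2)] by simp
qed

lemma seqs_finite: "x \<in> seqs \<Longrightarrow> q < k \<Longrightarrow> finite (comp_col (x q))"
  using seqs_admissible admissibleD(3) by blast

lemma seqs_nz: "x \<in> seqs \<Longrightarrow> {q. x q \<noteq> Zero} = {..<k}"
proof -
  assume x: "x \<in> seqs"
  have "x q \<noteq> Zero \<longleftrightarrow> q < k" for q
    using x by (cases "q < k") (auto simp: seqs_def)
  then show ?thesis by auto
qed

lemma nz_count: "x \<in> seqs \<Longrightarrow> nz_count x = k"
  by (simp add: nz_count_def seqs_nz)

lemma nz_pos: "x \<in> seqs \<Longrightarrow> 1 \<le> p \<Longrightarrow> p \<le> k \<Longrightarrow> nz_pos x p = p - 1"
  by (simp add: nz_pos_def seqs_nz lessThan_atLeast0)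

lemma seqs_R_inf: "x \<in> seqs \<Longrightarrow> x \<in> R_inf n"
proof -
  assume x: "x \<in> seqs"
  have "x q \<in> R_comps n" for q
  proof (cases "q < k")
    case True
    obtain ps s where "x q = Elem (d q) ps" "ps \<in> Rseq n (d q) s" using seqsE[OF x True] .
    moreover have "d q \<in> {1..n}" using d[OF True] by simp
    ultimately show ?thesis unfolding R_comps_def by blast
  next
    case False
    then show ?thesis using x by (simp add: seqs_def R_comps_def)
  qed
  then show ?thesis using seqs_nz[OF x] by (simp add: R_inf_def)
qed

text \<open>Properties (a') and (d') count a second time, so a component contributes
  \<open>phi\<close> of its column to \<open>sigma\<close> and \<open>eps\<close> to
  \<open>tau\<close>.\<close>

lemma sat_counts:
  assumes "x \<in> seqs" "q < k" "1 \<le> l" "l \<le> n"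
  shows "of_bool (sat (\<lambda>i ps. prop_a n l i ps \<or> prop_b n l i ps) (x q))
      + of_bool (sat (prop_a' n l) (x q)) = phi n l (comp_col (x q))"
    "of_bool (sat (\<lambda>i ps. prop_c n l i ps \<or> prop_d n l i ps) (x q))
      + of_bool (sat (prop_d' n l) (x q)) = eps n l (comp_col (x q))"
proof -
  obtain ps s where ps: "x q = Elem (d q) ps" "ps \<in> Rseq n (d q) s" using seqsE assms by blast
  have dq: "1 \<le> d q" "d q \<le> n" using d assms by auto
  note c = Rseq_bisorted[OF ps(2)] dq assms(3,4)
  show "of_bool (sat (\<lambda>i ps. prop_a n l i ps \<or> prop_b n l i ps) (x q))
      + of_bool (sat (prop_a' n l) (x q)) = phi n l (comp_col (x q))"
    by (simp add: ps(1) sat_def prop_a_column[OF c] prop_a'_column[OF c] prop_b_column[OF c]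
      phi_def)
  show "of_bool (sat (\<lambda>i ps. prop_c n l i ps \<or> prop_d n l i ps) (x q))
      + of_bool (sat (prop_d' n l) (x q)) = eps n l (comp_col (x q))"
    by (simp add: ps(1) sat_def prop_c_column[OF c] prop_d'_column[OF c] prop_d_column[OF c]
      eps_def)
qed

lemma sig_diff_1: "sig_diff n l x 1 = 0"
  by (simp add: sig_diff_def sigma_def tau_def)

text \<open>Passing from \<open>j\<close> to \<open>j + 1\<close> adds the component number
  \<open>j\<close> to \<open>sigma\<close> but the component number \<open>j + 1\<close> to
  \<open>tau\<close>; counted from 0 these are the positions \<open>j - 1\<close> and
  \<open>j\<close>. Hence minimality of the difference compares neighbours, as the stability lemmas
  require.\<close>

lemma sig_diff_Suc:
  assumes "x \<in> seqs" "1 \<le> j" "j < k" "1 \<le> l" "l \<le> n"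
  shows "sig_diff n l x (Suc j)
    = sig_diff n l x j + int (phi n l (comp_col (x (j - 1)))) - int (eps n l (comp_col (x j)))"
proof -
  have "nz_pos x j = j - 1" "nz_pos x (Suc j) = j" using nz_pos assms by auto
  then have "sigma n l x (Suc j) = sigma n l x j + phi n l (comp_col (x (j - 1)))"
    "tau n l x (Suc j) = tau n l x j + eps n l (comp_col (x j))"
    using sat_counts(1)[of x "j - 1" l] sat_counts(2)[of x j l] assms
      card_Collect_atLeastLessThan_Suc[of 1 j] card_Collect_atLeastLessThan_Suc[of 2 "Suc j"]
    unfolding sigma_def tau_def by (simp_all flip: atLeastLessThanSuc_atLeastAtMost)
  then show ?thesis by (simp add: sig_diff_def)
qed

lemma f_index:
  assumes "x \<in> seqs" "0 < k"
  shows "f_index n l x \<in> {1..k}"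
    "p \<in> {1..k} \<Longrightarrow> sig_diff n l x (f_index n l x) \<le> sig_diff n l x p"
    "p \<in> {f_index n l x<..k} \<Longrightarrow> sig_diff n l x (f_index n l x) < sig_diff n l x p"
proof -
  let ?h = "sig_diff n l x" and ?M = "{p \<in> {1..k}. sig_diff n l x p = mu n l x}"
  have mu: "mu n l x = Min (?h ` {1..k})" using assms by (simp add: mu_def nz_count)
  have "mu n l x \<in> ?h ` {1..k}" unfolding mu using assms(2) by (intro Min_in) auto
  then have ne: "?M \<noteq> {}" by auto
  have fi: "f_index n l x = Max ?M" using assms(1) by (simp add: f_index_def nz_count)
  then have mem: "f_index n l x \<in> ?M" using Max_in[OF _ ne] by simp
  then show "f_index n l x \<in> {1..k}" by simp
  have le: "?h (f_index n l x) \<le> ?h p" if "p \<in> {1..k}" for p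
    using mem that unfolding mu by simp
  show "p \<in> {1..k} \<Longrightarrow> ?h (f_index n l x) \<le> ?h p" by (rule le)
  assume p: "p \<in> {f_index n l x<..k}"
  then have pk: "p \<in> {1..k}" by auto
  have "p \<notin> ?M"
  proof
    assume "p \<in> ?M"
    then have "p \<le> f_index n l x" unfolding fi by (intro Max_ge) auto
    then show False using p by simp
  qed
  then show "?h (f_index n l x) < ?h p" using le[OF pk] mem pk by auto
qed

lemma f_index_eqI:
  assumes "x \<in> seqs" "p \<in> {1..k}" "\<And>j. j \<in> {1..<p} \<Longrightarrow> sig_diff n l x p \<le> sig_diff n l x j"
    "\<And>j. j \<in> {p<..k} \<Longrightarrow> sig_diff n l x p < sig_diff n l x j"
  shows "f_index n l x = p"
proof -
  have k: "0 < k" using assms(2) by simp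
  note f = f_index[OF assms(1) k, where l = l]
  consider "f_index n l x = p" | "f_index n l x < p" | "p < f_index n l x" by linarith
  then show ?thesis
  proof cases
    case 2
    then show ?thesis using f(1) f(3)[of p] assms(2) assms(3)[of "f_index n l x"] by auto
  next
    case 3
    then show ?thesis using f(1) f(2)[of p] assms(2) assms(4)[of "f_index n l x"] by auto
  qed
qed

lemma f_op_seqs:
  assumes "x \<in> seqs" "f_op n l x = Some y" "y \<in> R_inf n" "1 \<le> l" "l \<le> n"
  obtains q where "q < k" "f_index n l x = Suc q" "y \<in> seqs" "0 < phi n l (comp_col (x q))"
    "comp_col (y q) = f_col n l (comp_col (x q))" "\<And>p. p \<noteq> q \<Longrightarrow> y p = x p"
proof -
  have k: "0 < k" using assms(1,2) by (cases "k = 0") (auto simp: f_op_def nz_count)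
  define q where "q = f_index n l x - 1"
  have q: "f_index n l x = Suc q" "q < k"
    using f_index(1)[OF assms(1) k, of l] by (auto simp: q_def)
  obtain ps s where ps: "x q = Elem (d q) ps" "ps \<in> Rseq n (d q) s"
    using seqsE[OF assms(1) q(2)] by blast
  have "nz_pos x (Suc q) = q" using nz_pos[OF assms(1), of "Suc q"] q(2) by simp
  then obtain c where c: "theta n l (d q) ps = Some c" "y = x(q := c)"
    using assms(2) k ps(1) by (auto simp: f_op_def nz_count[OF assms(1)] q(1) Let_def)
  have th: "bisorted (d q) ps" "1 \<le> d q" "d q \<le> n" "1 \<le> l" "l \<le> n"
    using Rseq_bisorted[OF ps(2)] d[OF q(2)] assms(4,5) by auto
  have phi: "0 < phi n l (column (d q) ps)" using theta_column(1)[OF th] c(1) by fastforce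
  then obtain qs where qs: "c = Elem (d q) qs" "column (d q) qs = f_col n l (column (d q) ps)"
    using theta_column(2)[OF th] c(1) by auto
  \<comment> \<open>So far \<theta> is only known to give a \<open>bisorted\<close> sequence; the
    bounds of \<open>Rseq\<close> are read off from \<open>y \<in> R_inf n\<close>.\<close>
  have "Elem (d q) qs \<in> R_comps n" using assms(3) c qs by (auto simp: R_inf_def dest: spec[of _ q])
  then obtain s' where "qs \<in> Rseq n (d q) s'" by (auto simp: R_comps_def)
  then have "y \<in> seqs" using seqs_update[OF assms(1) q(2)] c qs by simp
  then show ?thesis using that[of q] q phi qs c ps by simp
qed

text \<open>At the largest minimiser the difference increases strictly towards the right neighbour
  and weakly towards the left one. These are the hypotheses of \<open>compat_f_col_first\<close> and
  \<open>compat_f_col_second\<close>; all other pairs are untouched.\<close>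

lemma f_op_pairs_compat:
  assumes "x \<in> seqs" "f_op n l x = Some y" "y \<in> R_inf n" "1 \<le> l" "l \<le> n"
  shows "y \<in> seqs" "pairs_compat y \<longleftrightarrow> pairs_compat x"
proof -
  obtain q where q: "q < k" "f_index n l x = Suc q" "y \<in> seqs" "0 < phi n l (comp_col (x q))"
    "comp_col (y q) = f_col n l (comp_col (x q))" "\<And>p. p \<noteq> q \<Longrightarrow> y p = x p"
    using f_op_seqs[OF assms] by blast
  show "y \<in> seqs" by fact
  have k: "0 < k" using q by simp
  note f = f_index[OF assms(1) k, where l = l, unfolded q(2)]
  have "compat n (comp_col (y p)) (comp_col (y (p + 1)))
      \<longleftrightarrow> compat n (comp_col (x p)) (comp_col (x (p + 1)))"
    if p: "p + 1 < k" for p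
  proof -
    note adm = seqs_admissible[OF assms(1), of p] seqs_admissible[OF assms(1), of "p + 1"]
    consider "p = q" | "p + 1 = q" | "p \<noteq> q" "p + 1 \<noteq> q" by blast
    then show ?thesis
    proof cases
      case 1
      have "sig_diff n l x (Suc q) < sig_diff n l x (Suc (Suc q))"
        using f(3)[of "Suc (Suc q)"] p 1 by simp
      then have "eps n l (comp_col (x (Suc q))) < phi n l (comp_col (x q))"
        using sig_diff_Suc[OF assms(1), of "Suc q" l] p 1 assms by simp
      then have "compat n (f_col n l (comp_col (x q))) (comp_col (x (Suc q)))
          \<longleftrightarrow> compat n (comp_col (x q)) (comp_col (x (Suc q)))"
        using adm p 1 assms by (intro compat_f_col_first) auto
      then show ?thesis using q 1 by simp
    next
      case 2
      have "sig_diff n l x (Suc q) \<le> sig_diff n l x q" using f(2)[of q] p 2 by auto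
      then have "phi n l (comp_col (x p)) \<le> eps n l (comp_col (x q))"
        using sig_diff_Suc[OF assms(1), of q l] p 2 assms by auto
      then have "compat n (comp_col (x p)) (f_col n l (comp_col (x q)))
          \<longleftrightarrow> compat n (comp_col (x p)) (comp_col (x q))"
        using adm p 2 assms q by (intro compat_f_col_second) auto
      then show ?thesis using q 2 by auto
    next
      case 3
      then show ?thesis using q by simp
    qed
  qed
  then show "pairs_compat y \<longleftrightarrow> pairs_compat x" unfolding pairs_compat_def by blast
qed

text \<open>\<theta> keeps the superscript and never yields \<open>Zero\<close>, so source and
  target have the same pattern of superscripts.\<close>

lemma f_op_seqs_source:
  assumes "y \<in> seqs" "f_op n l x = Some y" "x \<in> R_inf n"
  shows "x \<in> seqs"
proof -
  define q where "q = nz_pos x (f_index n l x)"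
  obtain i ps c where c: "x q = Elem i ps" "theta n l i ps = Some c" "y = x(q := c)"
    using assms(2) by (auto simp: f_op_def q_def Let_def split: if_splits component.splits)
  obtain qs where qs: "c = Elem i qs" using theta_Elem[OF c(2)] by blast
  have q: "q < k"
  proof (rule ccontr)
    assume "\<not> q < k"
    then have "y q = Zero" using assms(1) by (simp add: seqs_def)
    then show False using c qs by simp
  qed
  then have i: "i = d q" using assms(1) c qs by (elim seqsE) auto
  have "Elem i ps \<in> R_comps n" using assms(3) c by (auto simp: R_inf_def dest: spec[of _ q])
  then obtain s where "ps \<in> Rseq n (d q) s" using i by (auto simp: R_comps_def)
  from seqs_update[OF assms(1) q this] show ?thesis using c i by (metis fun_upd_triv fun_upd_upd)
qed

text \<open>The preimage arises by \<open>e_col\<close> at the smallest minimiser \<open>p\<close>,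
  which becomes the largest minimiser for the new sequence. The hypothesis \<open>nhw\<close> says
  that \<epsilon> of the whole sequence is positive.\<close>

lemma exists_f_op_preimage:
  assumes y: "y \<in> seqs" and l: "1 \<le> l" "l \<le> n" and k: "0 < k"
    and nhw: "0 < eps n l (comp_col (y 0)) \<or> (\<exists>j\<in>{1..k}. sig_diff n l y j < 0)"
  obtains x where "x \<in> seqs" "f_op n l x = Some y"
proof -
  let ?h = "sig_diff n l y"
  let ?min = "\<lambda>p. p \<in> {1..k} \<and> (\<forall>j\<in>{1..k}. ?h p \<le> ?h j)"
  have ex: "\<exists>p. ?min p"
  proof -
    have "Min (?h ` {1..k}) \<in> ?h ` {1..k}" using k by (intro Min_in) auto
    then obtain p where "p \<in> {1..k}" "?h p = Min (?h ` {1..k})" by auto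
    then show ?thesis by (intro exI[of _ p]) auto
  qed
  define p where "p = (LEAST p. ?min p)"
  have p: "p \<in> {1..k}" and pmin: "\<And>j. j \<in> {1..k} \<Longrightarrow> ?h p \<le> ?h j"
    using LeastI_ex[OF ex] by (auto simp: p_def)
  have pless: "?h p < ?h j" if "j \<in> {1..<p}" for j
  proof (rule ccontr)
    assume "\<not> ?h p < ?h j"
    then have "?h j \<le> ?h i" if "i \<in> {1..k}" for i using pmin[OF that] by linarith
    then have "?min j" using that p by auto
    then show False using not_less_Least[of j ?min] that by (simp add: p_def)
  qed
  define q where "q = p - 1"
  have q: "q < k" "p = Suc q" using p by (auto simp: q_def)
  let ?C = "comp_col (y q)"
  have pos: "0 < eps n l ?C"
  \<comment> \<open>If \<open>p = 1\<close>, the minimum is 0, which leaves the first alternative of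
    \<open>nhw\<close>; otherwise the difference drops strictly in the step to \<open>p\<close>, and
    only \<open>eps\<close> can cause that.\<close>
  proof (cases "q = 0")
    case True
    then show ?thesis using nhw pmin sig_diff_1[of l y] q by fastforce
  next
    case False
    then have "?h (Suc q) < ?h q" using pless[of q] q by simp
    then show ?thesis using sig_diff_Suc[OF y, of q l] False q l by simp
  qed
  have adm: "admissible n (d q) (e_col n l ?C)"
    by (rule admissible_e_col[OF seqs_admissible[OF y q(1)] l pos])
  have dq: "1 \<le> d q" "d q \<le> n" using d q by auto
  obtain ps s where ps: "ps \<in> Rseq n (d q) s" "column (d q) ps = e_col n l ?C"
    using admissible_Rseq[OF adm dq] .
  define x where "x = y(q := Elem (d q) ps)"
  have x: "x \<in> seqs" unfolding x_def by (rule seqs_update[OF y q(1) ps(1)])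
  have col: "comp_col (x q) = e_col n l ?C" "\<And>j. j \<noteq> q \<Longrightarrow> x j = y j"
    by (simp_all add: x_def ps)
  have phi: "phi n l (comp_col (x q)) = Suc (phi n l ?C)" and eps:
    "eps n l ?C = Suc (eps n l (comp_col (x q)))"
    unfolding col using phi_e_col[OF pos l] eps_e_col[OF pos l] by auto
  \<comment> \<open>The first component never enters \<open>tau\<close>, so for \<open>q = 0\<close>
    the smaller \<open>eps\<close> leaves the difference at \<open>p\<close> unchanged; otherwise it
    adds one from \<open>p\<close> on. The larger \<open>phi\<close> adds one more beyond
    \<open>p\<close>.\<close>
  define c0 :: int where "c0 = of_bool (q \<noteq> 0)"
  have hx: "sig_diff n l x j = ?h j + (if j < p then 0 else if j = p then c0 else c0 + 1)"
    if "1 \<le> j" "j \<le> k" for j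
    using that
  proof (induction j rule: nat_induct_at_least)
    case base
    show ?case using sig_diff_1[of l x] sig_diff_1[of l y] q by (auto simp: c0_def)
  next
    case (Suc j)
    have IH: "sig_diff n l x j = ?h j + (if j < p then 0 else if j = p then c0 else c0 + 1)"
      using Suc by simp
    note S = sig_diff_Suc[OF x Suc.hyps _ l] sig_diff_Suc[OF y Suc.hyps _ l]
    consider "Suc j < p" | "Suc j = p" | "j = p" | "p < j" by linarith
    then show ?case
    proof cases
      case 1
      then have "j - 1 \<noteq> q" "j \<noteq> q" using q by auto
      then show ?thesis using S IH Suc.prems 1 col(2) by simp
    next
      case 2
      then have "j - 1 \<noteq> q" "j = q" "q \<noteq> 0" using q Suc.hyps by auto
      then show ?thesis using S IH Suc.prems 2 col(2) eps by (simp add: c0_def)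
    next
      case 3
      then have "j - 1 = q" "j \<noteq> q" using q by auto
      then show ?thesis using S IH Suc.prems 3 col(2) phi by simp
    next
      case 4
      then have "j - 1 \<noteq> q" "j \<noteq> q" using q by auto
      then show ?thesis using S IH Suc.prems 4 col(2) by simp
    qed
  qed
  have c0: "0 \<le> c0" "c0 \<le> 1" by (auto simp: c0_def)
  have fi: "f_index n l x = p"
  proof (rule f_index_eqI[OF x p])
    fix j assume "j \<in> {1..<p}"
    then show "sig_diff n l x p \<le> sig_diff n l x j" using pless[of j] hx[of j] hx[of p] p c0 by auto
  next
    fix j assume "j \<in> {p<..k}"
    then show "sig_diff n l x p < sig_diff n l x j" using pmin[of j] hx[of j] hx[of p] p c0 by auto
  qed
  have "nz_pos x p = q" using nz_pos[OF x, of p] p q by simp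
  moreover have "0 < phi n l (column (d q) ps)" using phi by (simp add: x_def)
  then obtain qs where qs: "theta n l (d q) ps = Some (Elem (d q) qs)" "bisorted (d q) qs"
    "column (d q) qs = f_col n l (column (d q) ps)"
    using theta_column(2)[OF Rseq_bisorted[OF ps(1)] dq l] by blast
  moreover obtain ps' s' where ps': "y q = Elem (d q) ps'" "ps' \<in> Rseq n (d q) s'"
    using seqsE[OF y q(1)] by blast
  moreover have "column (d q) qs = column (d q) ps'"
    using f_col_e_col[OF pos l] unfolding qs(3) ps(2) ps'(1) by simp
  then have "qs = ps'" using column_inj[OF qs(2) Rseq_bisorted[OF ps'(2)]] by blast
  moreover have "x q = Elem (d q) ps" "x(q := Elem (d q) ps') = y"
    using ps'(1) by (auto simp: x_def)
  ultimately have "f_op n l x = Some y"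
    using k by (simp add: f_op_def nz_count[OF x] fi)
  with x show ?thesis by (rule that)
qed

text \<open>The measure for the descent along incoming arrows.\<close>

lemma f_op_sum_less:
  assumes "x \<in> seqs" "y \<in> seqs" "f_op n l x = Some y" "1 \<le> l" "l \<le> n"
  shows "(\<Sum>q<k. \<Sum>(comp_col (x q))) < (\<Sum>q<k. \<Sum>(comp_col (y q)))"
proof -
  obtain q where q: "q < k" "0 < phi n l (comp_col (x q))"
    "comp_col (y q) = f_col n l (comp_col (x q))" "\<And>p. p \<noteq> q \<Longrightarrow> y p = x p"
    using f_op_seqs[OF assms(1,3) seqs_R_inf[OF assms(2)] assms(4,5)] by metis
  have S: "\<Sum>(comp_col (y q)) = Suc (\<Sum>(comp_col (x q)))"
    unfolding q(3) by (rule sum_f_col[OF q(2) seqs_finite[OF assms(1) q(1)]])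
  show ?thesis
  proof (rule sum_strict_mono_ex1)
    show "\<forall>p\<in>{..<k}. \<Sum>(comp_col (x p)) \<le> \<Sum>(comp_col (y p))"
    proof
      fix p show "\<Sum>(comp_col (x p)) \<le> \<Sum>(comp_col (y p))" using S q(4) by (cases "p = q") auto
    qed
    show "\<exists>p\<in>{..<k}. \<Sum>(comp_col (x p)) < \<Sum>(comp_col (y p))"
      using S q(1) by (intro bexI[of _ q]) auto
  qed simp
qed

text \<open>Work from left to right. The components before \<open>q\<close> are initial columns of
  height at most \<open>e\<close>, which carry no signs for \<open>l > e\<close>; so the difference
  stays 0 up to \<open>q\<close>, and its next value forces \<open>eps\<close> of the column at
  \<open>q\<close> to vanish. Compatibility with the previous column puts \<open>{1..e}\<close> into
  this one, and \<open>admissible_eq_initial\<close> applies.\<close>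

lemma highest_weight_unique:
  assumes y: "y \<in> seqs" "pairs_compat y" and dmono: "\<And>q. q + 1 < k \<Longrightarrow> d q \<le> d (q + 1)"
    and hw: "\<And>l. 1 \<le> l \<Longrightarrow> l \<le> n \<Longrightarrow> eps n l (comp_col (y 0)) = 0"
      "\<And>l j. 1 \<le> l \<Longrightarrow> l \<le> n \<Longrightarrow> j \<in> {1..k} \<Longrightarrow> 0 \<le> sig_diff n l y j"
    and q: "q < k"
  shows "y q = Elem (d q) []"
  using q
proof (induction q rule: less_induct)
  case (less q)
  note dq = d[OF less.prems]
  \<comment> \<open>The height of the previous column; the value 0 for the first component makes
    every index \<open>l\<close> satisfy \<open>e < l\<close>.\<close>
  define e where "e = (if q = 0 then 0 else d (q - 1))"
  have mono: "d p \<le> e" if "p < q" for p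
  proof -
    have "d p \<le> d (q - 1)"
      by (rule dec_induct[where P = "\<lambda>z. z < q \<longrightarrow> d p \<le> d z" and i = p and j = "q - 1", rule_format])
        (use that less.prems dmono in \<open>auto intro: order_trans\<close>)
    then show ?thesis using that by (simp add: e_def)
  qed
  have eps0: "eps n l (comp_col (y q)) = 0" if l: "e < l" "l \<le> n" for l
  proof (cases "q = 0")
    case True
    then show ?thesis using hw(1) l by auto
  next
    case False
    have l1: "1 \<le> l" using l by simp
    have init: "phi n l (comp_col (y p)) = 0" "eps n l (comp_col (y p)) = 0" if "p < q" for p
      using less.IH[of p] that less.prems d[of p] mono[OF that] l
        phi_initial[of "d p" n l] eps_initial[of "d p" n l] by auto
    have "sig_diff n l y j = 0" if "1 \<le> j" "j \<le> q" for j
      using that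
    proof (induction j rule: nat_induct_at_least)
      case base
      then show ?case using sig_diff_1 by simp
    next
      case (Suc j)
      then show ?case
        using sig_diff_Suc[OF y(1) Suc.hyps _ l1 l(2)] init[of j] init[of "j - 1"] less.prems
          by auto
    qed
    then have "sig_diff n l y q = 0" using False by simp
    then show ?thesis
      using hw(2)[OF l1 l(2), of "Suc q"] sig_diff_Suc[OF y(1) _ less.prems l1 l(2)] init[of
        "q - 1"]
        False less.prems by auto
  qed
  have "{1..e} \<subseteq> comp_col (y q)"
  proof (cases "q = 0")
    case False
    then have "compat n (comp_col (y (q - 1))) (comp_col (y q))"
      using y(2) less.prems unfolding pairs_compat_def by (metis Suc_eq_plus1 Suc_diff_1 neq0_conv)
    moreover have "comp_col (y (q - 1)) = {1..e}"
      using less.IH[of "q - 1"] less.prems False by (simp add: e_def)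
    moreover have "e \<le> n" using d[of "q - 1"] less.prems False by (simp add: e_def)
    ultimately show ?thesis using compat_initial_subset by metis
  qed (simp add: e_def)
  then have "comp_col (y q) = {1..d q}"
    using admissible_eq_initial[OF seqs_admissible[OF y(1) less.prems]] dq eps0 by blast
  moreover obtain ps s where ps: "y q = Elem (d q) ps" "ps \<in> Rseq n (d q) s"
    using seqsE[OF y(1) less.prems] .
  ultimately have "column (d q) ps = column (d q) []" by simp
  then have "ps = []" by (rule column_inj[OF Rseq_bisorted[OF ps(2)], rotated]) (simp add:
    bisorted_def)
  with ps show ?case by simp
qed

end

section \<open>The connected component of the initial sequence\<close>

lemma length_r_seq: "length (concat (map (\<lambda>i. replicate (m i) (f i)) [1..<n + 1])) = (\<Sum>i=1..n. m i)"
  by (induction n) auto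

lemma sorted_concat_replicate: "sorted (concat (map (\<lambda>i. replicate (m i) i) [1..<n + 1]))"
  by (induction n) (auto simp: sorted_append)

theorem theorem5p2p1:
  fixes n k :: nat and m d :: "nat \<Rightarrow> nat"
  assumes "n \<ge> 1"
    and "k = (\<Sum>i=1..n. m i)"
    and "\<And>q. q < k \<Longrightarrow> d q \<in> {1..n} \<and> r_seq n m q = Elem (d q) []"
  shows "R_lambda n m =
    {x. (\<forall>q<k. x q \<in> (\<Union>s. Elem (d q) ` Rseq n (d q) s))
      \<and> (\<forall>q\<ge>k. x q = Zero)
      \<and> (\<forall>q i xs j ys. q + 1 < k \<longrightarrow> x q = Elem i xs \<longrightarrow> x (q + 1) = Elem j ys \<longrightarrow>
           cond1 i xs j ys \<and> cond2 i xs j ys \<and> cond3 n i xs j ys \<and> cond4 n i xs j ys)}"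
    (is "_ = ?D")
proof -
  interpret tensor n k d using assms by unfold_locales auto
  let ?is = "concat (map (\<lambda>i. replicate (m i) i) [1..<n + 1])" and ?r = "r_seq n m"
  \<comment> \<open>The list of heights is sorted, which yields \<open>d q \<le> d (q + 1)\<close>;
    the translation of conditions 1 to 4 relies on this order.\<close>
  have cs: "concat (map (\<lambda>i. replicate (m i) (Elem i [])) [1..<n + 1]) = map (\<lambda>i. Elem i []) ?is"
    by (simp add: map_concat comp_def)
  have len: "length ?is = k" using length_r_seq[where f = "\<lambda>i. i"] assms(2) by simp
  have rq: "?r q = (if q < k then Elem (?is ! q) [] else Zero)" for q
    unfolding r_seq_def cs Let_def using len by simp
  have dmono: "d q \<le> d (q + 1)" if "q + 1 < k" for q
    using assms(3)[of q] assms(3)[of "q + 1"] that rq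
      sorted_nth_mono[OF sorted_concat_replicate[of m n], of q "q + 1"] len by simp
  have Nil: "[] \<in> Rseq n i 0" for i by (simp add: Rseq_def)
  have r_seqs: "?r \<in> seqs"
    unfolding seqs_def
  proof (intro CollectI conjI allI impI)
    fix q assume "q < k"
    then have "?r q = Elem (d q) []" using assms(3) by blast
    with Nil show "?r q \<in> (\<Union>s. Elem (d q) ` Rseq n (d q) s)" by blast
  qed (simp add: rq)
  have D: "?D = {x \<in> seqs. pairs_compat x}"
  proof -
    have *: "(\<forall>i xs j ys. x q = Elem i xs \<longrightarrow> x (q + 1) = Elem j ys \<longrightarrow>
        cond1 i xs j ys \<and> cond2 i xs j ys \<and> cond3 n i xs j ys \<and> cond4 n i xs j ys)
      \<longleftrightarrow> compat n (comp_col (x q)) (comp_col (x (q + 1)))" if x: "x \<in> seqs" and q: "q + 1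
          < k" for x q
    proof -
      obtain xs s where xs: "x q = Elem (d q) xs" "xs \<in> Rseq n (d q) s"
        using seqsE[OF x, of q] q by auto
      obtain ys t where ys: "x (q + 1) = Elem (d (q + 1)) ys" "ys \<in> Rseq n (d (q + 1)) t"
        using seqsE[OF x q] .
      show ?thesis
        using conds_iff_compat[OF xs(2) ys(2)] d[of q] d[OF q] dmono[OF q] q xs(1) ys(1) by auto
    qed
    show ?thesis
    proof (intro set_eqI iffI)
      fix x assume x: "x \<in> ?D"
      then have "x \<in> seqs" unfolding seqs_def by simp
      with x * show "x \<in> {x \<in> seqs. pairs_compat x}" unfolding pairs_compat_def by blast
    next
      fix x assume "x \<in> {x \<in> seqs. pairs_compat x}"
      then have x: "x \<in> seqs" "pairs_compat x" by auto
      then have "\<forall>q i xs j ys. q + 1 < k \<longrightarrow> x q = Elem i xs \<longrightarrow> x (q + 1) = Elem j ys \<longrightarrow>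
           cond1 i xs j ys \<and> cond2 i xs j ys \<and> cond3 n i xs j ys \<and> cond4 n i xs j ys"
        using * unfolding pairs_compat_def by blast
      with x(1) show "x \<in> ?D" unfolding seqs_def by simp
    qed
  qed
  have r_D: "?r \<in> ?D"
  proof (intro CollectI conjI)
    show "\<forall>q<k. ?r q \<in> (\<Union>s. Elem (d q) ` Rseq n (d q) s)" "\<forall>q\<ge>k. ?r q = Zero"
      using r_seqs unfolding seqs_def by blast+
    show "\<forall>q i xs j ys. q + 1 < k \<longrightarrow> ?r q = Elem i xs \<longrightarrow> ?r (q + 1) = Elem j ys \<longrightarrow>
           cond1 i xs j ys \<and> cond2 i xs j ys \<and> cond3 n i xs j ys \<and> cond4 n i xs j ys"
    proof (intro allI impI)
      fix q i xs j ys assume "q + 1 < k" "?r q = Elem i xs" "?r (q + 1) = Elem j ys"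
      then have "xs = []" "ys = []" using rq[of q] rq[of "q + 1"] by simp_all
      then show "cond1 i xs j ys \<and> cond2 i xs j ys \<and> cond3 n i xs j ys \<and> cond4 n i xs j ys"
        by (simp add: cond1_def cond2_def cond3_def cond4_def)
    qed
  qed
  \<comment> \<open>Connectedness is meant along undirected paths, so invariance is needed in both
    directions of an arrow.\<close>
  have closed: "x \<in> ?D \<longleftrightarrow> y \<in> ?D" if arrow: "f_arrow n x y" for x y
  proof -
    obtain l where l: "x \<in> R_inf n" "y \<in> R_inf n" "1 \<le> l" "l \<le> n" "f_op n l x = Some y"
      using arrow by (auto simp: f_arrow_def)
    show ?thesis
      unfolding D using f_op_pairs_compat[OF _ l(5,2,3,4)] f_op_seqs_source[OF _ l(5,1)] by blast
  qed
  have D_if_connected: "x \<in> ?D" if "equivclp (f_arrow n) ?r x" for x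
    using that
  proof (induction rule: equivclp_induct)
    case base
    show ?case by (rule r_D)
  next
    case (step y z)
    from step.hyps(2) show ?case
    proof
      assume "f_arrow n y z"
      from iffD1[OF closed[OF this] step.IH] show ?case .
    next
      assume "f_arrow n z y"
      from iffD2[OF closed[OF this] step.IH] show ?case .
    qed
  qed
  \<comment> \<open>Descent: every element of \<open>?D\<close> other than \<open>?r\<close> has an
    incoming arrow, and its source lies in \<open>?D\<close> and has a smaller sum of
    letters.\<close>
  have connected_if_D: "equivclp (f_arrow n) ?r y" if "y \<in> ?D" for y
    using that
  proof (induction "\<Sum>q<k. \<Sum>(comp_col (y q))" arbitrary: y rule: less_induct)
    case less
    have y: "y \<in> seqs" "pairs_compat y" using less.prems unfolding D by auto
    show ?case
    proof (cases "y = ?r")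
      case False
      have "\<exists>q<k. y q \<noteq> Elem (d q) []"
      proof (rule ccontr)
        assume "\<not> (\<exists>q<k. y q \<noteq> Elem (d q) [])"
        then have "y q = ?r q" for q
          using assms(3)[of q] rq[of q] y(1) by (cases "q < k") (auto simp: seqs_def)
        then show False using False by blast
      qed
      then obtain q where q: "q < k" "y q \<noteq> Elem (d q) []" by blast
      \<comment> \<open>Otherwise \<open>y\<close> would be of highest weight, and then all its
        components would be empty sequences.\<close>
      have "\<exists>l. 1 \<le> l \<and> l \<le> n \<and>
          (0 < eps n l (comp_col (y 0)) \<or> (\<exists>j\<in>{1..k}. sig_diff n l y j < 0))"
      proof (rule ccontr)
        assume hw: "\<not> ?thesis"
        have "eps n l (comp_col (y 0)) = 0" if "1 \<le> l" "l \<le> n" for l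
          using hw that by auto
        moreover have "0 \<le> sig_diff n l y j" if "1 \<le> l" "l \<le> n" "j \<in> {1..k}" for l j
          using hw that by (meson not_less)
        ultimately have "y q = Elem (d q) []"
          by (intro highest_weight_unique[OF y _ _ _ q(1)]) (auto simp: dmono[simplified])
        then show False using q(2) by simp
      qed
      then obtain l where l: "1 \<le> l" "l \<le> n"
        "0 < eps n l (comp_col (y 0)) \<or> (\<exists>j\<in>{1..k}. sig_diff n l y j < 0)"
        by blast
      have "0 < k" using q by simp
      then obtain x where x: "x \<in> seqs" "f_op n l x = Some y"
        by (rule exists_f_op_preimage[OF y(1) l(1,2) _ l(3)])
      have arrow: "f_arrow n x y"
        using l x(2) seqs_R_inf[OF x(1)] seqs_R_inf[OF y(1)] unfolding f_arrow_def by auto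
      have "equivclp (f_arrow n) ?r x"
        by (rule less.hyps[OF f_op_sum_less[OF x(1) y(1) x(2) l(1,2)]
              iffD2[OF closed[OF arrow] less.prems]])
      then show ?thesis using arrow equivclp_into_equivclp[of "f_arrow n" ?r x y] by simp
    qed simp
  qed
  show ?thesis
    unfolding R_lambda_def
  proof (intro set_eqI iffI)
    fix x assume "x \<in> {x. equivclp (f_arrow n) ?r x}"
    then have "equivclp (f_arrow n) ?r x" by (rule CollectD)
    then show "x \<in> ?D" by (rule D_if_connected)
  next
    fix x assume "x \<in> ?D"
    then have "equivclp (f_arrow n) ?r x" by (rule connected_if_D)
    then show "x \<in> {x. equivclp (f_arrow n) ?r x}" by (simp only: mem_Collect_eq)
  qed
qed

end
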